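(* Let $\mathcal{T}$ be a tube of rank $n\ge1$ and $\mathcal{C}_{\mathcal{T}}$ its cluster category. Then $\mathcal{C}_{\mathcal{T}}$ has no cluster-tilting objects.
   Context: Let $k$ be a field. The tube $\mathcal{T}=\mathcal{T}_n$ of rank $n$ is the category of finite-dimensional nilpotent $k$-representations of the quiver with underlying graph $\tilde A_{n-1}$ and cyclic orientation; it is a Hom-finite hereditary abelian category, with Auslander-Reiten translation $\tau$. The cluster category (cluster tube) is the orbit category $\mathcal{C}_{\mathcal{T}}=\mathcal{D}^b(\mathcal{T})/\tau^{-1}[1]$; it is a triangulated 2-Calabi-Yau category such that the canonical functor from $\mathcal{D}^b(\mathcal{T})$ is a triangle functor. A rigid object $C$ (i.e. $\operatorname{Ext}^1(C,C)=\operatorname{Hom}(C,C[1])=0$) in a triangulated 2-CY category is called cluster-tilting if $\operatorname{Ext}^1(C,X)=0$ implies $X\in\operatorname{add}C$. *)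

theory Defs
  imports "Jordan_Normal_Form.Matrix"
begin

section \<open>Preadditive categories with a shift\<close>

text \<open>A category is given by its set of objects and, for any two objects, a set of morphisms with
  a composition, identities, an addition and zero morphisms. Compositions carry the three objects
  involved: \<open>Cmp \<C> X Y Z g f\<close> is $g \circ f$ for $f : X \to Y$ and $g : Y \to Z$.\<close>

record ('o, 'm) precat =
  Obj :: "'o set"
  Hom :: "'o \<Rightarrow> 'o \<Rightarrow> 'm set"
  Cmp :: "'o \<Rightarrow> 'o \<Rightarrow> 'o \<Rightarrow> 'm \<Rightarrow> 'm \<Rightarrow> 'm"
  Idn :: "'o \<Rightarrow> 'm"
  Add :: "'o \<Rightarrow> 'o \<Rightarrow> 'm \<Rightarrow> 'm \<Rightarrow> 'm"
  Zer :: "'o \<Rightarrow> 'o \<Rightarrow> 'm"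

definition Sum_hom :: "('o, 'm) precat \<Rightarrow> 'o \<Rightarrow> 'o \<Rightarrow> 'm list \<Rightarrow> 'm" where
  "Sum_hom \<C> X Y fs = foldr (Add \<C> X Y) fs (Zer \<C> X Y)"

definition is_direct_sum :: "('o, 'm) precat \<Rightarrow> 'o list \<Rightarrow> 'o \<Rightarrow> bool" where
  "is_direct_sum \<C> Xs P \<longleftrightarrow> P \<in> Obj \<C> \<and> set Xs \<subseteq> Obj \<C> \<and>
     (\<exists>\<iota> \<pi>.
        (\<forall>j < length Xs. \<iota> j \<in> Hom \<C> (Xs ! j) P \<and> \<pi> j \<in> Hom \<C> P (Xs ! j)) \<and>
        (\<forall>j < length Xs. Cmp \<C> (Xs ! j) P (Xs ! j) (\<pi> j) (\<iota> j) = Idn \<C> (Xs ! j)) \<and>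
        (\<forall>j < length Xs. \<forall>l < length Xs. j \<noteq> l \<longrightarrow>
           Cmp \<C> (Xs ! j) P (Xs ! l) (\<pi> l) (\<iota> j) = Zer \<C> (Xs ! j) (Xs ! l)) \<and>
        Sum_hom \<C> P P (map (\<lambda>j. Cmp \<C> P (Xs ! j) P (\<iota> j) (\<pi> j)) [0..<length Xs]) = Idn \<C> P)"

text \<open>\<open>add C\<close>: the direct summands of finite direct sums of copies of \<open>C\<close>. The case \<open>m = 0\<close> gives
  the zero objects.\<close>

definition add_closure :: "('o, 'm) precat \<Rightarrow> 'o \<Rightarrow> 'o set" where
  "add_closure \<C> C =
     {X. \<exists>Y P m. is_direct_sum \<C> (replicate m C) P \<and> is_direct_sum \<C> [X, Y] P}"

text \<open>Here \<open>sh\<close> is the action of the shift functor $[1]$ on objects; by definition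
  $\mathrm{Ext}^1(X,Y) = \mathrm{Hom}(X, Y[1])$.\<close>

definition Ext1_vanishes :: "('o, 'm) precat \<Rightarrow> ('o \<Rightarrow> 'o) \<Rightarrow> 'o \<Rightarrow> 'o \<Rightarrow> bool" where
  "Ext1_vanishes \<C> sh X Y \<longleftrightarrow> Hom \<C> X (sh Y) = {Zer \<C> X (sh Y)}"

definition rigid :: "('o, 'm) precat \<Rightarrow> ('o \<Rightarrow> 'o) \<Rightarrow> 'o \<Rightarrow> bool" where
  "rigid \<C> sh C \<longleftrightarrow> C \<in> Obj \<C> \<and> Ext1_vanishes \<C> sh C C"

definition cluster_tilting :: "('o, 'm) precat \<Rightarrow> ('o \<Rightarrow> 'o) \<Rightarrow> 'o \<Rightarrow> bool" where
  "cluster_tilting \<C> sh C \<longleftrightarrow>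
     rigid \<C> sh C \<and> (\<forall>X \<in> Obj \<C>. Ext1_vanishes \<C> sh C X \<longrightarrow> X \<in> add_closure \<C> C)"

text \<open>The orbit category of \<open>\<D>\<close> by a strict automorphism $F$. The parameters are the integral powers
  of $F$: \<open>Fo m X\<close> is $F^m X$ and \<open>Fm m X Y f\<close> is $F^m f$ for $f : X \to Y$. Morphisms
  from $X$ to $Y$ are the elements of $\bigoplus_{m} \mathrm{Hom}(X, F^m Y)$, with
  $(\psi \circ \varphi)_m = \sum_{a} F^a(\psi_{m-a}) \circ \varphi_a$.\<close>

definition orbit_cat ::
  "('o, 'm) precat \<Rightarrow> (int \<Rightarrow> 'o \<Rightarrow> 'o) \<Rightarrow> (int \<Rightarrow> 'o \<Rightarrow> 'o \<Rightarrow> 'm \<Rightarrow> 'm) \<Rightarrow> ('o, int \<Rightarrow> 'm) precat" where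
  "orbit_cat \<D> Fo Fm = \<lparr>
     Obj = Obj \<D>,
     Hom = (\<lambda>X Y. {\<phi>. (\<forall>m. \<phi> m \<in> Hom \<D> X (Fo m Y)) \<and> finite {m. \<phi> m \<noteq> Zer \<D> X (Fo m Y)}}),
     Cmp = (\<lambda>X Y Z \<psi> \<phi> m. Sum_hom \<D> X (Fo m Z)
              (map (\<lambda>a. Cmp \<D> X (Fo a Y) (Fo m Z) (Fm a Y (Fo (m - a) Z) (\<psi> (m - a))) (\<phi> a))
                (sorted_list_of_set {a. \<phi> a \<noteq> Zer \<D> X (Fo a Y)}))),
     Idn = (\<lambda>X m. if m = 0 then Idn \<D> X else Zer \<D> X (Fo m X)),
     Add = (\<lambda>X Y \<phi> \<psi> m. Add \<D> X (Fo m Y) (\<phi> m) (\<psi> m)),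
     Zer = (\<lambda>X Y m. Zer \<D> X (Fo m Y)) \<rparr>"


section \<open>The tube of rank n\<close>

text \<open>Representations of the cyclic quiver with vertices $0, \dots, n-1$ and arrows
  $i \to i+1 \pmod n$. The finite-dimensional vector space at vertex $i$ is $k^{d_i}$ with
  $d_i$ = \<open>dimv V i\<close>, linear maps being matrices acting on column vectors; every finite-dimensional
  representation is isomorphic to one of these. Values at indices \<open>i \<ge> n\<close> are never looked at.\<close>

record 'k rep =
  dimv :: "nat \<Rightarrow> nat"
  arr :: "nat \<Rightarrow> 'k mat"

definition is_rep :: "nat \<Rightarrow> 'k rep \<Rightarrow> bool" where
  "is_rep n V \<longleftrightarrow> (\<forall>i < n. arr V i \<in> carrier_mat (dimv V (Suc i mod n)) (dimv V i))"

text \<open>The linear map along the path of length \<open>l\<close> that starts at vertex \<open>i\<close>.\<close>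

fun path_mat :: "nat \<Rightarrow> 'k::field rep \<Rightarrow> nat \<Rightarrow> nat \<Rightarrow> 'k mat" where
  "path_mat n V i 0 = 1\<^sub>m (dimv V i)"
| "path_mat n V i (Suc l) = arr V ((i + l) mod n) * path_mat n V i l"

definition nilpotent_rep :: "nat \<Rightarrow> 'k::field rep \<Rightarrow> bool" where
  "nilpotent_rep n V \<longleftrightarrow>
     (\<exists>l. \<forall>i < n. path_mat n V i l = 0\<^sub>m (dimv V ((i + l) mod n)) (dimv V i))"

definition tube :: "nat \<Rightarrow> 'k::field rep set" where
  "tube n = {V. is_rep n V \<and> nilpotent_rep n V}"

definition rep_hom :: "nat \<Rightarrow> 'k::field rep \<Rightarrow> 'k rep \<Rightarrow> (nat \<Rightarrow> 'k mat) set" where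
  "rep_hom n V W =
     {f. \<forall>i < n. f i \<in> carrier_mat (dimv W i) (dimv V i) \<and>
                 f (Suc i mod n) * arr V i = arr W i * f i}"

text \<open>The Auslander-Reiten translation $\tau$ of the tube is induced by the rotation of the quiver,
  $(\tau V)_i = V_{i-1}$; on simples, $\tau S_i = S_{i+1}$, in accordance with the nonsplit extensions
  in $\mathrm{Ext}^1(S_i, S_{i+1})$ that come from the arrows $i \to i+1$. See the Auslander-Reiten
  formula below. The function \<open>tau_rep n m\<close> is the integral power $\tau^m$.\<close>

definition vertex_shift :: "nat \<Rightarrow> int \<Rightarrow> nat \<Rightarrow> nat" where
  "vertex_shift n m i = nat ((int i - m) mod int n)"

definition tau_rep :: "nat \<Rightarrow> int \<Rightarrow> 'k rep \<Rightarrow> 'k rep" where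
  "tau_rep n m V = \<lparr> dimv = (\<lambda>i. dimv V (vertex_shift n m i)),
                     arr = (\<lambda>i. arr V (vertex_shift n m i)) \<rparr>"


section \<open>Bounded complexes\<close>

text \<open>Complexes are cohomological: \<open>df X p\<close> is the differential $X^p \to X^{p+1}$. Graded families
  of maps take a degree and a vertex.\<close>

type_synonym 'k gmap = "int \<Rightarrow> nat \<Rightarrow> 'k mat"

record 'k cpx =
  ob :: "int \<Rightarrow> 'k rep"
  df :: "'k gmap"

definition is_cpx :: "nat \<Rightarrow> 'k::field cpx \<Rightarrow> bool" where
  "is_cpx n X \<longleftrightarrow>
     (\<forall>p. ob X p \<in> tube n) \<and>
     (\<forall>p. df X p \<in> rep_hom n (ob X p) (ob X (p + 1))) \<and>
     (\<forall>p. \<forall>i < n. df X (p + 1) i * df X p i = 0\<^sub>m (dimv (ob X (p + 2)) i) (dimv (ob X p) i)) \<and>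
     (\<exists>b. \<forall>p. \<bar>p\<bar> > b \<longrightarrow> (\<forall>i < n. dimv (ob X p) i = 0))"

definition chain_map :: "nat \<Rightarrow> 'k::field cpx \<Rightarrow> 'k cpx \<Rightarrow> 'k gmap \<Rightarrow> bool" where
  "chain_map n X Y f \<longleftrightarrow>
     (\<forall>p. f p \<in> rep_hom n (ob X p) (ob Y p)) \<and>
     (\<forall>p. \<forall>i < n. f (p + 1) i * df X p i = df Y p i * f p i)"

definition homotopic :: "nat \<Rightarrow> 'k::field cpx \<Rightarrow> 'k cpx \<Rightarrow> 'k gmap \<Rightarrow> 'k gmap \<Rightarrow> bool" where
  "homotopic n X Y f g \<longleftrightarrow>
     (\<exists>h. (\<forall>p. h p \<in> rep_hom n (ob X p) (ob Y (p - 1))) \<and>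
          (\<forall>p. \<forall>i < n. f p i - g p i = df Y (p - 1) i * h p i + h (p + 1) i * df X p i))"

definition comp_map :: "'k::field gmap \<Rightarrow> 'k gmap \<Rightarrow> 'k gmap" (infixl "\<circ>\<^sub>g" 70) where
  "(f \<circ>\<^sub>g g) p i = f p i * g p i"

definition add_map :: "'k::field gmap \<Rightarrow> 'k gmap \<Rightarrow> 'k gmap" (infixl "+\<^sub>g" 65) where
  "(f +\<^sub>g g) p i = f p i + g p i"

definition id_map :: "'k::field cpx \<Rightarrow> 'k gmap" where
  "id_map X p i = 1\<^sub>m (dimv (ob X p) i)"

definition zero_map :: "'k::field cpx \<Rightarrow> 'k cpx \<Rightarrow> 'k gmap" where
  "zero_map X Y p i = 0\<^sub>m (dimv (ob Y p) i) (dimv (ob X p) i)"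

definition cocycles :: "'k::field cpx \<Rightarrow> int \<Rightarrow> nat \<Rightarrow> 'k vec set" where
  "cocycles X p i = {x \<in> carrier_vec (dimv (ob X p) i). df X p i *\<^sub>v x = 0\<^sub>v (dimv (ob X (p + 1)) i)}"

definition coboundaries :: "'k::field cpx \<Rightarrow> int \<Rightarrow> nat \<Rightarrow> 'k vec set" where
  "coboundaries X p i = (\<lambda>y. df X (p - 1) i *\<^sub>v y) ` carrier_vec (dimv (ob X (p - 1)) i)"

text \<open>A quasi-isomorphism is a chain map for which all induced maps
  $H^p(f)_i : H^p(X)_i \to H^p(Y)_i$ are injective and surjective; cohomology is computed
  vertexwise.\<close>

definition quasi_iso :: "nat \<Rightarrow> 'k::field cpx \<Rightarrow> 'k cpx \<Rightarrow> 'k gmap \<Rightarrow> bool" where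
  "quasi_iso n X Y f \<longleftrightarrow> chain_map n X Y f \<and>
     (\<forall>p. \<forall>i < n.
        (\<forall>x \<in> cocycles X p i. f p i *\<^sub>v x \<in> coboundaries Y p i \<longrightarrow> x \<in> coboundaries X p i) \<and>
        (\<forall>y \<in> cocycles Y p i. \<exists>x \<in> cocycles X p i. y - f p i *\<^sub>v x \<in> coboundaries Y p i))"


section \<open>The bounded derived category\<close>

text \<open>The localization of the bounded homotopy category at the quasi-isomorphisms. A morphism
  $X \to Y$ is an equivalence class of roofs $X \leftarrow Z \to Y$, the left leg being a
  quasi-isomorphism. The legs are chain maps that represent morphisms of the homotopy category,
  so diagrams of roofs are only required to commute up to homotopy.\<close>

type_synonym 'k roof = "'k cpx \<times> 'k gmap \<times> 'k gmap"

definition roofs :: "nat \<Rightarrow> 'k::field cpx \<Rightarrow> 'k cpx \<Rightarrow> 'k roof set" where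
  "roofs n X Y = {(Z, s, f). is_cpx n Z \<and> quasi_iso n Z X s \<and> chain_map n Z Y f}"

definition roof_equiv :: "nat \<Rightarrow> 'k::field cpx \<Rightarrow> 'k cpx \<Rightarrow> 'k roof \<Rightarrow> 'k roof \<Rightarrow> bool" where
  "roof_equiv n X Y = (\<lambda>(Z, s, f) (Z', s', f').
     \<exists>W u u'. is_cpx n W \<and> chain_map n W Z u \<and> chain_map n W Z' u' \<and>
       quasi_iso n W X (s \<circ>\<^sub>g u) \<and>
       homotopic n W X (s \<circ>\<^sub>g u) (s' \<circ>\<^sub>g u') \<and> homotopic n W Y (f \<circ>\<^sub>g u) (f' \<circ>\<^sub>g u'))"

definition roof_class :: "nat \<Rightarrow> 'k::field cpx \<Rightarrow> 'k cpx \<Rightarrow> 'k roof \<Rightarrow> 'k roof set" where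
  "roof_class n X Y r = {r' \<in> roofs n X Y. roof_equiv n X Y r r'}"

text \<open>The operations on classes are defined as the union of the classes of all results obtained
  from representatives and auxiliary choices; by the calculus of fractions this union is a single
  class. Composition uses an Ore square $f \circ u \simeq t \circ v$; two roofs with
  the same left leg are added by adding their right legs, and any two morphisms admit
  such representatives.\<close>

definition derived_cat :: "nat \<Rightarrow> ('k::field cpx, 'k roof set) precat" where
  "derived_cat n = \<lparr>
     Obj = {X. is_cpx n X},
     Hom = (\<lambda>X Y. roof_class n X Y ` roofs n X Y),
     Cmp = (\<lambda>X Y Z \<psi> \<phi>. \<Union> {roof_class n X Z (W, s \<circ>\<^sub>g u, g \<circ>\<^sub>g v) | W u v A s f B t g.
              (A, s, f) \<in> \<phi> \<and> (B, t, g) \<in> \<psi> \<and> is_cpx n W \<and>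
              quasi_iso n W A u \<and> chain_map n W B v \<and> homotopic n W Y (f \<circ>\<^sub>g u) (t \<circ>\<^sub>g v)}),
     Idn = (\<lambda>X. roof_class n X X (X, id_map X, id_map X)),
     Add = (\<lambda>X Y \<phi> \<psi>. \<Union> {roof_class n X Y (Z, s, f +\<^sub>g g) | Z s f g.
              (Z, s, f) \<in> \<phi> \<and> (Z, s, g) \<in> \<psi>}),
     Zer = (\<lambda>X Y. roof_class n X Y (X, id_map X, zero_map X Y)) \<rparr>"

text \<open>The powers of the shift, $X[m]^p = X^{p+m}$ with differential multiplied by $(-1)^m$, and the
  powers of $\tau$, applied degreewise.\<close>

definition shift_cpx :: "int \<Rightarrow> 'k::field cpx \<Rightarrow> 'k cpx" where
  "shift_cpx m X = \<lparr> ob = (\<lambda>p. ob X (p + m)),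
                     df = (\<lambda>p i. if even m then df X (p + m) i else - df X (p + m) i) \<rparr>"

definition shift_map :: "int \<Rightarrow> 'k gmap \<Rightarrow> 'k gmap" where
  "shift_map m f p i = f (p + m) i"

definition tau_cpx :: "nat \<Rightarrow> int \<Rightarrow> 'k cpx \<Rightarrow> 'k cpx" where
  "tau_cpx n m X = \<lparr> ob = (\<lambda>p. tau_rep n m (ob X p)),
                     df = (\<lambda>p i. df X p (vertex_shift n m i)) \<rparr>"

definition tau_map :: "nat \<Rightarrow> int \<Rightarrow> 'k gmap \<Rightarrow> 'k gmap" where
  "tau_map n m f p i = f p (vertex_shift n m i)"

text \<open>The $m$-th power of $F = \tau^{-1}[1]$.\<close>

definition F_cpx :: "nat \<Rightarrow> int \<Rightarrow> 'k::field cpx \<Rightarrow> 'k cpx" where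
  "F_cpx n m X = shift_cpx m (tau_cpx n (- m) X)"

definition F_map :: "nat \<Rightarrow> int \<Rightarrow> 'k gmap \<Rightarrow> 'k gmap" where
  "F_map n m f = shift_map m (tau_map n (- m) f)"

definition F_class :: "nat \<Rightarrow> int \<Rightarrow> 'k::field cpx \<Rightarrow> 'k cpx \<Rightarrow> 'k roof set \<Rightarrow> 'k roof set" where
  "F_class n m X Y \<phi> =
     \<Union> {roof_class n (F_cpx n m X) (F_cpx n m Y) (F_cpx n m Z, F_map n m s, F_map n m f) | Z s f.
         (Z, s, f) \<in> \<phi>}"

definition cluster_tube :: "nat \<Rightarrow> ('k::field cpx, int \<Rightarrow> 'k roof set) precat" where
  "cluster_tube n = orbit_cat (derived_cat n) (F_cpx n) (F_class n)"


section \<open>Checks of the encoding\<close>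

text \<open>$F$ is a strict automorphism: $F^a F^b = F^{a+b}$ on the nose, and $F^0$ is the identity up to
  the irrelevant values at indices \<open>i \<ge> n\<close>.\<close>

lemma vertex_shift_less: "n > 0 \<Longrightarrow> vertex_shift n m i < n"
  by (simp add: vertex_shift_def nat_less_iff)

lemma vertex_shift_0: "i < n \<Longrightarrow> vertex_shift n 0 i = i"
  by (simp add: vertex_shift_def)

lemma vertex_shift_add:
  "n > 0 \<Longrightarrow> vertex_shift n a (vertex_shift n b i) = vertex_shift n (a + b) i"
  by (simp add: vertex_shift_def mod_diff_left_eq algebra_simps)

lemma F_cpx_add: "n > 0 \<Longrightarrow> F_cpx n a (F_cpx n b X) = F_cpx n (a + b) X"
  by (auto simp: F_cpx_def shift_cpx_def tau_cpx_def tau_rep_def vertex_shift_add algebra_simps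
      fun_eq_iff)

lemma F_map_add: "n > 0 \<Longrightarrow> F_map n a (F_map n b f) = F_map n (a + b) f"
  by (auto simp: F_map_def shift_map_def tau_map_def vertex_shift_add algebra_simps fun_eq_iff)

text \<open>The Auslander-Reiten formula $D\,\mathrm{Ext}^1(V,W) \cong \mathrm{Hom}(W, \tau V)$. Here
  $\mathrm{Ext}^1(V,W)$ is the cokernel of
  $\bigoplus_i \mathrm{Hom}(V_i,W_i) \to \bigoplus_i \mathrm{Hom}(V_i,W_{i+1})$,
  $f \mapsto (f_{i+1} A_i - B_i f_i)_i$, with $A$ and $B$ the arrows of $V$ and $W$. The trace form
  identifies the dual of the target with $\bigoplus_i \mathrm{Hom}(W_{i+1}, V_i)$, and the
  annihilator of the image is $\mathrm{Hom}(W, \tau V)$.\<close>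

definition mat_trace :: "'k::field mat \<Rightarrow> 'k" where
  "mat_trace M = (\<Sum>j < dim_row M. M $$ (j, j))"

lemma mat_trace_mult:
  assumes "M \<in> carrier_mat a b" "N \<in> carrier_mat b a"
  shows "mat_trace (M * N) = (\<Sum>j<a. \<Sum>l<b. M $$ (j, l) * N $$ (l, j))"
  using assms by (auto simp: mat_trace_def scalar_prod_def lessThan_atLeast0 intro!: sum.cong)

lemma mat_trace_comm:
  assumes "M \<in> carrier_mat a b" "N \<in> carrier_mat b a"
  shows "mat_trace (M * N) = mat_trace (N * M)"
  unfolding mat_trace_mult[OF assms] mat_trace_mult[OF assms(2,1)]
  by (subst sum.swap) (simp add: mult.commute)

lemma mat_trace_diff:
  assumes "M \<in> carrier_mat a a" "N \<in> carrier_mat a a"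
  shows "mat_trace (M - N) = mat_trace M - mat_trace N"
  using assms by (auto simp: mat_trace_def sum_subtractf)

lemma mat_trace_nondegenerate:
  assumes M: "M \<in> carrier_mat a b"
    and 0: "\<And>N. N \<in> carrier_mat b a \<Longrightarrow> mat_trace (M * N) = 0"
  shows "M = 0\<^sub>m a b"
proof (rule eq_matI)
  fix i j assume ij: "i < dim_row (0\<^sub>m a b :: 'a mat)" "j < dim_col (0\<^sub>m a b :: 'a mat)"
  define N :: "'a mat" where "N = mat b a (\<lambda>(r, c). if r = j \<and> c = i then 1 else 0)"
  have N: "N \<in> carrier_mat b a" by (simp add: N_def)
  have "0 = (\<Sum>r<a. \<Sum>c<b. M $$ (r, c) * N $$ (c, r))"
    using 0[OF N] mat_trace_mult[OF M N] by simp
  also have "\<dots> = (\<Sum>r<a. \<Sum>c<b. if c = j then (if r = i then M $$ (r, c) else 0) else 0)"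
    by (intro sum.cong refl) (auto simp: N_def)
  also have "\<dots> = M $$ (i, j)" using ij by simp
  finally show "M $$ (i, j) = (0\<^sub>m a b) $$ (i, j)" using ij by simp
qed (use M in auto)

theorem auslander_reiten_formula:
  fixes V W :: "'k::field rep"
  assumes n: "n > 0" and V: "is_rep n V" and W: "is_rep n W"
    and g: "\<forall>i < n. g i \<in> carrier_mat (dimv (tau_rep n 1 V) i) (dimv W i)"
  shows "g \<in> rep_hom n W (tau_rep n 1 V) \<longleftrightarrow>
    (\<forall>f. (\<forall>i < n. f i \<in> carrier_mat (dimv W i) (dimv V i)) \<longrightarrow>
      (\<Sum>i<n. mat_trace (g (Suc i mod n) * (f (Suc i mod n) * arr V i - arr W i * f i))) = 0)"
proof -
  define s where "s i = Suc i mod n" for i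
  define p where "p = vertex_shift n 1"
  have s: "s i < n" for i using n by (simp add: s_def)
  have p: "p i < n" for i using n by (simp add: p_def vertex_shift_less)
  have s': "s i = vertex_shift n (-1) i" for i
    unfolding s_def vertex_shift_def using n by (simp add: nat_mod_as_int add.commute)
  have sp: "s (p i) = i" and ps: "p (s i) = i" if "i < n" for i
    using n that by (simp_all add: s' p_def vertex_shift_add vertex_shift_0)
  have A: "arr V i \<in> carrier_mat (dimv V (s i)) (dimv V i)"
    and B: "arr W i \<in> carrier_mat (dimv W (s i)) (dimv W i)" if "i < n" for i
    using V W that by (auto simp: is_rep_def s_def)
  have G: "g i \<in> carrier_mat (dimv V (p i)) (dimv W i)" if "i < n" for i
    using g that by (simp add: tau_rep_def p_def)
  define M where "M i = arr V (p i) * g i - g (s i) * arr W i" for i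
  have AG: "arr V (p i) * g i \<in> carrier_mat (dimv V i) (dimv W i)" if "i < n" for i
    using A[OF p, of i] G[OF that] by (simp add: sp that)
  have GB: "g (s i) * arr W i \<in> carrier_mat (dimv V i) (dimv W i)" if "i < n" for i
    using G[OF s, of i] B[OF that] by (simp add: ps that)
  have M: "M i \<in> carrier_mat (dimv V i) (dimv W i)" if "i < n" for i
    using AG[OF that] GB[OF that] by (simp add: M_def minus_carrier_mat)
  have hom: "g \<in> rep_hom n W (tau_rep n 1 V) \<longleftrightarrow> (\<forall>i<n. M i = 0\<^sub>m (dimv V i) (dimv W i))"
  proof -
    have "g (s i) * arr W i = arr V (p i) * g i \<longleftrightarrow> M i = 0\<^sub>m (dimv V i) (dimv W i)"
      if "i < n" for i
    proof
      assume Mi: "M i = 0\<^sub>m (dimv V i) (dimv W i)"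
      show "g (s i) * arr W i = arr V (p i) * g i"
      proof (rule eq_matI)
        fix r c
        assume rc: "r < dim_row (arr V (p i) * g i)" "c < dim_col (arr V (p i) * g i)"
        then have rc': "r < dimv V i" "c < dimv W i" using AG[OF that] by auto
        then have "(arr V (p i) * g i) $$ (r, c) - (g (s i) * arr W i) $$ (r, c) = M i $$ (r, c)"
          unfolding M_def using GB[OF that] by (intro index_minus_mat(1)[symmetric]) auto
        also have "\<dots> = 0" using Mi rc' by simp
        finally show "(g (s i) * arr W i) $$ (r, c) = (arr V (p i) * g i) $$ (r, c)" by simp
      qed (use carrier_matD[OF AG[OF that]] carrier_matD[OF GB[OF that]] in simp_all)
    next
      assume "g (s i) * arr W i = arr V (p i) * g i"
      then show "M i = 0\<^sub>m (dimv V i) (dimv W i)"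
        using AG[OF that] by (simp add: M_def minus_r_inv_mat)
    qed
    then show ?thesis using g by (auto simp: rep_hom_def tau_rep_def s_def p_def)
  qed
  have pairing: "(\<Sum>i<n. mat_trace (g (s i) * (f (s i) * arr V i - arr W i * f i)))
      = (\<Sum>i<n. mat_trace (M i * f i))"
    if F: "\<And>i. i < n \<Longrightarrow> f i \<in> carrier_mat (dimv W i) (dimv V i)" for f
  proof -
    have "mat_trace (g (s i) * (f (s i) * arr V i - arr W i * f i))
        = mat_trace (arr V i * g (s i) * f (s i)) - mat_trace (g (s i) * arr W i * f i)"
      if i: "i < n" for i
    proof -
      have Gs: "g (s i) \<in> carrier_mat (dimv V i) (dimv W (s i))" using G[OF s, of i] i by (simp add: ps)
      have Fs: "f (s i) \<in> carrier_mat (dimv W (s i)) (dimv V (s i))" by (rule F[OF s])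
      note c = Gs Fs A[OF i] B[OF i] F[OF i]
      have "g (s i) * (f (s i) * arr V i - arr W i * f i)
          = g (s i) * (f (s i) * arr V i) - g (s i) * (arr W i * f i)"
        by (rule mult_minus_distrib_mat) (use c in auto)
      moreover have "mat_trace (g (s i) * (f (s i) * arr V i)) = mat_trace (arr V i * g (s i) * f (s i))"
      proof -
        have "g (s i) * (f (s i) * arr V i) = (g (s i) * f (s i)) * arr V i"
          by (rule assoc_mult_mat[symmetric]) (use c in auto)
        also have "mat_trace \<dots> = mat_trace (arr V i * (g (s i) * f (s i)))"
          by (rule mat_trace_comm) (use c in auto)
        also have "arr V i * (g (s i) * f (s i)) = arr V i * g (s i) * f (s i)"
          by (rule assoc_mult_mat[symmetric]) (use c in auto)
        finally show ?thesis .
      qed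
      moreover have "g (s i) * (arr W i * f i) = g (s i) * arr W i * f i"
        by (rule assoc_mult_mat[symmetric]) (use c in auto)
      moreover have "mat_trace (g (s i) * (f (s i) * arr V i) - g (s i) * (arr W i * f i))
          = mat_trace (g (s i) * (f (s i) * arr V i)) - mat_trace (g (s i) * (arr W i * f i))"
        by (rule mat_trace_diff[where a = "dimv V i"]) (use c in auto)
      ultimately show ?thesis by simp
    qed
    then have "(\<Sum>i<n. mat_trace (g (s i) * (f (s i) * arr V i - arr W i * f i)))
        = (\<Sum>i<n. mat_trace (arr V i * g (s i) * f (s i))) - (\<Sum>i<n. mat_trace (g (s i) * arr W i * f i))"
      by (simp add: sum_subtractf)
    also have "(\<Sum>i<n. mat_trace (arr V i * g (s i) * f (s i)))
        = (\<Sum>i<n. mat_trace (arr V (p i) * g i * f i))"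
      by (rule sum.reindex_bij_witness[where i = p and j = s]) (auto simp: s p sp ps)
    also have "\<dots> - (\<Sum>i<n. mat_trace (g (s i) * arr W i * f i)) = (\<Sum>i<n. mat_trace (M i * f i))"
      unfolding sum_subtractf[symmetric]
    proof (rule sum.cong[OF refl])
      fix i assume "i \<in> {..<n}"
      then have i: "i < n" by simp
      have "M i * f i = arr V (p i) * g i * f i - g (s i) * arr W i * f i"
        unfolding M_def by (rule minus_mult_distrib_mat[OF AG[OF i] GB[OF i] F[OF i]])
      then show "mat_trace (arr V (p i) * g i * f i) - mat_trace (g (s i) * arr W i * f i)
          = mat_trace (M i * f i)"
        using mat_trace_diff[of "arr V (p i) * g i * f i" "dimv V i" "g (s i) * arr W i * f i"]
          mult_carrier_mat[OF AG[OF i] F[OF i]] mult_carrier_mat[OF GB[OF i] F[OF i]] by simp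
    qed
    finally show ?thesis .
  qed
  have M0: "M i = 0\<^sub>m (dimv V i) (dimv W i)"
    if ann: "\<And>f. (\<And>i. i < n \<Longrightarrow> f i \<in> carrier_mat (dimv W i) (dimv V i)) \<Longrightarrow>
          (\<Sum>i<n. mat_trace (M i * f i)) = 0" and i: "i < n" for i
  proof (rule mat_trace_nondegenerate[OF M[OF i]])
    fix N :: "'k mat" assume N: "N \<in> carrier_mat (dimv W i) (dimv V i)"
    define f where "f j = (if j = i then N else 0\<^sub>m (dimv W j) (dimv V j))" for j
    have z: "mat_trace (M j * f j) = (if j = i then mat_trace (M i * N) else 0)" if "j < n" for j
      using M[OF that] by (auto simp: f_def mat_trace_def)
    have "0 = (\<Sum>j<n. mat_trace (M j * f j))"
      by (rule ann[symmetric]) (auto simp: f_def N)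
    also have "\<dots> = (\<Sum>j<n. if j = i then mat_trace (M i * N) else 0)"
      by (rule sum.cong) (auto simp: z)
    finally show "mat_trace (M i * N) = 0" using i by simp
  qed
  have Mz: "mat_trace (M i * f i) = 0"
    if "M i = 0\<^sub>m (dimv V i) (dimv W i)" "f i \<in> carrier_mat (dimv W i) (dimv V i)" for f i
    using that by (simp add: mat_trace_def)
  show ?thesis
    unfolding hom s_def[symmetric]
  proof (intro iffI allI impI)
    fix f :: "nat \<Rightarrow> 'k mat"
    assume "\<forall>i<n. M i = 0\<^sub>m (dimv V i) (dimv W i)"
      and "\<forall>i<n. f i \<in> carrier_mat (dimv W i) (dimv V i)"
    then show "(\<Sum>i<n. mat_trace (g (s i) * (f (s i) * arr V i - arr W i * f i))) = 0"
      using Mz[of _ f] by (subst pairing) (blast, intro sum.neutral, blast)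
  next
    fix i assume "\<forall>f. (\<forall>i<n. f i \<in> carrier_mat (dimv W i) (dimv V i)) \<longrightarrow>
        (\<Sum>i<n. mat_trace (g (s i) * (f (s i) * arr V i - arr W i * f i))) = 0" and "i < n"
    then show "M i = 0\<^sub>m (dimv V i) (dimv W i)"
      by (intro M0) (auto simp: pairing)
  qed
qed

end

theory Submission
  imports Defs
begin

text \<open>Paths of the quiver act on cohomology, and morphisms of the cluster tube commute with this action.
  A bounded complex $C$ of nilpotent representations is killed by all paths of some length $l$, hence
  so is the cohomology of every object of add $C$. It therefore suffices to find an indecomposable
  $X$ with $\mathrm{Ext}^1(C,X)=0$ that is so long that a path of length $l$ acts nontrivially.

  Put $M = \bigoplus_p \tau^{-p}H^p(C)$. Let $U \subseteq M$ be a uniserial subrepresentation of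
  maximal length, with socle at the vertex $b$. By maximality a linear form on $M_{b+1}$ coinduces to a
  homomorphism $M \to \tau U \subseteq \tau M$, which is nonzero if the form is. If $C$ is rigid there
  is no such map, so $M_j = 0$ for $j = b+1$ (and trivially if $M = 0$).

  Now let $X$ be uniserial with top at $j+1$ and socle at $j-1$, of arbitrarily large length. As
  $\tau X$ has its socle at $j$ and $M_j = 0$, $\mathrm{Hom}(M,\tau X)=0$. As the arrows of $X$ that
  do not end at the top are surjective and $M_j = 0$ cuts the cycle open, a cochain for
  $\mathrm{Ext}^1(M,X)$ can be integrated vertex by vertex, so $\mathrm{Ext}^1(M,X)=0$. These two
  spaces make up $\mathrm{Ext}^1(C,X)$ in the cluster tube.\<close>

text \<open>The ends of \<open>X\<close> answer two conditions at the one vertex \<open>j\<close>. A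
  nonzero map to \<open>\<tau> X\<close> meets its socle, placed at \<open>j\<close>. By the
  Auslander-Reiten formula \<open>Ext^1(M, X)\<close> is dual to \<open>Hom(X, \<tau> M)\<close>,
  where a nonzero map is nonzero on the top of \<open>X\<close>, at \<open>j + 1\<close>, while
  \<open>\<tau> M\<close> at \<open>j + 1\<close> is \<open>M_j = 0\<close>. The code integrates
  cochains instead of dualizing, because this yields the homotopies themselves.

  Morphisms are classes of roofs, composed and added by unions over all representatives, and no
  category axioms are derived. Vanishing of morphisms is therefore used in two one-sided forms: a
  roof in the zero class induces zero on cohomology, and if all roofs with given ends are
  equivalent, then the Hom set is trivial.

  The obstacle is that formulas on cochains commute with arrows only up to coboundaries, and
  \<open>M\<close> itself is never formed. Heredity absorbs this defect by one change of the
  resolution (\<open>realize\<close>); that lemma produces both the nonzero map that contradicts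
  rigidity and the null-homotopies behind \<open>Ext^1(C, X) = 0\<close>. Splittings of vector
  spaces come from generalized inverses.\<close>

section \<open>Generalized inverses of matrices\<close>

lemma mat_eq_by_vec:
  fixes A B :: "'k::field mat"
  assumes A: "A \<in> carrier_mat m n" and B: "B \<in> carrier_mat m n"
    and eq: "\<And>x. x \<in> carrier_vec n \<Longrightarrow> A *\<^sub>v x = B *\<^sub>v x"
  shows "A = B"
proof (rule eq_matI)
  fix i j assume "i < dim_row B" "j < dim_col B"
  then have ij: "i < m" "j < n" using B by auto
  have "(A *\<^sub>v unit_vec n j) $ i = (B *\<^sub>v unit_vec n j) $ i" using eq by simp
  then show "A $$ (i, j) = B $$ (i, j)" using A B ij by simp
qed (use A B in auto)

text \<open>The hypothesis of this lemma is Wedderburn's rank reduction step when $E$ has a single nonzero entry.\<close>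

lemma gen_inverse_step:
  fixes D E G :: "'k::field mat"
  assumes D: "D \<in> carrier_mat m n" and E: "E \<in> carrier_mat n m" and G: "G \<in> carrier_mat n m"
    and DG: "(D - D * E * D) * G * (D - D * E * D) = D - D * E * D"
  shows "\<exists>G \<in> carrier_mat n m. D * G * D = D"
proof
  \<comment> \<open>Both \<open>?P * D\<close> and \<open>D * ?Q\<close> equal
    \<open>D - D * E * D\<close>. So \<open>?Q * G * ?P\<close> recovers this part of
    \<open>D\<close>, and the summand \<open>E\<close> supplies the missing
    \<open>D * E * D\<close>.\<close>
  let ?P = "1\<^sub>m m - D * E" and ?Q = "1\<^sub>m n - E * D"
  have P: "?P \<in> carrier_mat m m" and Q: "?Q \<in> carrier_mat n n" using D E by (auto intro!: minus_carrier_mat mult_carrier_mat)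
  have DED: "D * E * D \<in> carrier_mat m n" using D E by (auto intro!: mult_carrier_mat)
  have PD: "?P * D = D - D * E * D"
    by (subst minus_mult_distrib_mat[of _ m m]) (use D E in auto)
  have DQ: "D * ?Q = D - D * E * D"
    by (subst mult_minus_distrib_mat[of _ m n _ n]) (use D E in auto)
  have QGP: "?Q * G * ?P \<in> carrier_mat n m" using P Q G by auto
  show "?Q * G * ?P + E \<in> carrier_mat n m" using E QGP by auto
  have "D * (?Q * G * ?P + E) * D = (D * (?Q * G * ?P) + D * E) * D"
    by (subst mult_add_distrib_mat[OF D QGP E]) simp
  also have "\<dots> = D * (?Q * G * ?P) * D + D * E * D"
    by (rule add_mult_distrib_mat[of _ m m]) (use D E QGP in \<open>auto intro!: mult_carrier_mat\<close>)
  also have "D * (?Q * G * ?P) * D = (D * ?Q) * G * (?P * D)"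
  proof -
    note [simp] = D Q G P mult_carrier_mat[OF Q G] mult_carrier_mat[OF D Q]
      mult_carrier_mat[OF mult_carrier_mat[OF D Q] G]
      mult_carrier_mat[OF P D]
    have "D * (?Q * G * ?P) = D * ?Q * G * ?P"
      using assoc_mult_mat[OF D mult_carrier_mat[OF Q G] P] assoc_mult_mat[OF D Q G] by simp
    then show ?thesis
      using assoc_mult_mat[OF mult_carrier_mat[OF mult_carrier_mat[OF D Q] G] P D] by simp
  qed
  also have "\<dots> = D - D * E * D" unfolding PD DQ by (rule DG)
  also have "\<dots> + D * E * D = D" using D DED by (intro eq_matI) auto
  finally show "D * (?Q * G * ?P + E) * D = D" .
qed

text \<open>Clearing a pivot row lowers the number of nonzero rows, which drives the induction. The
  matrix \<open>G\<close> serves as a linear choice of preimages: \<open>D * G\<close> fixes the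
  image of \<open>D\<close>, and \<open>G * D\<close> differs from the identity by a map into the
  kernel of \<open>D\<close>. This replaces choices of complements below.\<close>

lemma gen_inverse:
  fixes D :: "'k::field mat"
  assumes "D \<in> carrier_mat m n"
  shows "\<exists>G \<in> carrier_mat n m. D * G * D = D"
  using assms
proof (induction "card {r. r < m \<and> (\<exists>c<n. D $$ (r, c) \<noteq> 0)}" arbitrary: D rule: less_induct)
  case less
  note D = less.prems
  show ?case
  proof (cases "\<exists>i<m. \<exists>j<n. D $$ (i, j) \<noteq> 0")
    case False
    then have "D = 0\<^sub>m m n" using D by (intro eq_matI) auto
    then show ?thesis by (intro bexI[of _ "0\<^sub>m n m"]) auto
  next
    case True
    then obtain i j where ij: "i < m" "j < n" "D $$ (i, j) \<noteq> 0" by blast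
    \<comment> \<open>With this \<open>E\<close>, the product \<open>D * E * D\<close> is column
      \<open>j\<close> times row \<open>i\<close> of \<open>D\<close>, divided by the pivot.
      Subtracting it clears row \<open>i\<close> and keeps zero rows zero.\<close>
    define E :: "'k mat" where "E = mat n m (\<lambda>(r, c). if r = j \<and> c = i then inverse (D $$ (i, j)) else 0)"
    have E: "E \<in> carrier_mat n m" by (simp add: E_def)
    have DE: "(D * E) $$ (r, c) = (if c = i then D $$ (r, j) * inverse (D $$ (i, j)) else 0)"
      if "r < m" "c < m" for r c
    proof -
      have "(D * E) $$ (r, c) = (\<Sum>s = 0..<n. D $$ (r, s) * E $$ (s, c))"
        using that D E by (simp add: scalar_prod_def del: assoc_mult_mat)
      also have "\<dots> = (\<Sum>s = 0..<n. if s = j then (if c = i then D $$ (r, j) * inverse (D $$ (i, j)) else 0) else 0)"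
        by (rule sum.cong) (use that in \<open>auto simp: E_def\<close>)
      also have "\<dots> = (if c = i then D $$ (r, j) * inverse (D $$ (i, j)) else 0)" using ij by simp
      finally show ?thesis .
    qed
    have DED: "(D * E * D) $$ (r, c) = D $$ (r, j) * inverse (D $$ (i, j)) * D $$ (i, c)"
      if "r < m" "c < n" for r c
    proof -
      have "(D * E * D) $$ (r, c) = (\<Sum>s = 0..<m. (D * E) $$ (r, s) * D $$ (s, c))"
        using that D E by (simp add: scalar_prod_def del: assoc_mult_mat)
      also have "\<dots> = (\<Sum>s = 0..<m. if s = i then D $$ (r, j) * inverse (D $$ (i, j)) * D $$ (i, c) else 0)"
        by (rule sum.cong) (use that DE in auto)
      also have "\<dots> = D $$ (r, j) * inverse (D $$ (i, j)) * D $$ (i, c)" using ij by simp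
      finally show ?thesis .
    qed
    have cDED: "D * E * D \<in> carrier_mat m n" using D E by auto
    let ?D' = "D - D * E * D"
    have D': "?D' $$ (r, c) = D $$ (r, c) - D $$ (r, j) * inverse (D $$ (i, j)) * D $$ (i, c)"
      if "r < m" "c < n" for r c
      using that D cDED DED[OF that] by (subst index_minus_mat) auto
    have "{r. r < m \<and> (\<exists>c<n. ?D' $$ (r, c) \<noteq> 0)} \<subset> {r. r < m \<and> (\<exists>c<n. D $$ (r, c) \<noteq> 0)}"
    proof
      show "{r. r < m \<and> (\<exists>c<n. ?D' $$ (r, c) \<noteq> 0)} \<subseteq> {r. r < m \<and> (\<exists>c<n. D $$ (r, c) \<noteq> 0)}"
      proof safe
        fix r c assume "r < m" "c < n" "?D' $$ (r, c) \<noteq> 0"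
        then have "D $$ (r, c) \<noteq> 0 \<or> D $$ (r, j) \<noteq> 0" using D' by auto
        then show "\<exists>c<n. D $$ (r, c) \<noteq> 0" using \<open>c < n\<close> ij(2) by blast
      qed
      have "i \<in> {r. r < m \<and> (\<exists>c<n. D $$ (r, c) \<noteq> 0)}" using ij by blast
      moreover have "i \<notin> {r. r < m \<and> (\<exists>c<n. ?D' $$ (r, c) \<noteq> 0)}" using D'[OF ij(1)] ij by auto
      ultimately show "{r. r < m \<and> (\<exists>c<n. ?D' $$ (r, c) \<noteq> 0)} \<noteq> {r. r < m \<and> (\<exists>c<n. D $$ (r, c) \<noteq> 0)}"
        by blast
    qed
    then have "card {r. r < m \<and> (\<exists>c<n. ?D' $$ (r, c) \<noteq> 0)} < card {r. r < m \<and> (\<exists>c<n. D $$ (r, c) \<noteq> 0)}"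
      by (intro psubset_card_mono) auto
    from less.hyps[OF this] obtain G where "G \<in> carrier_mat n m" "?D' * G * ?D' = ?D'"
      using D cDED by (meson minus_carrier_mat)
    then show ?thesis by (intro gen_inverse_step[OF D E])
  qed
qed

lemma gen_inverse_vec:
  fixes D :: "'k::field mat"
  assumes D: "D \<in> carrier_mat m n"
  obtains G where "G \<in> carrier_mat n m" "\<And>x. x \<in> carrier_vec n \<Longrightarrow> D *\<^sub>v (G *\<^sub>v (D *\<^sub>v x)) = D *\<^sub>v x"
proof -
  obtain G where G: "G \<in> carrier_mat n m" "D * G * D = D" using gen_inverse[OF D] by blast
  have "D *\<^sub>v (G *\<^sub>v (D *\<^sub>v x)) = D *\<^sub>v x" if "x \<in> carrier_vec n" for x
  proof -
    have "(D * G * D) *\<^sub>v x = D *\<^sub>v (G *\<^sub>v (D *\<^sub>v x))"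
      using assoc_mult_mat_vec[OF mult_carrier_mat[OF D G(1)] D that]
        assoc_mult_mat_vec[OF D G(1) mult_mat_vec_carrier[OF D that]] by simp
    then show ?thesis using G(2) by simp
  qed
  then show thesis using that G(1) by blast
qed

lemma mult_mat_zero_vec:
  fixes A :: "'k::field mat"
  assumes "A \<in> carrier_mat m n"
  shows "A *\<^sub>v 0\<^sub>v n = 0\<^sub>v m"
  using assms by (intro eq_vecI) auto

lemma zero_mat_mult_vec:
  "x \<in> carrier_vec n \<Longrightarrow> 0\<^sub>m m n *\<^sub>v (x :: 'k::field vec) = 0\<^sub>v m"
  by (intro eq_vecI) auto

lemma carrier_vec_0_eq:
  "x \<in> carrier_vec 0 \<Longrightarrow> y \<in> carrier_vec 0 \<Longrightarrow> x = y"
  by (intro eq_vecI) auto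

section \<open>Representations and complexes in terms of vectors\<close>

abbreviation cochains :: "'k cpx \<Rightarrow> int \<Rightarrow> nat \<Rightarrow> 'k vec set" where
  "cochains X p i \<equiv> carrier_vec (dimv (ob X p) i)"

abbreviation zero_cochain :: "'k::zero cpx \<Rightarrow> int \<Rightarrow> nat \<Rightarrow> 'k vec" where
  "zero_cochain X p i \<equiv> 0\<^sub>v (dimv (ob X p) i)"

abbreviation graded_maps :: "'k cpx \<Rightarrow> int \<Rightarrow> nat \<Rightarrow> 'k cpx \<Rightarrow> int \<Rightarrow> nat \<Rightarrow> 'k mat set" where
  "graded_maps X p i Y q j \<equiv> carrier_mat (dimv (ob Y q) j) (dimv (ob X p) i)"

section \<open>Paths and homomorphisms of representations, evaluated on vectors\<close>

lemma is_repD: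
  "is_rep n V \<Longrightarrow> i < n \<Longrightarrow> arr V i \<in> carrier_mat (dimv V (Suc i mod n)) (dimv V i)"
  by (simp add: is_rep_def)

lemma path_mat_carrier:
  assumes V: "is_rep n V" and i: "i < n"
  shows "path_mat n V i l \<in> carrier_mat (dimv V ((i + l) mod n)) (dimv V i)"
proof (induction l)
  case 0
  then show ?case using i by simp
next
  case (Suc l)
  have "arr V ((i + l) mod n) \<in> carrier_mat (dimv V ((i + Suc l) mod n)) (dimv V ((i + l) mod n))"
    using is_repD[OF V, of "(i + l) mod n"] i by (simp add: mod_Suc_eq)
  then show ?case using Suc by simp
qed

lemma path_mat_Suc_vec:
  assumes "is_rep n V" "i < n" "x \<in> carrier_vec (dimv V i)"
  shows "path_mat n V i (Suc l) *\<^sub>v x = arr V ((i + l) mod n) *\<^sub>v (path_mat n V i l *\<^sub>v x)"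
proof -
  have "(i + l) mod n < n" using assms(2) by simp
  from assoc_mult_mat_vec[OF is_repD[OF assms(1) this] path_mat_carrier[OF assms(1,2)] assms(3)]
  show ?thesis by simp
qed

lemma path_mat_0_vec: "x \<in> carrier_vec (dimv V i) \<Longrightarrow> path_mat n V i 0 *\<^sub>v x = x"
  by simp

lemma path_vec_carrier:
  assumes "is_rep n V" "i < n" "x \<in> carrier_vec (dimv V i)"
  shows "path_mat n V i l *\<^sub>v x \<in> carrier_vec (dimv V ((i + l) mod n))"
  using path_mat_carrier[OF assms(1,2)] assms(3) by (rule mult_mat_vec_carrier)

lemma path_mat_add_vec:
  assumes "is_rep n V" "i < n" "x \<in> carrier_vec (dimv V i)"
  shows "path_mat n V i (l + m) *\<^sub>v x = path_mat n V ((i + l) mod n) m *\<^sub>v (path_mat n V i l *\<^sub>v x)"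
proof (induction m)
  case 0
  show ?case using path_vec_carrier[OF assms, of l] by simp
next
  case (Suc m)
  have i': "(i + l) mod n < n" using assms(2) by simp
  show ?case
    unfolding path_mat_Suc_vec[OF assms(1) i' path_vec_carrier[OF assms]] Suc[symmetric]
    using path_mat_Suc_vec[OF assms, of "l + m"] by (simp add: mod_add_left_eq add.assoc del: path_mat.simps)
qed

text \<open>The recursion of \<open>path_mat\<close> appends arrows at the end of a path; this form
  is for paths that are precomposed with an arrow.\<close>

lemma path_mat_Suc_vec':
  assumes "is_rep n V" "i < n" "x \<in> carrier_vec (dimv V i)"
  shows "path_mat n V i (Suc l) *\<^sub>v x = path_mat n V (Suc i mod n) l *\<^sub>v (arr V i *\<^sub>v x)"
  using path_mat_add_vec[OF assms, of 1 l] path_mat_Suc_vec[OF assms, of 0] assms by simp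

lemma rep_hom_carrier: "f \<in> rep_hom n V W \<Longrightarrow> i < n \<Longrightarrow> f i \<in> carrier_mat (dimv W i) (dimv V i)"
  by (simp add: rep_hom_def)

lemma rep_hom_arr:
  assumes f: "f \<in> rep_hom n V W" and V: "is_rep n V" and W: "is_rep n W" and i: "i < n"
    and x: "x \<in> carrier_vec (dimv V i)"
  shows "f (Suc i mod n) *\<^sub>v (arr V i *\<^sub>v x) = arr W i *\<^sub>v (f i *\<^sub>v x)"
proof -
  have i': "Suc i mod n < n" using i by simp
  have "f (Suc i mod n) *\<^sub>v (arr V i *\<^sub>v x) = (f (Suc i mod n) * arr V i) *\<^sub>v x"
    using assoc_mult_mat_vec[OF rep_hom_carrier[OF f i'] is_repD[OF V i] x] by simp
  also have "f (Suc i mod n) * arr V i = arr W i * f i" using f i by (simp add: rep_hom_def)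
  also have "\<dots> *\<^sub>v x = arr W i *\<^sub>v (f i *\<^sub>v x)"
    using assoc_mult_mat_vec[OF is_repD[OF W i] rep_hom_carrier[OF f i] x] by simp
  finally show ?thesis .
qed

lemma rep_homI:
  assumes V: "is_rep n V" and W: "is_rep n W"
    and c: "\<And>i. i < n \<Longrightarrow> f i \<in> carrier_mat (dimv W i) (dimv V i)"
    and eq: "\<And>i x. i < n \<Longrightarrow> x \<in> carrier_vec (dimv V i) \<Longrightarrow>
      f (Suc i mod n) *\<^sub>v (arr V i *\<^sub>v x) = arr W i *\<^sub>v (f i *\<^sub>v x)"
  shows "f \<in> rep_hom n V W"
proof -
  have "f (Suc i mod n) * arr V i = arr W i * f i" if i: "i < n" for i
  proof (rule mat_eq_by_vec)
    have i': "Suc i mod n < n" using i by simp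
    note ca = c[OF i'] is_repD[OF V i] c[OF i] is_repD[OF W i]
    show "f (Suc i mod n) * arr V i \<in> carrier_mat (dimv W (Suc i mod n)) (dimv V i)" using ca by simp
    show "arr W i * f i \<in> carrier_mat (dimv W (Suc i mod n)) (dimv V i)" using ca by simp
    show "f (Suc i mod n) * arr V i *\<^sub>v x = arr W i * f i *\<^sub>v x" if x: "x \<in> carrier_vec (dimv V i)" for x
      using assoc_mult_mat_vec[OF ca(1,2) x] assoc_mult_mat_vec[OF ca(4,3) x] eq[OF i x] by simp
  qed
  then show ?thesis using c by (simp add: rep_hom_def)
qed

lemma rep_hom_path:
  assumes f: "f \<in> rep_hom n V W" and V: "is_rep n V" and W: "is_rep n W" and i: "i < n"
    and x: "x \<in> carrier_vec (dimv V i)"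
  shows "f ((i + l) mod n) *\<^sub>v (path_mat n V i l *\<^sub>v x) = path_mat n W i l *\<^sub>v (f i *\<^sub>v x)"
proof (induction l)
  case 0
  then show ?case using i x rep_hom_carrier[OF f i] by simp
next
  case (Suc l)
  have j: "(i + l) mod n < n" using i by simp
  have fx: "f i *\<^sub>v x \<in> carrier_vec (dimv W i)" using rep_hom_carrier[OF f i] x by simp
  show ?case
    unfolding path_mat_Suc_vec[OF V i x] path_mat_Suc_vec[OF W i fx] Suc[symmetric]
    using rep_hom_arr[OF f V W j path_vec_carrier[OF V i x]] by (simp add: mod_Suc_eq)
qed

section \<open>Complexes and chain maps, evaluated on vectors\<close>

lemma is_cpx_rep: "is_cpx n X \<Longrightarrow> is_rep n (ob X p)"
  by (simp add: is_cpx_def tube_def)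

lemma is_cpx_arr:
  "is_cpx n X \<Longrightarrow> i < n \<Longrightarrow> arr (ob X p) i \<in> graded_maps X p i X p (Suc i mod n)"
  by (rule is_repD[OF is_cpx_rep])

lemma is_cpx_arr_vec:
  "is_cpx n X \<Longrightarrow> i < n \<Longrightarrow> x \<in> cochains X p i \<Longrightarrow>
    arr (ob X p) i *\<^sub>v x \<in> cochains X p (Suc i mod n)"
  using is_cpx_arr by (rule mult_mat_vec_carrier)

lemma is_cpx_df_hom: "is_cpx n X \<Longrightarrow> df X p \<in> rep_hom n (ob X p) (ob X (p + 1))"
  by (simp add: is_cpx_def)

lemma is_cpx_df:
  "is_cpx n X \<Longrightarrow> i < n \<Longrightarrow> df X p i \<in> graded_maps X p i X (p + 1) i"
  by (rule rep_hom_carrier[OF is_cpx_df_hom])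

lemma is_cpx_df_vec:
  "is_cpx n X \<Longrightarrow> i < n \<Longrightarrow> x \<in> cochains X p i \<Longrightarrow>
    df X p i *\<^sub>v x \<in> cochains X (p + 1) i"
  using is_cpx_df by (rule mult_mat_vec_carrier)

lemma is_cpx_df_arr:
  "is_cpx n X \<Longrightarrow> i < n \<Longrightarrow> x \<in> cochains X p i \<Longrightarrow>
    df X p (Suc i mod n) *\<^sub>v (arr (ob X p) i *\<^sub>v x) = arr (ob X (p + 1)) i *\<^sub>v (df X p i *\<^sub>v x)"
  by (rule rep_hom_arr[OF is_cpx_df_hom is_cpx_rep is_cpx_rep])

lemma is_cpx_df_df:
  assumes X: "is_cpx n X" and i: "i < n" and x: "x \<in> cochains X p i"
  shows "df X (p + 1) i *\<^sub>v (df X p i *\<^sub>v x) = zero_cochain X (p + 2) i"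
proof -
  have "df X (p + 1) i * df X p i = 0\<^sub>m (dimv (ob X (p + 2)) i) (dimv (ob X p) i)"
    using X i by (simp add: is_cpx_def)
  moreover have "df X (p + 1) i *\<^sub>v (df X p i *\<^sub>v x) = (df X (p + 1) i * df X p i) *\<^sub>v x"
    using assoc_mult_mat_vec[OF is_cpx_df[OF X i] is_cpx_df[OF X i] x] by simp
  ultimately show ?thesis using x by (simp add: zero_mat_mult_vec)
qed

lemma is_cpxI:
  assumes ob: "\<And>p. ob X p \<in> tube n"
    and df: "\<And>p i. i < n \<Longrightarrow> df X p i \<in> graded_maps X p i X (p + 1) i"
    and df_arr: "\<And>p i x. i < n \<Longrightarrow> x \<in> cochains X p i \<Longrightarrow>
      df X p (Suc i mod n) *\<^sub>v (arr (ob X p) i *\<^sub>v x) = arr (ob X (p + 1)) i *\<^sub>v (df X p i *\<^sub>v x)"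
    and df_df: "\<And>p i x. i < n \<Longrightarrow> x \<in> cochains X p i \<Longrightarrow>
      df X (p + 1) i *\<^sub>v (df X p i *\<^sub>v x) = zero_cochain X (p + 2) i"
    and bd: "\<And>p i. \<bar>p\<bar> > b \<Longrightarrow> i < n \<Longrightarrow> dimv (ob X p) i = 0"
  shows "is_cpx n X"
proof -
  have rep: "is_rep n (ob X p)" for p using ob by (auto simp: tube_def)
  have "df X (p + 1) i * df X p i = 0\<^sub>m (dimv (ob X (p + 2)) i) (dimv (ob X p) i)" if i: "i < n" for p i
  proof (rule mat_eq_by_vec)
    have c: "df X (p + 1) i \<in> graded_maps X (p + 1) i X (p + 2) i"
      using df[OF i, of "p + 1"] by (simp add: add.assoc)
    show "df X (p + 1) i * df X p i \<in> graded_maps X p i X (p + 2) i"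
      using c df[OF i] by (rule mult_carrier_mat)
    show "df X (p + 1) i * df X p i *\<^sub>v x = 0\<^sub>m (dimv (ob X (p + 2)) i) (dimv (ob X p) i) *\<^sub>v x"
      if x: "x \<in> cochains X p i" for x
      using assoc_mult_mat_vec[OF c df[OF i] x] df_df[OF i x] x by (simp add: zero_mat_mult_vec)
  qed simp
  moreover have "df X p \<in> rep_hom n (ob X p) (ob X (p + 1))" for p
    by (rule rep_homI[OF rep rep]) (use df df_arr in auto)
  moreover have "\<exists>b. \<forall>p. \<bar>p\<bar> > b \<longrightarrow> (\<forall>i<n. dimv (ob X p) i = 0)"
    using bd by blast
  ultimately show ?thesis using ob by (simp add: is_cpx_def)
qed

lemma chain_map_hom: "chain_map n X Y f \<Longrightarrow> f p \<in> rep_hom n (ob X p) (ob Y p)"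
  by (simp add: chain_map_def)

lemma chain_map_carrier:
  "chain_map n X Y f \<Longrightarrow> i < n \<Longrightarrow> f p i \<in> graded_maps X p i Y p i"
  by (rule rep_hom_carrier[OF chain_map_hom])

lemma chain_map_vec:
  "chain_map n X Y f \<Longrightarrow> i < n \<Longrightarrow> x \<in> cochains X p i \<Longrightarrow>
    f p i *\<^sub>v x \<in> cochains Y p i"
  using chain_map_carrier by (rule mult_mat_vec_carrier)

lemma chain_map_arr:
  "chain_map n X Y f \<Longrightarrow> is_cpx n X \<Longrightarrow> is_cpx n Y \<Longrightarrow> i < n \<Longrightarrow> x \<in> cochains X p i \<Longrightarrow>
    f p (Suc i mod n) *\<^sub>v (arr (ob X p) i *\<^sub>v x) = arr (ob Y p) i *\<^sub>v (f p i *\<^sub>v x)"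
  by (rule rep_hom_arr[OF chain_map_hom is_cpx_rep is_cpx_rep])

lemma chain_map_df:
  assumes f: "chain_map n X Y f" and X: "is_cpx n X" and Y: "is_cpx n Y" and i: "i < n"
    and x: "x \<in> cochains X p i"
  shows "f (p + 1) i *\<^sub>v (df X p i *\<^sub>v x) = df Y p i *\<^sub>v (f p i *\<^sub>v x)"
proof -
  have "f (p + 1) i * df X p i = df Y p i * f p i" using f i by (simp add: chain_map_def)
  then show ?thesis
    using assoc_mult_mat_vec[OF chain_map_carrier[OF f i] is_cpx_df[OF X i] x]
      assoc_mult_mat_vec[OF is_cpx_df[OF Y i] chain_map_carrier[OF f i] x] by simp
qed

lemma chain_mapI:
  assumes X: "is_cpx n X" and Y: "is_cpx n Y"
    and c: "\<And>p i. i < n \<Longrightarrow> f p i \<in> graded_maps X p i Y p i"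
    and ar: "\<And>p i x. i < n \<Longrightarrow> x \<in> cochains X p i \<Longrightarrow>
      f p (Suc i mod n) *\<^sub>v (arr (ob X p) i *\<^sub>v x) = arr (ob Y p) i *\<^sub>v (f p i *\<^sub>v x)"
    and d: "\<And>p i x. i < n \<Longrightarrow> x \<in> cochains X p i \<Longrightarrow>
      f (p + 1) i *\<^sub>v (df X p i *\<^sub>v x) = df Y p i *\<^sub>v (f p i *\<^sub>v x)"
  shows "chain_map n X Y f"
proof -
  have "f (p + 1) i * df X p i = df Y p i * f p i" if i: "i < n" for p i
  proof (rule mat_eq_by_vec)
    show "f (p + 1) i * df X p i \<in> graded_maps X p i Y (p + 1) i"
      using c[OF i] is_cpx_df[OF X i] by (rule mult_carrier_mat)
    show "df Y p i * f p i \<in> graded_maps X p i Y (p + 1) i"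
      using is_cpx_df[OF Y i] c[OF i] by (rule mult_carrier_mat)
    show "f (p + 1) i * df X p i *\<^sub>v x = df Y p i * f p i *\<^sub>v x" if x: "x \<in> cochains X p i" for x
      using assoc_mult_mat_vec[OF c[OF i] is_cpx_df[OF X i] x]
        assoc_mult_mat_vec[OF is_cpx_df[OF Y i] c[OF i] x] d[OF i x] by simp
  qed
  moreover have "f p \<in> rep_hom n (ob X p) (ob Y p)" for p
    by (rule rep_homI[OF is_cpx_rep[OF X] is_cpx_rep[OF Y]]) (use c ar in auto)
  ultimately show ?thesis by (simp add: chain_map_def)
qed

lemma chain_map_comp:
  assumes f: "chain_map n Y Z f" and g: "chain_map n X Y g"
    and X: "is_cpx n X" and Y: "is_cpx n Y" and Z: "is_cpx n Z"
  shows "chain_map n X Z (f \<circ>\<^sub>g g)"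
proof (rule chain_mapI[OF X Z])
  fix p i assume i: "i < n"
  then have i': "Suc i mod n < n" by simp
  note cf = chain_map_carrier[OF f] and cg = chain_map_carrier[OF g]
  show "(f \<circ>\<^sub>g g) p i \<in> graded_maps X p i Z p i"
    unfolding comp_map_def using cf[OF i] cg[OF i] by (rule mult_carrier_mat)
  fix x :: "'a vec" assume x: "x \<in> cochains X p i"
  note gx = chain_map_vec[OF g i x]
  show "(f \<circ>\<^sub>g g) p (Suc i mod n) *\<^sub>v (arr (ob X p) i *\<^sub>v x) = arr (ob Z p) i *\<^sub>v ((f \<circ>\<^sub>g g) p i *\<^sub>v x)"
    unfolding comp_map_def assoc_mult_mat_vec[OF cf[OF i'] cg[OF i'] is_cpx_arr_vec[OF X i x]]
      assoc_mult_mat_vec[OF cf[OF i] cg[OF i] x]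
      chain_map_arr[OF g X Y i x] chain_map_arr[OF f Y Z i gx] ..
  show "(f \<circ>\<^sub>g g) (p + 1) i *\<^sub>v (df X p i *\<^sub>v x) = df Z p i *\<^sub>v ((f \<circ>\<^sub>g g) p i *\<^sub>v x)"
    unfolding comp_map_def assoc_mult_mat_vec[OF cf[OF i] cg[OF i] is_cpx_df_vec[OF X i x]]
      assoc_mult_mat_vec[OF cf[OF i] cg[OF i] x]
      chain_map_df[OF g X Y i x] chain_map_df[OF f Y Z i gx] ..
qed

lemma comp_map_vec:
  assumes "chain_map n Y Z f" "chain_map n X Y g" "i < n" "x \<in> cochains X p i"
  shows "(f \<circ>\<^sub>g g) p i *\<^sub>v x = f p i *\<^sub>v (g p i *\<^sub>v x)"
  unfolding comp_map_def
  by (rule assoc_mult_mat_vec[OF chain_map_carrier[OF assms(1,3)] chain_map_carrier[OF assms(2,3)] assms(4)])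

lemma id_map_chain_map: "is_cpx n X \<Longrightarrow> chain_map n X X (id_map X)"
  by (rule chain_mapI) (auto simp: id_map_def one_mult_mat_vec[OF is_cpx_arr_vec] one_mult_mat_vec[OF is_cpx_df_vec])

lemma id_map_vec: "x \<in> cochains X p i \<Longrightarrow> id_map X p i *\<^sub>v x = x"
  by (simp add: id_map_def)

lemma zero_map_vec: "x \<in> cochains X p i \<Longrightarrow> zero_map X Y p i *\<^sub>v x = zero_cochain Y p i"
  by (simp add: zero_map_def zero_mat_mult_vec)

lemma zero_map_chain_map:
  assumes X: "is_cpx n X" and Y: "is_cpx n Y"
  shows "chain_map n X Y (zero_map X Y)"
proof (rule chain_mapI[OF X Y])
  fix p i assume i: "i < n"
  show "zero_map X Y p i \<in> graded_maps X p i Y p i" by (simp add: zero_map_def)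
  fix x :: "'a vec" assume x: "x \<in> cochains X p i"
  show "zero_map X Y p (Suc i mod n) *\<^sub>v (arr (ob X p) i *\<^sub>v x) = arr (ob Y p) i *\<^sub>v (zero_map X Y p i *\<^sub>v x)"
    unfolding zero_map_vec[OF x] zero_map_vec[OF is_cpx_arr_vec[OF X i x]]
    by (rule mult_mat_zero_vec[OF is_cpx_arr[OF Y i], symmetric])
  show "zero_map X Y (p + 1) i *\<^sub>v (df X p i *\<^sub>v x) = df Y p i *\<^sub>v (zero_map X Y p i *\<^sub>v x)"
    unfolding zero_map_vec[OF x] zero_map_vec[OF is_cpx_df_vec[OF X i x]]
    by (rule mult_mat_zero_vec[OF is_cpx_df[OF Y i], symmetric])
qed

section \<open>Cocycles, coboundaries and homotopies\<close>

lemma cocyclesD: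
  "z \<in> cocycles X p i \<Longrightarrow> z \<in> cochains X p i"
  "z \<in> cocycles X p i \<Longrightarrow> df X p i *\<^sub>v z = zero_cochain X (p + 1) i"
  by (auto simp: cocycles_def)

lemma coboundariesI:
  "y \<in> cochains X (p - 1) i \<Longrightarrow> x = df X (p - 1) i *\<^sub>v y \<Longrightarrow> x \<in> coboundaries X p i"
  by (auto simp: coboundaries_def)

lemma coboundariesE:
  assumes "x \<in> coboundaries X p i"
  obtains y where "y \<in> cochains X (p - 1) i" "x = df X (p - 1) i *\<^sub>v y"
  using assms by (auto simp: coboundaries_def)

lemma coboundaries_cocycles:
  assumes X: "is_cpx n X" and i: "i < n" and x: "x \<in> coboundaries X p i"
  shows "x \<in> cocycles X p i"
proof -
  obtain y where y: "y \<in> cochains X (p - 1) i" "x = df X (p - 1) i *\<^sub>v y"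
    using x by (rule coboundariesE)
  show ?thesis
    using is_cpx_df_vec[OF X i y(1)] is_cpx_df_df[OF X i y(1)] y(2) by (simp add: cocycles_def add.commute)
qed

lemma coboundaries_carrier:
  "is_cpx n X \<Longrightarrow> i < n \<Longrightarrow> x \<in> coboundaries X p i \<Longrightarrow> x \<in> cochains X p i"
  by (blast dest: coboundaries_cocycles cocyclesD)

lemma coboundaries_df:
  assumes "x \<in> cochains X p i"
  shows "df X p i *\<^sub>v x \<in> coboundaries X (p + 1) i"
  using assms by (auto simp: coboundaries_def)

context
  fixes n and X :: "'k::field cpx" and i :: nat
  assumes X: "is_cpx n X" and i: "i < n"
begin

lemma df_carrier': "df X (p - 1) i \<in> graded_maps X (p - 1) i X p i"
  using is_cpx_df[OF X i, of "p - 1"] by simp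

lemma coboundaries_add:
  "x \<in> coboundaries X p i \<Longrightarrow> y \<in> coboundaries X p i \<Longrightarrow> x + y \<in> coboundaries X p i"
proof (elim coboundariesE)
  fix u v assume u: "u \<in> cochains X (p - 1) i" "x = df X (p - 1) i *\<^sub>v u"
    and v: "v \<in> cochains X (p - 1) i" "y = df X (p - 1) i *\<^sub>v v"
  show "x + y \<in> coboundaries X p i"
    by (rule coboundariesI[of "u + v"]) (use u v in \<open>auto simp: mult_add_distrib_mat_vec[OF df_carrier']\<close>)
qed

lemma coboundaries_minus:
  "x \<in> coboundaries X p i \<Longrightarrow> y \<in> coboundaries X p i \<Longrightarrow> x - y \<in> coboundaries X p i"
proof (elim coboundariesE)
  fix u v assume u: "u \<in> cochains X (p - 1) i" "x = df X (p - 1) i *\<^sub>v u"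
    and v: "v \<in> cochains X (p - 1) i" "y = df X (p - 1) i *\<^sub>v v"
  show "x - y \<in> coboundaries X p i"
    by (rule coboundariesI[of "u - v"]) (use u v in \<open>auto simp: mult_minus_distrib_mat_vec[OF df_carrier']\<close>)
qed

lemma coboundaries_zero: "zero_cochain X p i \<in> coboundaries X p i"
  by (rule coboundariesI[OF zero_carrier_vec]) (simp add: mult_mat_zero_vec[OF df_carrier'])

lemma coboundaries_smult:
  "x \<in> coboundaries X p i \<Longrightarrow> c \<cdot>\<^sub>v x \<in> coboundaries X p i"
proof (elim coboundariesE)
  fix u assume u: "u \<in> cochains X (p - 1) i" "x = df X (p - 1) i *\<^sub>v u"
  show "c \<cdot>\<^sub>v x \<in> coboundaries X p i"
    by (rule coboundariesI[of "c \<cdot>\<^sub>v u"]) (use u in \<open>auto simp: mult_mat_vec[OF df_carrier']\<close>)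
qed

lemma cocycles_add: "x \<in> cocycles X p i \<Longrightarrow> y \<in> cocycles X p i \<Longrightarrow> x + y \<in> cocycles X p i"
  by (auto simp: cocycles_def mult_add_distrib_mat_vec[OF is_cpx_df[OF X i]])

lemma cocycles_minus: "x \<in> cocycles X p i \<Longrightarrow> y \<in> cocycles X p i \<Longrightarrow> x - y \<in> cocycles X p i"
  by (auto simp: cocycles_def mult_minus_distrib_mat_vec[OF is_cpx_df[OF X i]])

lemma cocycles_zero: "zero_cochain X p i \<in> cocycles X p i"
  by (simp add: cocycles_def mult_mat_zero_vec[OF is_cpx_df[OF X i]])

lemma coboundaries_diff_cong:
  assumes "x - y \<in> coboundaries X p i" "x \<in> coboundaries X p i"
    and "x \<in> cochains X p i" "y \<in> cochains X p i"
  shows "y \<in> coboundaries X p i"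
proof -
  have "y = x - (x - y)" using assms(3,4) by (intro eq_vecI) auto
  then show ?thesis using coboundaries_minus[OF assms(2,1)] by simp
qed

lemma coboundaries_diff_sym:
  assumes "x - y \<in> coboundaries X p i" 
    and "x \<in> cochains X p i" "y \<in> cochains X p i"
  shows "y - x \<in> coboundaries X p i"
proof -
  have "y - x = zero_cochain X p i - (x - y)" using assms(2,3) by (intro eq_vecI) auto
  then show ?thesis using coboundaries_minus[OF coboundaries_zero assms(1)] by simp
qed

lemma coboundaries_diff_trans:
  assumes "x - y \<in> coboundaries X p i" "y - z \<in> coboundaries X p i"
    and "x \<in> cochains X p i" "y \<in> cochains X p i" "z \<in> cochains X p i"
  shows "x - z \<in> coboundaries X p i"
proof -
  have "x - z = (x - y) + (y - z)" using assms(3-5) by (intro eq_vecI) auto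
  then show ?thesis using coboundaries_add[OF assms(1,2)] by simp
qed

end

lemma rep_hom_minus_vec:
  fixes V :: "'k::field rep"
  assumes "f \<in> rep_hom n V W" "i < n" "x \<in> carrier_vec (dimv V i)" "y \<in> carrier_vec (dimv V i)"
  shows "f i *\<^sub>v (x - y) = f i *\<^sub>v x - f i *\<^sub>v y"
  by (rule mult_minus_distrib_mat_vec[OF rep_hom_carrier[OF assms(1,2)] assms(3,4)])

context
  fixes n and X Y :: "'k::field cpx" and f :: "'k gmap" and i :: nat
  assumes f: "chain_map n X Y f" and X: "is_cpx n X" and Y: "is_cpx n Y" and i: "i < n"
begin

lemma chain_map_cocycles: "z \<in> cocycles X p i \<Longrightarrow> f p i *\<^sub>v z \<in> cocycles Y p i"
  using chain_map_df[OF f X Y i, of z p] chain_map_vec[OF f i, of z p]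
    mult_mat_zero_vec[OF chain_map_carrier[OF f i, of "p + 1"]]
  by (auto simp: cocycles_def)

lemma chain_map_coboundaries: "z \<in> coboundaries X p i \<Longrightarrow> f p i *\<^sub>v z \<in> coboundaries Y p i"
  using chain_map_df[OF f X Y i, of _ "p - 1"] chain_map_vec[OF f i, of _ "p - 1"]
  by (auto simp: coboundaries_def)

end

text \<open>Differentials are homomorphisms of representations, so they commute with paths. Together
  with the companion lemma on coboundaries this is the action of paths on cohomology.\<close>

lemma path_cocycles:
  assumes X: "is_cpx n X" and i: "i < n" and z: "z \<in> cocycles X p i"
  shows "path_mat n (ob X p) i l *\<^sub>v z \<in> cocycles X p ((i + l) mod n)"
proof -
  have i': "(i + l) mod n < n" using i by simp
  have "df X p ((i + l) mod n) *\<^sub>v (path_mat n (ob X p) i l *\<^sub>v z) = path_mat n (ob X (p + 1)) i l *\<^sub>v (df X p i *\<^sub>v z)"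
    by (rule rep_hom_path[OF is_cpx_df_hom[OF X] is_cpx_rep[OF X] is_cpx_rep[OF X] i cocyclesD(1)[OF z]])
  also have "\<dots> = zero_cochain X (p + 1) ((i + l) mod n)"
    unfolding cocyclesD(2)[OF z] by (rule mult_mat_zero_vec[OF path_mat_carrier[OF is_cpx_rep[OF X] i]])
  finally show ?thesis
    using path_vec_carrier[OF is_cpx_rep[OF X] i cocyclesD(1)[OF z]] by (simp add: cocycles_def)
qed

lemma path_coboundaries:
  assumes X: "is_cpx n X" and i: "i < n" and z: "z \<in> coboundaries X p i"
  shows "path_mat n (ob X p) i l *\<^sub>v z \<in> coboundaries X p ((i + l) mod n)"
proof -
  obtain y where y: "y \<in> cochains X (p - 1) i" "z = df X (p - 1) i *\<^sub>v y"
    using z by (rule coboundariesE)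
  have "path_mat n (ob X p) i l *\<^sub>v z = df X (p - 1) ((i + l) mod n) *\<^sub>v (path_mat n (ob X (p - 1)) i l *\<^sub>v y)"
    using rep_hom_path[OF is_cpx_df_hom[OF X, of "p - 1"] is_cpx_rep[OF X] is_cpx_rep[OF X] i y(1)] y(2) by simp
  then show ?thesis by (rule coboundariesI[OF path_vec_carrier[OF is_cpx_rep[OF X] i y(1)]])
qed

lemma arr_cocycles:
  assumes X: "is_cpx n X" and i: "i < n" and z: "z \<in> cocycles X p i"
  shows "arr (ob X p) i *\<^sub>v z \<in> cocycles X p (Suc i mod n)"
  using path_cocycles[OF assms, of 1] path_mat_Suc_vec[OF is_cpx_rep[OF X] i cocyclesD(1)[OF z], of 0]
    cocyclesD(1)[OF z] i by simp

text \<open>On a cocycle the term \<open>h d\<close> of the homotopy formula dies and only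
  \<open>d h\<close> remains, so homotopic maps agree on cohomology.\<close>

lemma homotopicD:
  assumes h: "homotopic n X Y f g" and X: "is_cpx n X" and Y: "is_cpx n Y"
    and f: "\<And>p i. i < n \<Longrightarrow> f p i \<in> graded_maps X p i Y p i"
    and g: "\<And>p i. i < n \<Longrightarrow> g p i \<in> graded_maps X p i Y p i"
    and i: "i < n" and z: "z \<in> cocycles X p i"
  shows "f p i *\<^sub>v z - g p i *\<^sub>v z \<in> coboundaries Y p i"
proof -
  obtain h where h: "\<And>p. h p \<in> rep_hom n (ob X p) (ob Y (p - 1))"
    and eq: "\<And>p i. i < n \<Longrightarrow> f p i - g p i = df Y (p - 1) i * h p i + h (p + 1) i * df X p i"
    using h by (auto simp: homotopic_def)
  note hc = rep_hom_carrier[OF h i] and zc = cocyclesD(1)[OF z]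
  have hc': "h (p + 1) i \<in> graded_maps X (p + 1) i Y p i" using hc[of "p + 1"] by simp
  have "f p i *\<^sub>v z - g p i *\<^sub>v z = (f p i - g p i) *\<^sub>v z"
    using minus_mult_distrib_mat_vec[OF f[OF i] g[OF i] zc] by simp
  also have "\<dots> = df Y (p - 1) i *\<^sub>v (h p i *\<^sub>v z) + h (p + 1) i *\<^sub>v (df X p i *\<^sub>v z)"
    unfolding eq[OF i]
    by (subst add_mult_distrib_mat_vec[OF mult_carrier_mat[OF df_carrier'[OF Y i] hc] mult_carrier_mat[OF hc' is_cpx_df[OF X i]] zc])
      (simp add: assoc_mult_mat_vec[OF df_carrier'[OF Y i] hc zc] assoc_mult_mat_vec[OF hc' is_cpx_df[OF X i] zc])
  also have "h (p + 1) i *\<^sub>v (df X p i *\<^sub>v z) = zero_cochain Y p i"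
    unfolding cocyclesD(2)[OF z] by (rule mult_mat_zero_vec[OF hc'])
  also have "df Y (p - 1) i *\<^sub>v (h p i *\<^sub>v z) + zero_cochain Y p i = df Y (p - 1) i *\<^sub>v (h p i *\<^sub>v z)"
    using mult_mat_vec_carrier[OF df_carrier'[OF Y i] mult_mat_vec_carrier[OF hc zc]] by simp
  finally show ?thesis using mult_mat_vec_carrier[OF hc zc] by (intro coboundariesI) auto
qed

lemma homotopicI:
  assumes X: "is_cpx n X" and Y: "is_cpx n Y"
    and f: "\<And>p i. i < n \<Longrightarrow> f p i \<in> graded_maps X p i Y p i"
    and g: "\<And>p i. i < n \<Longrightarrow> g p i \<in> graded_maps X p i Y p i"
    and h: "\<And>p. h p \<in> rep_hom n (ob X p) (ob Y (p - 1))"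
    and eq: "\<And>p i x. i < n \<Longrightarrow> x \<in> cochains X p i \<Longrightarrow>
      f p i *\<^sub>v x - g p i *\<^sub>v x = df Y (p - 1) i *\<^sub>v (h p i *\<^sub>v x) + h (p + 1) i *\<^sub>v (df X p i *\<^sub>v x)"
  shows "homotopic n X Y f g"
proof -
  have "f p i - g p i = df Y (p - 1) i * h p i + h (p + 1) i * df X p i" if i: "i < n" for p i
  proof (rule mat_eq_by_vec)
    note hc = rep_hom_carrier[OF h i]
    have hc': "h (p + 1) i \<in> graded_maps X (p + 1) i Y p i" using hc[of "p + 1"] by simp
    note c1 = mult_carrier_mat[OF df_carrier'[OF Y i] hc] and c2 = mult_carrier_mat[OF hc' is_cpx_df[OF X i]]
    show "f p i - g p i \<in> graded_maps X p i Y p i" using g[OF i] by (rule minus_carrier_mat)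
    show "df Y (p - 1) i * h p i + h (p + 1) i * df X p i \<in> graded_maps X p i Y p i"
      using c2 by (rule add_carrier_mat)
    show "(f p i - g p i) *\<^sub>v x = (df Y (p - 1) i * h p i + h (p + 1) i * df X p i) *\<^sub>v x"
      if x: "x \<in> cochains X p i" for x
      unfolding minus_mult_distrib_mat_vec[OF f[OF i] g[OF i] x] add_mult_distrib_mat_vec[OF c1 c2 x]
        assoc_mult_mat_vec[OF df_carrier'[OF Y i] hc x] assoc_mult_mat_vec[OF hc' is_cpx_df[OF X i] x]
      by (rule eq[OF i x])
  qed
  then show ?thesis using h unfolding homotopic_def by blast
qed

lemma homotopicE:
  assumes h: "homotopic n X Y f g" and X: "is_cpx n X" and Y: "is_cpx n Y"
    and f: "\<And>p i. i < n \<Longrightarrow> f p i \<in> graded_maps X p i Y p i"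
    and g: "\<And>p i. i < n \<Longrightarrow> g p i \<in> graded_maps X p i Y p i"
  obtains h where "\<And>p. h p \<in> rep_hom n (ob X p) (ob Y (p - 1))"
    and "\<And>p i x. i < n \<Longrightarrow> x \<in> cochains X p i \<Longrightarrow>
      f p i *\<^sub>v x - g p i *\<^sub>v x = df Y (p - 1) i *\<^sub>v (h p i *\<^sub>v x) + h (p + 1) i *\<^sub>v (df X p i *\<^sub>v x)"
proof -
  obtain h where h: "\<And>p. h p \<in> rep_hom n (ob X p) (ob Y (p - 1))"
    and eq: "\<And>p i. i < n \<Longrightarrow> f p i - g p i = df Y (p - 1) i * h p i + h (p + 1) i * df X p i"
    using h by (auto simp: homotopic_def)
  have "f p i *\<^sub>v x - g p i *\<^sub>v x = df Y (p - 1) i *\<^sub>v (h p i *\<^sub>v x) + h (p + 1) i *\<^sub>v (df X p i *\<^sub>v x)"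
    if i: "i < n" and x: "x \<in> cochains X p i" for p i x
  proof -
    note hc = rep_hom_carrier[OF h i]
    have hc': "h (p + 1) i \<in> graded_maps X (p + 1) i Y p i" using hc[of "p + 1"] by simp
    note c1 = mult_carrier_mat[OF df_carrier'[OF Y i] hc] and c2 = mult_carrier_mat[OF hc' is_cpx_df[OF X i]]
    show ?thesis
      unfolding minus_mult_distrib_mat_vec[OF f[OF i] g[OF i] x, symmetric] eq[OF i] add_mult_distrib_mat_vec[OF c1 c2 x]
        assoc_mult_mat_vec[OF df_carrier'[OF Y i] hc x] assoc_mult_mat_vec[OF hc' is_cpx_df[OF X i] x] ..
  qed
  then show thesis using that h by blast
qed

section \<open>Quasi-isomorphisms\<close>

lemma quasi_iso_chain_map: "quasi_iso n X Y f \<Longrightarrow> chain_map n X Y f"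
  by (simp add: quasi_iso_def)

lemma quasi_iso_inj:
  "quasi_iso n X Y f \<Longrightarrow> i < n \<Longrightarrow> x \<in> cocycles X p i \<Longrightarrow> f p i *\<^sub>v x \<in> coboundaries Y p i \<Longrightarrow> x \<in> coboundaries X p i"
  by (simp add: quasi_iso_def)

lemma quasi_iso_surj:
  assumes "quasi_iso n X Y f" "i < n" "y \<in> cocycles Y p i"
  obtains x where "x \<in> cocycles X p i" "y - f p i *\<^sub>v x \<in> coboundaries Y p i"
  using assms unfolding quasi_iso_def by blast

lemma quasi_iso_id:
  assumes X: "is_cpx n X"
  shows "quasi_iso n X X (id_map X)"
  unfolding quasi_iso_def
proof (intro conjI allI impI ballI)
  fix p i y assume i: "i < n" and y: "y \<in> cocycles X p i"
  have "y - id_map X p i *\<^sub>v y = zero_cochain X p i"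
    using cocyclesD(1)[OF y] by (simp add: id_map_vec)
  then show "\<exists>x\<in>cocycles X p i. y - id_map X p i *\<^sub>v x \<in> coboundaries X p i"
    using y coboundaries_zero[OF X i, of p] by (intro bexI[of _ y]) simp_all
qed (auto simp: id_map_chain_map[OF X] id_map_vec dest: cocyclesD)

lemma quasi_iso_comp:
  assumes f: "quasi_iso n Y Z f" and g: "quasi_iso n X Y g"
    and X: "is_cpx n X" and Y: "is_cpx n Y" and Z: "is_cpx n Z"
  shows "quasi_iso n X Z (f \<circ>\<^sub>g g)"
  unfolding quasi_iso_def
proof (intro conjI allI impI ballI)
  note cf = quasi_iso_chain_map[OF f] and cg = quasi_iso_chain_map[OF g]
  show "chain_map n X Z (f \<circ>\<^sub>g g)" by (rule chain_map_comp[OF cf cg X Y Z])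
  fix p i assume i: "i < n"
  note comp = comp_map_vec[OF cf cg i cocyclesD(1)]
  show "x \<in> coboundaries X p i" if x: "x \<in> cocycles X p i" "(f \<circ>\<^sub>g g) p i *\<^sub>v x \<in> coboundaries Z p i" for x
    using quasi_iso_inj[OF g i x(1)] quasi_iso_inj[OF f i chain_map_cocycles[OF cg X Y i x(1)]] x(2)
    by (simp add: comp[OF x(1)])
  fix z assume z: "z \<in> cocycles Z p i"
  obtain y where y: "y \<in> cocycles Y p i" "z - f p i *\<^sub>v y \<in> coboundaries Z p i"
    using quasi_iso_surj[OF f i z] .
  obtain x where x: "x \<in> cocycles X p i" "y - g p i *\<^sub>v x \<in> coboundaries Y p i"
    using quasi_iso_surj[OF g i y(1)] .
  note gx = chain_map_cocycles[OF cg X Y i x(1)]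
  have "f p i *\<^sub>v y - f p i *\<^sub>v (g p i *\<^sub>v x) \<in> coboundaries Z p i"
    using chain_map_coboundaries[OF cf Y Z i x(2)]
      rep_hom_minus_vec[OF chain_map_hom[OF cf] i cocyclesD(1)[OF y(1)] cocyclesD(1)[OF gx]] by simp
  then have "z - f p i *\<^sub>v (g p i *\<^sub>v x) \<in> coboundaries Z p i"
    by (rule coboundaries_diff_trans[OF Z i y(2)])
      (use z y gx chain_map_cocycles[OF cf Y Z i] in \<open>auto dest: cocyclesD\<close>)
  then show "\<exists>x\<in>cocycles X p i. z - (f \<circ>\<^sub>g g) p i *\<^sub>v x \<in> coboundaries Z p i"
    using x(1) comp[OF x(1)] by (intro bexI[of _ x]) simp_all
qed

section \<open>Twisted direct sums of complexes\<close>

text \<open>The coordinate projections onto one block of a direct sum; the three special cases below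
  read off the components of concatenated vectors.\<close>

definition sel_mat :: "nat \<Rightarrow> nat \<Rightarrow> nat \<Rightarrow> 'k::field mat" where
  "sel_mat m n k = mat m n (\<lambda>(r, c). if c = k + r then 1 else 0)"

lemma sel_mat_carrier: "sel_mat m n k \<in> carrier_mat m n"
  by (simp add: sel_mat_def)

lemma sel_mat_vec:
  assumes "k + m \<le> n" "v \<in> carrier_vec n"
  shows "sel_mat m n k *\<^sub>v v = vec m (\<lambda>r. v $ (k + r))"
proof (rule eq_vecI)
  fix r assume "r < dim_vec (vec m (\<lambda>r. v $ (k + r)))"
  then have r: "r < m" by simp
  have "(sel_mat m n k *\<^sub>v v) $ r = (\<Sum>c = 0..<n. (if c = k + r then 1 else 0) * v $ c)"
    using r assms by (simp add: sel_mat_def scalar_prod_def)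
  also have "\<dots> = (\<Sum>c = 0..<n. if c = k + r then v $ (k + r) else 0)"
    by (rule sum.cong) auto
  also have "\<dots> = v $ (k + r)" using r assms by simp
  finally show "(sel_mat m n k *\<^sub>v v) $ r = vec m (\<lambda>r. v $ (k + r)) $ r" using r by simp
qed (simp add: sel_mat_def)

lemma sel_mat_fst:
  assumes "x \<in> carrier_vec a" "y \<in> carrier_vec b"
  shows "sel_mat a (a + b) 0 *\<^sub>v (x @\<^sub>v y) = x"
  by (subst sel_mat_vec) (use assms in auto)

lemma sel_mat_mid:
  assumes "x \<in> carrier_vec a" "y \<in> carrier_vec b" "z \<in> carrier_vec c"
  shows "sel_mat b (a + (b + c)) a *\<^sub>v (x @\<^sub>v (y @\<^sub>v z)) = y"
  by (subst sel_mat_vec) (use assms in auto)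

lemma sel_mat_last:
  assumes "x \<in> carrier_vec a" "y \<in> carrier_vec b" "z \<in> carrier_vec c"
  shows "sel_mat c (a + (b + c)) (a + b) *\<^sub>v (x @\<^sub>v (y @\<^sub>v z)) = z"
  by (subst sel_mat_vec) (use assms in auto)

lemma append_vec_split:
  assumes "v \<in> carrier_vec (a + b)"
  obtains x y where "x \<in> carrier_vec a" "y \<in> carrier_vec b" "v = x @\<^sub>v y"
  using assms that all_vec_append[of a b "\<lambda>v. \<exists>x\<in>carrier_vec a. \<exists>y\<in>carrier_vec b. v = x @\<^sub>v y"] by blast

lemma append_zero_vec: "0\<^sub>v a @\<^sub>v 0\<^sub>v b = 0\<^sub>v (a + b)"
  by (intro eq_vecI) auto

lemma add_diff_vec:
  fixes a b :: "'k::field vec"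
  assumes "a \<in> carrier_vec m" "b \<in> carrier_vec m"
  shows "a + (b - a) = b"
  using assms by (intro eq_vecI) auto

lemma mult_mat_uminus_vec:
  fixes A :: "'k::field mat"
  assumes A: "A \<in> carrier_mat m l" and x: "x \<in> carrier_vec l"
  shows "A *\<^sub>v (- x) = - (A *\<^sub>v x)"
proof -
  have "- x = 0\<^sub>v l - x" using x by (intro eq_vecI) auto
  then have "A *\<^sub>v (- x) = 0\<^sub>v m - A *\<^sub>v x"
    using mult_minus_distrib_mat_vec[OF A zero_carrier_vec x] mult_mat_zero_vec[OF A] by simp
  also have "\<dots> = - (A *\<^sub>v x)" using A by (intro eq_vecI) auto
  finally show ?thesis .
qed

lemma is_cpx_nilpotent:
  assumes "is_cpx n X"
  obtains l where "\<And>i. i < n \<Longrightarrow> path_mat n (ob X p) i l = 0\<^sub>m (dimv (ob X p) ((i + l) mod n)) (dimv (ob X p) i)"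
proof -
  have "nilpotent_rep n (ob X p)" using assms by (simp add: is_cpx_def tube_def)
  then show thesis using that unfolding nilpotent_rep_def by blast
qed

definition acyclic_cpx :: "nat \<Rightarrow> 'k::field cpx \<Rightarrow> bool" where
  "acyclic_cpx n X \<longleftrightarrow> (\<forall>p. \<forall>i<n. cocycles X p i \<subseteq> coboundaries X p i)"

text \<open>The underlying spaces are $A \oplus B$; arrows and differentials are the lower triangular matrices with
  off-diagonal entries \<open>\<epsilon>\<close> and \<open>\<sigma>\<close>. Thus \<open>\<epsilon>\<close> records extensions of
  representations and \<open>\<sigma>\<close> mapping cones.\<close>

definition twisted :: "nat \<Rightarrow> 'k::field cpx \<Rightarrow> 'k cpx \<Rightarrow> 'k gmap \<Rightarrow> 'k gmap \<Rightarrow> 'k cpx" where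
  "twisted n A B \<epsilon> \<sigma> = \<lparr>
     ob = (\<lambda>p. \<lparr> dimv = (\<lambda>i. dimv (ob A p) i + dimv (ob B p) i),
                arr = (\<lambda>i. four_block_mat (arr (ob A p) i) (0\<^sub>m (dimv (ob A p) (Suc i mod n)) (dimv (ob B p) i))
                                          (\<epsilon> p i) (arr (ob B p) i)) \<rparr>),
     df = (\<lambda>p i. four_block_mat (df A p i) (0\<^sub>m (dimv (ob A (p + 1)) i) (dimv (ob B p) i))
                                (\<sigma> p i) (df B p i)) \<rparr>"

text \<open>For the block triangular matrices of \<open>twisted\<close>, \<open>sig_df\<close> is
  the off-diagonal entry of \<open>d d = 0\<close>, and \<open>sig_arr\<close> is the off-diagonal
  entry of the commutation of differentials with arrows. The diagonal entries hold because
  \<open>A\<close> and \<open>B\<close> are complexes.\<close>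

locale twisting =
  fixes n :: nat and A B :: "'k::field cpx" and \<epsilon> \<sigma> :: "'k gmap"
  assumes A: "is_cpx n A" and B: "is_cpx n B"
    and eps: "\<And>p i. i < n \<Longrightarrow> \<epsilon> p i \<in> graded_maps A p i B p (Suc i mod n)"
    and sig: "\<And>p i. i < n \<Longrightarrow> \<sigma> p i \<in> graded_maps A p i B (p + 1) i"
    and sig_df: "\<And>p i z. i < n \<Longrightarrow> z \<in> cochains A p i \<Longrightarrow>
      \<sigma> (p + 1) i *\<^sub>v (df A p i *\<^sub>v z) + df B (p + 1) i *\<^sub>v (\<sigma> p i *\<^sub>v z) = zero_cochain B (p + 2) i"
    and sig_arr: "\<And>p i z. i < n \<Longrightarrow> z \<in> cochains A p i \<Longrightarrow>
      \<sigma> p (Suc i mod n) *\<^sub>v (arr (ob A p) i *\<^sub>v z) + df B p (Suc i mod n) *\<^sub>v (\<epsilon> p i *\<^sub>v z)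
        = \<epsilon> (p + 1) i *\<^sub>v (df A p i *\<^sub>v z) + arr (ob B (p + 1)) i *\<^sub>v (\<sigma> p i *\<^sub>v z)"
begin

abbreviation "T \<equiv> twisted n A B \<epsilon> \<sigma>"

lemma dimv_T: "dimv (ob T p) i = dimv (ob A p) i + dimv (ob B p) i"
  by (simp add: twisted_def)

lemma T_carrier:
  "x \<in> cochains A p i \<Longrightarrow> y \<in> cochains B p i \<Longrightarrow>
    x @\<^sub>v y \<in> cochains T p i"
  by (simp add: dimv_T)

lemma T_split:
  assumes "v \<in> cochains T p i"
  obtains x y where "x \<in> cochains A p i" "y \<in> cochains B p i" "v = x @\<^sub>v y"
  using assms unfolding dimv_T by (rule append_vec_split)

lemma eps_vec: "i < n \<Longrightarrow> x \<in> cochains A p i \<Longrightarrow>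
    \<epsilon> p i *\<^sub>v x \<in> cochains B p (Suc i mod n)"
  using eps by (rule mult_mat_vec_carrier)

lemma sig_vec: "i < n \<Longrightarrow> x \<in> cochains A p i \<Longrightarrow>
    \<sigma> p i *\<^sub>v x \<in> cochains B (p + 1) i"
  using sig by (rule mult_mat_vec_carrier)

lemma T_arr:
  assumes i: "i < n" and x: "x \<in> cochains A p i" and y: "y \<in> cochains B p i"
  shows "arr (ob T p) i *\<^sub>v (x @\<^sub>v y) = (arr (ob A p) i *\<^sub>v x) @\<^sub>v (\<epsilon> p i *\<^sub>v x + arr (ob B p) i *\<^sub>v y)"
  using four_block_mat_mult_vec[OF is_cpx_arr[OF A i] zero_carrier_mat eps[OF i] is_cpx_arr[OF B i] x y]
    is_cpx_arr_vec[OF A i x] y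
  by (simp add: twisted_def zero_mat_mult_vec)

lemma T_df:
  assumes i: "i < n" and x: "x \<in> cochains A p i" and y: "y \<in> cochains B p i"
  shows "df T p i *\<^sub>v (x @\<^sub>v y) = (df A p i *\<^sub>v x) @\<^sub>v (\<sigma> p i *\<^sub>v x + df B p i *\<^sub>v y)"
  using four_block_mat_mult_vec[OF is_cpx_df[OF A i] zero_carrier_mat sig[OF i] is_cpx_df[OF B i] x y]
    is_cpx_df_vec[OF A i x] y
  by (simp add: twisted_def zero_mat_mult_vec)

lemma T_arr_carrier:
  "i < n \<Longrightarrow> arr (ob T p) i \<in> graded_maps T p i T p (Suc i mod n)"
  unfolding dimv_T using is_cpx_arr[OF A] is_cpx_arr[OF B] by (simp add: twisted_def)

lemma T_df_carrier:
  "i < n \<Longrightarrow> df T p i \<in> graded_maps T p i T (p + 1) i"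
  unfolding dimv_T using is_cpx_df[OF A] is_cpx_df[OF B] by (simp add: twisted_def)

lemma T_rep: "is_rep n (ob T p)"
  using T_arr_carrier by (simp add: is_rep_def)

lemma T_path_snd:
  assumes i: "i < n" and y: "y \<in> cochains B p i"
  shows "path_mat n (ob T p) i l *\<^sub>v (zero_cochain A p i @\<^sub>v y)
    = zero_cochain A p ((i + l) mod n) @\<^sub>v (path_mat n (ob B p) i l *\<^sub>v y)"
proof (induction l)
  case 0
  then show ?case using i y by (simp add: path_mat_0_vec T_carrier dimv_T)
next
  case (Suc l)
  have j: "(i + l) mod n < n" using i by simp
  have v: "zero_cochain A p i @\<^sub>v y \<in> cochains T p i" using y by (intro T_carrier) auto
  note py = path_vec_carrier[OF is_cpx_rep[OF B] i y]
  show ?case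
    unfolding path_mat_Suc_vec[OF T_rep i v] Suc T_arr[OF j zero_carrier_vec py]
      path_mat_Suc_vec[OF is_cpx_rep[OF B] i y] mult_mat_zero_vec[OF is_cpx_arr[OF A j]] mult_mat_zero_vec[OF eps[OF j]]
    using is_cpx_arr_vec[OF B j py] by (simp add: mod_Suc_eq)
qed

lemma T_path_fst:
  assumes i: "i < n" and x: "x \<in> cochains A p i" and y: "y \<in> cochains B p i"
  shows "\<exists>y' \<in> cochains B p ((i + l) mod n).
    path_mat n (ob T p) i l *\<^sub>v (x @\<^sub>v y) = (path_mat n (ob A p) i l *\<^sub>v x) @\<^sub>v y'"
proof (induction l)
  case 0
  then show ?case using i x y by (intro bexI[of _ y]) (simp_all add: path_mat_0_vec T_carrier)
next
  case (Suc l)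
  have j: "(i + l) mod n < n" using i by simp
  have v: "x @\<^sub>v y \<in> cochains T p i" using x y by (rule T_carrier)
  obtain y' where y': "y' \<in> cochains B p ((i + l) mod n)"
    "path_mat n (ob T p) i l *\<^sub>v (x @\<^sub>v y) = (path_mat n (ob A p) i l *\<^sub>v x) @\<^sub>v y'" using Suc by blast
  note px = path_vec_carrier[OF is_cpx_rep[OF A] i x]
  show ?case
    unfolding path_mat_Suc_vec[OF T_rep i v] y'(2) T_arr[OF j px y'(1)] path_mat_Suc_vec[OF is_cpx_rep[OF A] i x]
    using eps_vec[OF j px] is_cpx_arr_vec[OF B j y'(1)]
    by (intro bexI[of _ "\<epsilon> p ((i + l) mod n) *\<^sub>v (path_mat n (ob A p) i l *\<^sub>v x) + arr (ob B p) ((i + l) mod n) *\<^sub>v y'"])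
      (simp_all add: mod_Suc_eq)
qed

text \<open>\<open>B\<close> is a subrepresentation with quotient \<open>A\<close>. A path that
  kills \<open>A\<close> moves everything into \<open>B\<close>, so nilpotency lengths add
  up.\<close>

lemma T_tube: "ob T p \<in> tube n"
proof -
  obtain a where a: "\<And>i. i < n \<Longrightarrow> path_mat n (ob A p) i a = 0\<^sub>m (dimv (ob A p) ((i + a) mod n)) (dimv (ob A p) i)"
    using is_cpx_nilpotent[OF A] by blast
  obtain b where b: "\<And>i. i < n \<Longrightarrow> path_mat n (ob B p) i b = 0\<^sub>m (dimv (ob B p) ((i + b) mod n)) (dimv (ob B p) i)"
    using is_cpx_nilpotent[OF B] by blast
  have "path_mat n (ob T p) i (a + b) = 0\<^sub>m (dimv (ob T p) ((i + (a + b)) mod n)) (dimv (ob T p) i)" if i: "i < n" for i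
  proof (rule mat_eq_by_vec[OF path_mat_carrier[OF T_rep i] zero_carrier_mat])
    fix v :: "'k vec" assume v: "v \<in> cochains T p i"
    obtain x y where xy: "x \<in> cochains A p i" "y \<in> cochains B p i" "v = x @\<^sub>v y"
      using v by (rule T_split)
    have j: "(i + a) mod n < n" using i by simp
    obtain y' where y': "y' \<in> cochains B p ((i + a) mod n)"
      "path_mat n (ob T p) i a *\<^sub>v v = (path_mat n (ob A p) i a *\<^sub>v x) @\<^sub>v y'"
      using T_path_fst[OF i xy(1,2)] xy(3) by blast
    have "path_mat n (ob T p) i (a + b) *\<^sub>v v
        = path_mat n (ob T p) ((i + a) mod n) b *\<^sub>v (zero_cochain A p ((i + a) mod n) @\<^sub>v y')"
      unfolding path_mat_add_vec[OF T_rep i v] y'(2) a[OF i] zero_mat_mult_vec[OF xy(1)] ..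
    also have "\<dots> = zero_cochain T p ((i + (a + b)) mod n)"
      unfolding T_path_snd[OF j y'(1)] b[OF j] zero_mat_mult_vec[OF y'(1)] append_zero_vec dimv_T
      by (simp add: mod_add_left_eq add.assoc)
    finally show "path_mat n (ob T p) i (a + b) *\<^sub>v v = 0\<^sub>m (dimv (ob T p) ((i + (a + b)) mod n)) (dimv (ob T p) i) *\<^sub>v v"
      using v by (simp add: zero_mat_mult_vec)
  qed
  then show ?thesis using T_rep by (auto simp: tube_def nilpotent_rep_def)
qed

lemma T_cpx: "is_cpx n T"
proof -
  obtain a where a: "\<And>p i. \<bar>p\<bar> > a \<Longrightarrow> i < n \<Longrightarrow> dimv (ob A p) i = 0" using A unfolding is_cpx_def by blast
  obtain b where b: "\<And>p i. \<bar>p\<bar> > b \<Longrightarrow> i < n \<Longrightarrow> dimv (ob B p) i = 0" using B unfolding is_cpx_def by blast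
  show ?thesis
  proof (rule is_cpxI[where b = "max a b"])
    show "ob T p \<in> tube n" for p by (rule T_tube)
    show "dimv (ob T p) i = 0" if "\<bar>p\<bar> > max a b" "i < n" for p i
      using a[of p i] b[of p i] that by (simp add: dimv_T)
    fix p i assume i: "i < n"
    show "df T p i \<in> graded_maps T p i T (p + 1) i" by (rule T_df_carrier[OF i])
    have j: "Suc i mod n < n" using i by simp
    fix v :: "'k vec" assume v: "v \<in> cochains T p i"
    obtain x y where xy: "x \<in> cochains A p i" "y \<in> cochains B p i" "v = x @\<^sub>v y"
      using v by (rule T_split)
    note x = xy(1) and y = xy(2)
    note ax = is_cpx_arr_vec[OF A i x] and by' = is_cpx_arr_vec[OF B i y] and ex = eps_vec[OF i x]
      and dx = is_cpx_df_vec[OF A i x] and dy = is_cpx_df_vec[OF B i y] and sx = sig_vec[OF i x]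
    have "df T p (Suc i mod n) *\<^sub>v (arr (ob T p) i *\<^sub>v v)
      = (df A p (Suc i mod n) *\<^sub>v (arr (ob A p) i *\<^sub>v x)) @\<^sub>v
        (\<sigma> p (Suc i mod n) *\<^sub>v (arr (ob A p) i *\<^sub>v x) + df B p (Suc i mod n) *\<^sub>v (\<epsilon> p i *\<^sub>v x + arr (ob B p) i *\<^sub>v y))"
      unfolding xy(3) T_arr[OF i x y] T_df[OF j ax add_carrier_vec[OF ex by']] ..
    also have "\<sigma> p (Suc i mod n) *\<^sub>v (arr (ob A p) i *\<^sub>v x) + df B p (Suc i mod n) *\<^sub>v (\<epsilon> p i *\<^sub>v x + arr (ob B p) i *\<^sub>v y)
      = (\<sigma> p (Suc i mod n) *\<^sub>v (arr (ob A p) i *\<^sub>v x) + df B p (Suc i mod n) *\<^sub>v (\<epsilon> p i *\<^sub>v x))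
        + arr (ob B (p + 1)) i *\<^sub>v (df B p i *\<^sub>v y)"
      unfolding mult_add_distrib_mat_vec[OF is_cpx_df[OF B j] ex by'] is_cpx_df_arr[OF B i y]
      by (rule assoc_add_vec[symmetric, OF sig_vec[OF j ax] is_cpx_df_vec[OF B j ex] is_cpx_arr_vec[OF B i dy]])
    also have "\<dots> = \<epsilon> (p + 1) i *\<^sub>v (df A p i *\<^sub>v x) + arr (ob B (p + 1)) i *\<^sub>v (\<sigma> p i *\<^sub>v x + df B p i *\<^sub>v y)"
      unfolding sig_arr[OF i x] mult_add_distrib_mat_vec[OF is_cpx_arr[OF B i] sx dy]
      by (rule assoc_add_vec[OF eps_vec[OF i dx] is_cpx_arr_vec[OF B i sx] is_cpx_arr_vec[OF B i dy]])
    finally show "df T p (Suc i mod n) *\<^sub>v (arr (ob T p) i *\<^sub>v v) = arr (ob T (p + 1)) i *\<^sub>v (df T p i *\<^sub>v v)"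
      unfolding xy(3) T_df[OF i x y] T_arr[OF i dx add_carrier_vec[OF sx dy]] is_cpx_df_arr[OF A i x] .
    have dsx: "df B (p + 1) i *\<^sub>v (\<sigma> p i *\<^sub>v x) \<in> cochains B (p + 2) i"
      using is_cpx_df_vec[OF B i sx] by (simp add: add.assoc)
    have sdx: "\<sigma> (p + 1) i *\<^sub>v (df A p i *\<^sub>v x) \<in> cochains B (p + 2) i"
      using sig_vec[OF i dx] by (simp add: add.assoc)
    have "\<sigma> (p + 1) i *\<^sub>v (df A p i *\<^sub>v x) + df B (p + 1) i *\<^sub>v (\<sigma> p i *\<^sub>v x + df B p i *\<^sub>v y)
      = zero_cochain B (p + 2) i"
      unfolding mult_add_distrib_mat_vec[OF is_cpx_df[OF B i] sx dy] is_cpx_df_df[OF B i y]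
      using sig_df[OF i x] dsx by simp
    then show "df T (p + 1) i *\<^sub>v (df T p i *\<^sub>v v) = zero_cochain T (p + 2) i"
      unfolding xy(3) T_df[OF i x y] T_df[OF i dx add_carrier_vec[OF sx dy]] is_cpx_df_df[OF A i x] dimv_T
      by (simp add: append_zero_vec)
  qed
qed

definition pr :: "'k gmap" where "pr = (\<lambda>p i. sel_mat (dimv (ob A p) i) (dimv (ob T p) i) 0)"

lemma pr_vec:
  "x \<in> cochains A p i \<Longrightarrow> y \<in> cochains B p i \<Longrightarrow> pr p i *\<^sub>v (x @\<^sub>v y) = x"
  unfolding pr_def dimv_T by (rule sel_mat_fst)

lemma pr_chain_map: "chain_map n T A pr"
proof (rule chain_mapI[OF T_cpx A])
  fix p i assume i: "i < n"
  show "pr p i \<in> graded_maps T p i A p i" unfolding pr_def by (rule sel_mat_carrier)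
  fix v :: "'k vec" assume v: "v \<in> cochains T p i"
  obtain x y where xy: "x \<in> cochains A p i" "y \<in> cochains B p i" "v = x @\<^sub>v y"
    using v by (rule T_split)
  note x = xy(1) and y = xy(2)
  show "pr p (Suc i mod n) *\<^sub>v (arr (ob T p) i *\<^sub>v v) = arr (ob A p) i *\<^sub>v (pr p i *\<^sub>v v)"
    unfolding xy(3) T_arr[OF i x y] pr_vec[OF x y]
    by (rule pr_vec[OF is_cpx_arr_vec[OF A i x] add_carrier_vec[OF eps_vec[OF i x] is_cpx_arr_vec[OF B i y]]])
  show "pr (p + 1) i *\<^sub>v (df T p i *\<^sub>v v) = df A p i *\<^sub>v (pr p i *\<^sub>v v)"
    unfolding xy(3) T_df[OF i x y] pr_vec[OF x y]
    by (rule pr_vec[OF is_cpx_df_vec[OF A i x] add_carrier_vec[OF sig_vec[OF i x] is_cpx_df_vec[OF B i y]]])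
qed

lemma T_cocycle:
  assumes i: "i < n" and x: "x \<in> cochains A p i" and y: "y \<in> cochains B p i"
  shows "x @\<^sub>v y \<in> cocycles T p i \<longleftrightarrow>
    x \<in> cocycles A p i \<and> \<sigma> p i *\<^sub>v x + df B p i *\<^sub>v y = zero_cochain B (p + 1) i"
  using append_vec_eq[OF is_cpx_df_vec[OF A i x] zero_carrier_vec,
      of "\<sigma> p i *\<^sub>v x + df B p i *\<^sub>v y" "zero_cochain B (p + 1) i"]
  by (simp add: cocycles_def append_carrier_vec[OF x y] x T_df[OF i x y] dimv_T append_zero_vec[symmetric])

lemma T_coboundaryI:
  assumes i: "i < n" and x: "x \<in> cochains A (p - 1) i" and y: "y \<in> cochains B (p - 1) i"
  shows "(df A (p - 1) i *\<^sub>v x) @\<^sub>v (\<sigma> (p - 1) i *\<^sub>v x + df B (p - 1) i *\<^sub>v y) \<in> coboundaries T p i"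
  by (rule coboundariesI[OF T_carrier[OF x y]]) (simp add: T_df[OF i x y])

text \<open>\<open>pr\<close> is the quotient map of a short exact sequence of complexes whose
  kernel \<open>B\<close> is acyclic. The long exact sequence is replaced by a chase on pairs
  \<open>(x, y)\<close>.\<close>

lemma pr_quasi_iso:
  assumes acyc: "acyclic_cpx n B"
  shows "quasi_iso n T A pr"
  unfolding quasi_iso_def
proof (intro conjI allI impI ballI)
  show "chain_map n T A pr" by (rule pr_chain_map)
  fix p i assume i: "i < n"
  show "v \<in> coboundaries T p i" if v: "v \<in> cocycles T p i" and pv: "pr p i *\<^sub>v v \<in> coboundaries A p i" for v
  proof -
    obtain x y where xy: "x \<in> cochains A p i" "y \<in> cochains B p i" "v = x @\<^sub>v y"
      using cocyclesD(1)[OF v] by (rule T_split)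
    have "x \<in> coboundaries A p i" using pv pr_vec[OF xy(1,2)] xy(3) by simp
    then obtain x0 where x0: "x0 \<in> cochains A (p - 1) i" "x = df A (p - 1) i *\<^sub>v x0"
      by (rule coboundariesE)
    \<comment> \<open>Subtracting the coboundary \<open>(x, \<sigma> x0)\<close> of
      \<open>(x0, 0)\<close> from \<open>(x, y)\<close> leaves \<open>(0, y - \<sigma> x0)\<close>,
      and its second component is a cocycle of the acyclic \<open>B\<close>.\<close>
    have s0: "\<sigma> (p - 1) i *\<^sub>v x0 \<in> cochains B p i" using sig_vec[OF i x0(1)] by simp
    have 1: "\<sigma> p i *\<^sub>v x + df B p i *\<^sub>v y = zero_cochain B (p + 1) i"
      using v T_cocycle[OF i xy(1,2)] xy(3) by simp
    have 2: "\<sigma> p i *\<^sub>v x + df B p i *\<^sub>v (\<sigma> (p - 1) i *\<^sub>v x0) = zero_cochain B (p + 1) i"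
      using sig_df[OF i x0(1)] x0(2) by (simp add: add.commute)
    have sx: "\<sigma> p i *\<^sub>v x \<in> cochains B (p + 1) i" by (rule sig_vec[OF i xy(1)])
    have "df B p i *\<^sub>v y = df B p i *\<^sub>v (\<sigma> (p - 1) i *\<^sub>v x0)"
    proof (rule eq_vecI)
      note c = carrier_vecD[OF sx] carrier_vecD[OF is_cpx_df_vec[OF B i xy(2)]] carrier_vecD[OF is_cpx_df_vec[OF B i s0]]
      show "dim_vec (df B p i *\<^sub>v y) = dim_vec (df B p i *\<^sub>v (\<sigma> (p - 1) i *\<^sub>v x0))" using c by simp
      fix r assume "r < dim_vec (df B p i *\<^sub>v (\<sigma> (p - 1) i *\<^sub>v x0))"
      then have r: "r < dimv (ob B (p + 1)) i" using c by simp
      have "(\<sigma> p i *\<^sub>v x) $ r + (df B p i *\<^sub>v y) $ r = 0"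
        using arg_cong[OF 1, of "\<lambda>v. v $ r"] r c by (simp del: index_mult_mat_vec dim_mult_mat_vec)
      moreover have "(\<sigma> p i *\<^sub>v x) $ r + (df B p i *\<^sub>v (\<sigma> (p - 1) i *\<^sub>v x0)) $ r = 0"
        using arg_cong[OF 2, of "\<lambda>v. v $ r"] r c by (simp del: index_mult_mat_vec dim_mult_mat_vec)
      ultimately show "(df B p i *\<^sub>v y) $ r = (df B p i *\<^sub>v (\<sigma> (p - 1) i *\<^sub>v x0)) $ r" by (metis add_left_cancel)
    qed
    then have "y - \<sigma> (p - 1) i *\<^sub>v x0 \<in> cocycles B p i"
      using mult_minus_distrib_mat_vec[OF is_cpx_df[OF B i] xy(2) s0] is_cpx_df_vec[OF B i s0] xy(2) s0
      by (simp add: cocycles_def)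
    then have "y - \<sigma> (p - 1) i *\<^sub>v x0 \<in> coboundaries B p i" using acyc i by (auto simp: acyclic_cpx_def)
    then obtain y0 where y0: "y0 \<in> cochains B (p - 1) i" "y - \<sigma> (p - 1) i *\<^sub>v x0 = df B (p - 1) i *\<^sub>v y0"
      by (rule coboundariesE)
    have "y = \<sigma> (p - 1) i *\<^sub>v x0 + df B (p - 1) i *\<^sub>v y0"
      unfolding y0(2)[symmetric] by (rule add_diff_vec[OF s0 xy(2), symmetric])
    then show ?thesis using T_coboundaryI[OF i x0(1) y0(1)] xy(3) x0(2) by simp
  qed
  fix x assume x: "x \<in> cocycles A p i"
  note xc = cocyclesD(1)[OF x]
  have sx: "\<sigma> p i *\<^sub>v x \<in> cochains B (p + 1) i" by (rule sig_vec[OF i xc])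
  \<comment> \<open>By \<open>sig_df\<close> the obstruction \<open>\<sigma> x\<close> is a cocycle
    of the acyclic \<open>B\<close>. A cochain \<open>y0\<close> that bounds it corrects the naive
    lift \<open>(x, 0)\<close> to the cocycle \<open>(x, - y0)\<close>.\<close>
  have "\<sigma> p i *\<^sub>v x \<in> cocycles B (p + 1) i"
    using sig_df[OF i xc] is_cpx_df_vec[OF B i sx] sx mult_mat_zero_vec[OF sig[OF i]]
    unfolding cocyclesD(2)[OF x] by (simp add: cocycles_def add.assoc)
  then have "\<sigma> p i *\<^sub>v x \<in> coboundaries B (p + 1) i" using acyc i by (auto simp: acyclic_cpx_def)
  then obtain y0 where y0: "y0 \<in> cochains B p i" "\<sigma> p i *\<^sub>v x = df B p i *\<^sub>v y0"
    by (auto elim: coboundariesE)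
  have "df B p i *\<^sub>v (- y0) = - (\<sigma> p i *\<^sub>v x)"
    unfolding y0(2) by (rule mult_mat_uminus_vec[OF is_cpx_df[OF B i] y0(1)])
  then have "x @\<^sub>v (- y0) \<in> cocycles T p i"
    using T_cocycle[OF i xc] y0(1) x sx by simp
  moreover have "x - pr p i *\<^sub>v (x @\<^sub>v (- y0)) \<in> coboundaries A p i"
    using pr_vec[OF xc] y0(1) xc coboundaries_zero[OF A i] by simp
  ultimately show "\<exists>v \<in> cocycles T p i. x - pr p i *\<^sub>v v \<in> coboundaries A p i" by blast
qed

end

section \<open>Cocones\<close>

lemma ob_shift: "ob (shift_cpx m X) p = ob X (p + m)"
  by (simp add: shift_cpx_def)

lemma df_shift: "df (shift_cpx m X) p i = (if even m then df X (p + m) i else - df X (p + m) i)"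
  by (simp add: shift_cpx_def)

lemma df_shift_vec:
  fixes X :: "'k::field cpx"
  assumes "is_cpx n X" "i < n" "x \<in> cochains X (p + m) i"
  shows "df (shift_cpx m X) p i *\<^sub>v x = (if even m then df X (p + m) i *\<^sub>v x else - (df X (p + m) i *\<^sub>v x))"
  using is_cpx_df[OF assms(1,2), of "p + m"] assms(3) by (simp add: df_shift)

lemma is_cpx_shift:
  assumes X: "is_cpx n X"
  shows "is_cpx n (shift_cpx m X)"
proof -
  obtain b where b: "\<And>p i. \<bar>p\<bar> > b \<Longrightarrow> i < n \<Longrightarrow> dimv (ob X p) i = 0" using X unfolding is_cpx_def by blast
  show ?thesis
  proof (rule is_cpxI[where b = "b + \<bar>m\<bar>"])
    show "ob (shift_cpx m X) p \<in> tube n" for p using X by (simp add: ob_shift is_cpx_def)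
    show "dimv (ob (shift_cpx m X) p) i = 0" if "\<bar>p\<bar> > b + \<bar>m\<bar>" "i < n" for p i
      using b[of "p + m"] that by (simp add: ob_shift)
    fix p i assume i: "i < n"
    then have j: "Suc i mod n < n" by simp
    have pm: "p + 1 + m = p + m + 1" "p + 2 + m = p + m + 2" by simp_all
    show c: "df (shift_cpx m X) p i \<in> graded_maps (shift_cpx m X) p i (shift_cpx m X) (p + 1) i"
      using is_cpx_df[OF X i, of "p + m"] by (simp add: df_shift ob_shift pm)
    fix x :: "'a vec" assume "x \<in> cochains (shift_cpx m X) p i"
    then have x: "x \<in> cochains X (p + m) i" by (simp add: ob_shift)
    have ax: "arr (ob X (p + m)) i *\<^sub>v x \<in> cochains X (p + m) (Suc i mod n)"
      by (rule is_cpx_arr_vec[OF X i x])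
    have dx: "df X (p + m) i *\<^sub>v x \<in> cochains X (p + 1 + m) i"
      using is_cpx_df_vec[OF X i x] by (simp only: pm)
    have ac: "arr (ob X (p + 1 + m)) i \<in> graded_maps X (p + 1 + m) i X (p + 1 + m) (Suc i mod n)"
      by (rule is_cpx_arr[OF X i])
    have dc: "df X (p + 1 + m) i \<in> graded_maps X (p + 1 + m) i X (p + 2 + m) i"
      using is_cpx_df[OF X i, of "p + 1 + m"] by (simp add: ac_simps)
    show "df (shift_cpx m X) p (Suc i mod n) *\<^sub>v (arr (ob (shift_cpx m X) p) i *\<^sub>v x)
      = arr (ob (shift_cpx m X) (p + 1)) i *\<^sub>v (df (shift_cpx m X) p i *\<^sub>v x)"
      unfolding ob_shift df_shift_vec[OF X i x] df_shift_vec[OF X j ax] is_cpx_df_arr[OF X i x]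
      using mult_mat_uminus_vec[OF ac dx] by (simp add: pm)
    have dd: "df X (p + 1 + m) i *\<^sub>v (df X (p + m) i *\<^sub>v x) = zero_cochain X (p + 2 + m) i"
      using is_cpx_df_df[OF X i x] by (simp only: pm)
    have udx: "- (df X (p + m) i *\<^sub>v x) \<in> cochains X (p + 1 + m) i" using dx by simp
    show "df (shift_cpx m X) (p + 1) i *\<^sub>v (df (shift_cpx m X) p i *\<^sub>v x) = zero_cochain (shift_cpx m X) (p + 2) i"
      unfolding ob_shift df_shift_vec[OF X i x]
      using df_shift_vec[OF X i dx] df_shift_vec[OF X i udx] mult_mat_uminus_vec[OF dc dx] dd by simp
  qed
qed

lemma ob_shift_m1: "ob (shift_cpx (- 1) X) p = ob X (p - 1)"
  by (simp add: ob_shift)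

lemma df_shift_m1_vec:
  fixes X :: "'k::field cpx"
  assumes "is_cpx n X" "i < n" "x \<in> cochains X (p - 1) i"
  shows "df (shift_cpx (- 1) X) p i *\<^sub>v x = - (df X (p - 1) i *\<^sub>v x)"
  using df_shift_vec[OF assms(1,2), of x p "- 1"] assms(3) by simp

lemma add_uminus_vec: "x \<in> carrier_vec m \<Longrightarrow> x + - (x :: 'k::field vec) = 0\<^sub>v m"
  by (intro eq_vecI) auto

lemma diff_diff_vec:
  fixes a b c :: "'k::field vec"
  assumes "a \<in> carrier_vec m" "b \<in> carrier_vec m" "c \<in> carrier_vec m"
  shows "(a - b) - ((a - c) - b) = c"
  using assms by (intro eq_vecI) auto

text \<open>This is \<open>cone(t)[-1]\<close>. No representations are extended, hence the zero
  \<epsilon>. The chain map equation of \<open>t\<close> turns into \<open>sig_df\<close> thanks to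
  the sign in the differential of \<open>U[-1]\<close>.\<close>

definition cocone :: "nat \<Rightarrow> 'k::field cpx \<Rightarrow> 'k cpx \<Rightarrow> 'k gmap \<Rightarrow> 'k cpx" where
  "cocone n Z U t = twisted n Z (shift_cpx (- 1) U)
     (\<lambda>p i. 0\<^sub>m (dimv (ob U (p - 1)) (Suc i mod n)) (dimv (ob Z p) i)) t"

context
  fixes n and Z U :: "'k::field cpx" and t
  assumes Z: "is_cpx n Z" and U: "is_cpx n U" and t: "chain_map n Z U t"
begin

lemma cocone_twisting:
  "twisting n Z (shift_cpx (- 1) U) (\<lambda>p i. 0\<^sub>m (dimv (ob U (p - 1)) (Suc i mod n)) (dimv (ob Z p) i)) t"
proof
  show "is_cpx n Z" by (rule Z)
  show "is_cpx n (shift_cpx (- 1) U)" by (rule is_cpx_shift[OF U])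
  fix p i assume i: "i < n"
  then have j: "Suc i mod n < n" by simp
  show "0\<^sub>m (dimv (ob U (p - 1)) (Suc i mod n)) (dimv (ob Z p) i)
      \<in> graded_maps Z p i (shift_cpx (- 1) U) p (Suc i mod n)"
    by (simp add: ob_shift_m1)
  show "t p i \<in> graded_maps Z p i (shift_cpx (- 1) U) (p + 1) i"
    using chain_map_carrier[OF t i, of p] by (simp add: ob_shift_m1)
  fix z :: "'k vec" assume z: "z \<in> cochains Z p i"
  note tz = chain_map_vec[OF t i z]
  have tz': "t p i *\<^sub>v z \<in> cochains U (p + 1 - 1) i" using tz by simp
  show "t (p + 1) i *\<^sub>v (df Z p i *\<^sub>v z) + df (shift_cpx (- 1) U) (p + 1) i *\<^sub>v (t p i *\<^sub>v z)
      = zero_cochain (shift_cpx (- 1) U) (p + 2) i"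
    unfolding df_shift_m1_vec[OF U i tz'] chain_map_df[OF t Z U i z]
    using add_uminus_vec[OF is_cpx_df_vec[OF U i tz]] by (simp add: ob_shift_m1 add.commute)
  have dU: "df (shift_cpx (- 1) U) p (Suc i mod n) *\<^sub>v zero_cochain U (p - 1) (Suc i mod n) = zero_cochain U p (Suc i mod n)"
    using mult_mat_zero_vec[OF is_cpx_df[OF is_cpx_shift[OF U, of "- 1"] j, of p]] by (simp add: ob_shift_m1)
  have aU: "arr (ob U p) i *\<^sub>v (t p i *\<^sub>v z) \<in> cochains U p (Suc i mod n)"
    by (rule is_cpx_arr_vec[OF U i tz])
  show "t p (Suc i mod n) *\<^sub>v (arr (ob Z p) i *\<^sub>v z)
      + df (shift_cpx (- 1) U) p (Suc i mod n) *\<^sub>v (0\<^sub>m (dimv (ob U (p - 1)) (Suc i mod n)) (dimv (ob Z p) i) *\<^sub>v z)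
    = 0\<^sub>m (dimv (ob U (p + 1 - 1)) (Suc i mod n)) (dimv (ob Z (p + 1)) i) *\<^sub>v (df Z p i *\<^sub>v z)
      + arr (ob (shift_cpx (- 1) U) (p + 1)) i *\<^sub>v (t p i *\<^sub>v z)"
    unfolding zero_mat_mult_vec[OF z] zero_mat_mult_vec[OF is_cpx_df_vec[OF Z i z]] chain_map_arr[OF t Z U i z] dU ob_shift_m1
    using aU by simp
qed

interpretation C: twisting n Z "shift_cpx (- 1) U" "\<lambda>p i. 0\<^sub>m (dimv (ob U (p - 1)) (Suc i mod n)) (dimv (ob Z p) i)" t
  by (rule cocone_twisting)

lemma cocone_cpx: "is_cpx n (cocone n Z U t)"
  unfolding cocone_def by (rule C.T_cpx)

lemma dimv_cocone: "dimv (ob (cocone n Z U t) p) i = dimv (ob Z p) i + dimv (ob U (p - 1)) i"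
  unfolding cocone_def C.dimv_T by (simp add: ob_shift_m1)

lemma cocone_df:
  assumes i: "i < n" and z: "z \<in> cochains Z p i" and u: "u \<in> cochains U (p - 1) i"
  shows "df (cocone n Z U t) p i *\<^sub>v (z @\<^sub>v u) = (df Z p i *\<^sub>v z) @\<^sub>v (t p i *\<^sub>v z - df U (p - 1) i *\<^sub>v u)"
proof -
  have du: "df U (p - 1) i *\<^sub>v u \<in> cochains U p i" using is_cpx_df_vec[OF U i u] by simp
  have "df (cocone n Z U t) p i *\<^sub>v (z @\<^sub>v u) = (df Z p i *\<^sub>v z) @\<^sub>v (t p i *\<^sub>v z + - (df U (p - 1) i *\<^sub>v u))"
    unfolding cocone_def using C.T_df[OF i z, of u] u df_shift_m1_vec[OF U i u] by (simp add: ob_shift_m1)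
  then show ?thesis using minus_add_uminus_vec[OF chain_map_vec[OF t i z] du] by simp
qed

lemma cocone_arr:
  assumes i: "i < n" and z: "z \<in> cochains Z p i" and u: "u \<in> cochains U (p - 1) i"
  shows "arr (ob (cocone n Z U t) p) i *\<^sub>v (z @\<^sub>v u) = (arr (ob Z p) i *\<^sub>v z) @\<^sub>v (arr (ob U (p - 1)) i *\<^sub>v u)"
  unfolding cocone_def using C.T_arr[OF i z, of u] u is_cpx_arr_vec[OF U i u]
  by (simp add: ob_shift_m1 zero_mat_mult_vec[OF z])

text \<open>Injectivity of \<open>t\<close> on cohomology in degree \<open>p\<close> bounds the
  first component of a cocycle; surjectivity in degree \<open>p - 1\<close> repairs the
  second.\<close>

lemma cocone_acyclic:
  assumes qi: "quasi_iso n Z U t"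
  shows "acyclic_cpx n (cocone n Z U t)"
  unfolding acyclic_cpx_def
proof (intro allI impI subsetI)
  fix p i v assume i: "i < n" and v: "v \<in> cocycles (cocone n Z U t) p i"
  obtain z u where z: "z \<in> cochains Z p i" and u: "u \<in> cochains U (p - 1) i" and vzu: "v = z @\<^sub>v u"
    using cocyclesD(1)[OF v] unfolding dimv_cocone by (rule append_vec_split)
  have u': "u \<in> cochains (shift_cpx (- 1) U) p i" using u by (simp add: ob_shift_m1)
  have "z \<in> cocycles Z p i \<and> t p i *\<^sub>v z + df (shift_cpx (- 1) U) p i *\<^sub>v u = zero_cochain U p i"
    using v C.T_cocycle[OF i z u'] unfolding cocone_def vzu by (simp add: ob_shift_m1)
  then have zc: "z \<in> cocycles Z p i" and tz: "t p i *\<^sub>v z + - (df U (p - 1) i *\<^sub>v u) = zero_cochain U p i"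
    using df_shift_m1_vec[OF U i u] by simp_all
  have du: "df U (p - 1) i *\<^sub>v u \<in> cochains U p i" using is_cpx_df_vec[OF U i u] by simp
  have tz: "t p i *\<^sub>v z = df U (p - 1) i *\<^sub>v u"
    using tz minus_add_uminus_vec[OF chain_map_vec[OF t i z] du] add_diff_vec[OF du chain_map_vec[OF t i z]] du
    by simp
  have "z \<in> coboundaries Z p i"
    using quasi_iso_inj[OF qi i zc] tz coboundariesI[OF u tz] by simp
  then obtain z0 where z0: "z0 \<in> cochains Z (p - 1) i" "z = df Z (p - 1) i *\<^sub>v z0"
    by (rule coboundariesE)
  note tz0 = chain_map_vec[OF t i z0(1)]
  have "df U (p - 1) i *\<^sub>v (t (p - 1) i *\<^sub>v z0) = df U (p - 1) i *\<^sub>v u"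
    using chain_map_df[OF t Z U i z0(1)] z0(2) tz by simp
  \<comment> \<open>\<open>z0\<close> bounds \<open>z\<close>, but \<open>t z0\<close> may differ
    from \<open>u\<close>. The difference is a cocycle of \<open>U\<close>, hence
    \<open>t z1\<close> plus a coboundary \<open>d u1\<close>, and \<open>(z0 - z1, u1)\<close>
    bounds \<open>(z, u)\<close>.\<close>
  then have "t (p - 1) i *\<^sub>v z0 - u \<in> cocycles U (p - 1) i"
    using mult_minus_distrib_mat_vec[OF df_carrier'[OF U i] tz0 u] du u tz0 by (simp add: cocycles_def)
  then obtain z1 where z1: "z1 \<in> cocycles Z (p - 1) i" "(t (p - 1) i *\<^sub>v z0 - u) - t (p - 1) i *\<^sub>v z1 \<in> coboundaries U (p - 1) i"
    using quasi_iso_surj[OF qi i] by blast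
  obtain u1 where u1: "u1 \<in> cochains U (p - 1 - 1) i"
    "(t (p - 1) i *\<^sub>v z0 - u) - t (p - 1) i *\<^sub>v z1 = df U (p - 1 - 1) i *\<^sub>v u1"
    using z1(2) by (rule coboundariesE)
  note z1c = cocyclesD(1)[OF z1(1)]
  have zz: "z0 - z1 \<in> cochains Z (p - 1) i" using z0(1) z1c by simp
  have "df (cocone n Z U t) (p - 1) i *\<^sub>v ((z0 - z1) @\<^sub>v u1) = z @\<^sub>v u"
  proof -
    have "df Z (p - 1) i *\<^sub>v (z0 - z1) = z"
      using mult_minus_distrib_mat_vec[OF df_carrier'[OF Z i] z0(1) z1c] cocyclesD(2)[OF z1(1)] z0(2) z by simp
    moreover have "t (p - 1) i *\<^sub>v (z0 - z1) - df U (p - 1 - 1) i *\<^sub>v u1 = u"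
      unfolding mult_minus_distrib_mat_vec[OF chain_map_carrier[OF t i] z0(1) z1c] u1(2)[symmetric]
      by (rule diff_diff_vec[OF tz0 chain_map_vec[OF t i z1c] u])
    ultimately show ?thesis using cocone_df[OF i zz u1(1)] by simp
  qed
  moreover have "(z0 - z1) @\<^sub>v u1 \<in> cochains (cocone n Z U t) (p - 1) i"
    unfolding dimv_cocone using zz u1(1) by simp
  ultimately show "v \<in> coboundaries (cocone n Z U t) p i" using vzu by (intro coboundariesI) auto
qed

end

section \<open>Ore squares and the realization of derived morphisms by roofs\<close>

text \<open>The witness is the homotopy pullback of \<open>f\<close> and \<open>t\<close>: triples
  \<open>(x, z, w)\<close> from \<open>A\<close>, \<open>Z\<close> and \<open>U[-1]\<close> with
  differential \<open>(d x, d z, - f x + t z - d w)\<close>. Its projection to \<open>A\<close> has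
  the acyclic kernel \<open>cocone(t)\<close>, and \<open>- w\<close> is the homotopy between the
  two composites to \<open>U\<close>.\<close>

lemma ore_square:
  fixes A Z U :: "'k::field cpx"
  assumes A: "is_cpx n A" and Z: "is_cpx n Z" and U: "is_cpx n U"
    and f: "chain_map n A U f" and t: "quasi_iso n Z U t"
  obtains W u v where "is_cpx n W" "quasi_iso n W A u" "chain_map n W Z v"
    "homotopic n W U (f \<circ>\<^sub>g u) (t \<circ>\<^sub>g v)"
proof -
  note tc = quasi_iso_chain_map[OF t]
  define B where "B = cocone n Z U t"
  note Bc = cocone_cpx[OF Z U tc, folded B_def] and dB = dimv_cocone[OF Z U tc, folded B_def]
    and B_df = cocone_df[OF Z U tc, folded B_def] and B_arr = cocone_arr[OF Z U tc, folded B_def]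
    and B_acyc = cocone_acyclic[OF Z U tc t, folded B_def]
  define \<epsilon> where "\<epsilon> p i = (0\<^sub>m (dimv (ob B p) (Suc i mod n)) (dimv (ob A p) i) :: 'k mat)" for p i
  define \<sigma> where "\<sigma> p i = 0\<^sub>m (dimv (ob Z (p + 1)) i) (dimv (ob A p) i) @\<^sub>r (- f p i)" for p i
  have fc: "- f p i \<in> graded_maps A p i U p i" if "i < n" for p i
    using chain_map_carrier[OF f that] by simp
  have \<epsilon>_vec: "\<epsilon> p i *\<^sub>v x = zero_cochain B p (Suc i mod n)" if "x \<in> cochains A p i" for p i x
    unfolding \<epsilon>_def by (rule zero_mat_mult_vec[OF that])
  have \<sigma>_vec: "\<sigma> p i *\<^sub>v x = zero_cochain Z (p + 1) i @\<^sub>v - (f p i *\<^sub>v x)"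
    if i: "i < n" and x: "x \<in> cochains A p i" for p i x
    unfolding \<sigma>_def mat_mult_append[OF zero_carrier_mat fc[OF i] x] zero_mat_mult_vec[OF x]
    using uminus_mult_mat_vec[of x "f p i"] carrier_matD(2)[OF chain_map_carrier[OF f i]] carrier_vecD[OF x] by simp
  have B_df0: "df B (p + 1) i *\<^sub>v (zero_cochain Z (p + 1) i @\<^sub>v - w)
      = zero_cochain Z (p + 2) i @\<^sub>v (df U p i *\<^sub>v w)"
    if i: "i < n" and w: "w \<in> cochains U p i" for p i w
  proof -
    have w': "- w \<in> cochains U (p + 1 - 1) i" using w by simp
    have pp: "p + 1 + 1 = p + 2" by simp
    have "zero_cochain U (p + 1) i - (- (df U p i *\<^sub>v w)) = df U p i *\<^sub>v w"
      using is_cpx_df_vec[OF U i w] by (intro eq_vecI) (auto simp del: index_mult_mat_vec)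
    then show ?thesis
      unfolding B_df[OF i zero_carrier_vec w'] mult_mat_zero_vec[OF is_cpx_df[OF Z i]]
        mult_mat_zero_vec[OF chain_map_carrier[OF tc i]] pp
      using mult_mat_uminus_vec[OF is_cpx_df[OF U i] w] by simp
  qed
  have B_arr0: "arr (ob B (p + 1)) i *\<^sub>v (zero_cochain Z (p + 1) i @\<^sub>v - w)
      = zero_cochain Z (p + 1) (Suc i mod n) @\<^sub>v - (arr (ob U p) i *\<^sub>v w)"
    if i: "i < n" and w: "w \<in> cochains U p i" for p i w
  proof -
    have w': "- w \<in> cochains U (p + 1 - 1) i" using w by simp
    show ?thesis
      unfolding B_arr[OF i zero_carrier_vec w'] mult_mat_zero_vec[OF is_cpx_arr[OF Z i]]
      using mult_mat_uminus_vec[OF is_cpx_arr[OF U i] w] by simp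
  qed
  interpret T: twisting n A B \<epsilon> \<sigma>
  proof
    show "is_cpx n A" by (rule A)
    show "is_cpx n B" by (rule Bc)
    fix p i assume i: "i < n"
    then have j: "Suc i mod n < n" by simp
    show "\<epsilon> p i \<in> graded_maps A p i B p (Suc i mod n)" by (simp add: \<epsilon>_def)
    show "\<sigma> p i \<in> graded_maps A p i B (p + 1) i"
      unfolding \<sigma>_def dB using carrier_append_rows[OF zero_carrier_mat fc[OF i]] by simp
    fix x :: "'k vec" assume x: "x \<in> cochains A p i"
    note fx = chain_map_vec[OF f i x]
    note dx = is_cpx_df_vec[OF A i x] and ax = is_cpx_arr_vec[OF A i x]
    have pp: "p + 1 + 1 = p + 2" by simp
    have dfx: "df U p i *\<^sub>v (f p i *\<^sub>v x) \<in> cochains U (p + 1) i" by (rule is_cpx_df_vec[OF U i fx])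
    show "\<sigma> (p + 1) i *\<^sub>v (df A p i *\<^sub>v x) + df B (p + 1) i *\<^sub>v (\<sigma> p i *\<^sub>v x) = zero_cochain B (p + 2) i"
      unfolding \<sigma>_vec[OF i x] \<sigma>_vec[OF i dx] B_df0[OF i fx] chain_map_df[OF f A U i x] pp
      using append_vec_add[OF zero_carrier_vec[of "dimv (ob Z (p + 2)) i"] zero_carrier_vec uminus_carrier_vec[THEN iffD2, OF dfx] dfx]
        dfx by (simp add: dB append_zero_vec add.commute)
    have B0: "zero_cochain B q k = zero_cochain Z q k @\<^sub>v zero_cochain U (q - 1) k" for q k
      by (simp add: dB append_zero_vec)
    have afx: "arr (ob U p) i *\<^sub>v (f p i *\<^sub>v x) \<in> cochains U p (Suc i mod n)" by (rule is_cpx_arr_vec[OF U i fx])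
    show "\<sigma> p (Suc i mod n) *\<^sub>v (arr (ob A p) i *\<^sub>v x) + df B p (Suc i mod n) *\<^sub>v (\<epsilon> p i *\<^sub>v x) =
        \<epsilon> (p + 1) i *\<^sub>v (df A p i *\<^sub>v x) + arr (ob B (p + 1)) i *\<^sub>v (\<sigma> p i *\<^sub>v x)"
      unfolding \<sigma>_vec[OF i x] \<sigma>_vec[OF j ax] \<epsilon>_vec[OF x] \<epsilon>_vec[OF dx] B_arr0[OF i fx] chain_map_arr[OF f A U i x]
        mult_mat_zero_vec[OF is_cpx_df[OF Bc j]]
      using afx by (simp add: dB)
  qed
  have dT: "dimv (ob T.T p) i = dimv (ob A p) i + (dimv (ob Z p) i + dimv (ob U (p - 1)) i)" for p i
    by (simp add: T.dimv_T dB)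
  \<comment> \<open>Here \<open>u\<close> projects to \<open>Z\<close> and plays the role of
    \<open>v\<close> in the statement; the leg to \<open>A\<close> is \<open>T.pr\<close>.\<close>
  define u where "u p i = (sel_mat (dimv (ob Z p) i) (dimv (ob T.T p) i) (dimv (ob A p) i) :: 'k mat)" for p i
  define h where "h p i = (- sel_mat (dimv (ob U (p - 1)) i) (dimv (ob T.T p) i) (dimv (ob A p) i + dimv (ob Z p) i) :: 'k mat)" for p i
  have split: "\<exists>x\<in>cochains A p i. \<exists>z\<in>cochains Z p i. \<exists>w\<in>cochains U (p - 1) i. v = x @\<^sub>v (z @\<^sub>v w)"
    if "v \<in> cochains T.T p i" for v p i
    using that unfolding dT by (elim append_vec_split) blast
  have u_vec: "u p i *\<^sub>v (x @\<^sub>v (z @\<^sub>v w)) = z" and h_vec: "h p i *\<^sub>v (x @\<^sub>v (z @\<^sub>v w)) = - w"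
    and p_vec: "T.pr p i *\<^sub>v (x @\<^sub>v (z @\<^sub>v w)) = x"
    if "x \<in> cochains A p i" "z \<in> cochains Z p i" "w \<in> cochains U (p - 1) i"
    for p i x z w
    subgoal unfolding u_def dT by (rule sel_mat_mid[OF that])
    subgoal unfolding h_def dT
      by (subst uminus_mult_mat_vec) (use that in \<open>simp_all add: sel_mat_last[OF that] carrier_matD[OF sel_mat_carrier]\<close>)
    subgoal using T.pr_vec[OF that(1), of "z @\<^sub>v w"] that by (simp add: dB)
    done
  have T_arr: "arr (ob T.T p) i *\<^sub>v (x @\<^sub>v (z @\<^sub>v w)) = (arr (ob A p) i *\<^sub>v x) @\<^sub>v ((arr (ob Z p) i *\<^sub>v z) @\<^sub>v (arr (ob U (p - 1)) i *\<^sub>v w))"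
    if i: "i < n" and "x \<in> cochains A p i" "z \<in> cochains Z p i" "w \<in> cochains U (p - 1) i"
    for p i x z w
    using T.T_arr[OF i that(2), of "z @\<^sub>v w"] that(3,4) B_arr[OF i that(3,4)] \<epsilon>_vec[OF that(2)]
      is_cpx_arr_vec[OF Z i that(3)] is_cpx_arr_vec[OF U i that(4)] by (simp add: dB)
  have T_df: "df T.T p i *\<^sub>v (x @\<^sub>v (z @\<^sub>v w)) = (df A p i *\<^sub>v x) @\<^sub>v
      ((df Z p i *\<^sub>v z) @\<^sub>v (- (f p i *\<^sub>v x) + (t p i *\<^sub>v z - df U (p - 1) i *\<^sub>v w)))"
    if i: "i < n" and x: "x \<in> cochains A p i" and z: "z \<in> cochains Z p i"
      and w: "w \<in> cochains U (p - 1) i"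
    for p i x z w
  proof -
    have dw: "df U (p - 1) i *\<^sub>v w \<in> cochains U p i" using is_cpx_df_vec[OF U i w] by simp
    have zw: "z @\<^sub>v w \<in> cochains B p i" using z w by (simp add: dB)
    have c: "- (f p i *\<^sub>v x) \<in> cochains U p i" "t p i *\<^sub>v z - df U (p - 1) i *\<^sub>v w \<in> cochains U p i"
      using chain_map_vec[OF f i x] chain_map_vec[OF tc i z] dw by simp_all
    show ?thesis
      unfolding T.T_df[OF i x zw] \<sigma>_vec[OF i x] B_df[OF i z w]
        append_vec_add[OF zero_carrier_vec is_cpx_df_vec[OF Z i z] c]
      using is_cpx_df_vec[OF Z i z] by simp
  qed
  have "quasi_iso n T.T A T.pr" by (rule T.pr_quasi_iso[OF B_acyc])
  moreover have uc: "chain_map n T.T Z u"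
  proof (rule chain_mapI[OF T.T_cpx Z])
    fix p i assume i: "i < n"
    show "u p i \<in> graded_maps T.T p i Z p i" unfolding u_def by (rule sel_mat_carrier)
    fix v :: "'k vec" assume "v \<in> cochains T.T p i"
    then obtain x z w where x: "x \<in> cochains A p i" and z: "z \<in> cochains Z p i"
      and w: "w \<in> cochains U (p - 1) i" and v: "v = x @\<^sub>v (z @\<^sub>v w)" using split by blast
    show "u p (Suc i mod n) *\<^sub>v (arr (ob T.T p) i *\<^sub>v v) = arr (ob Z p) i *\<^sub>v (u p i *\<^sub>v v)"
      unfolding v T_arr[OF i x z w] u_vec[OF x z w]
      by (rule u_vec[OF is_cpx_arr_vec[OF A i x] is_cpx_arr_vec[OF Z i z] is_cpx_arr_vec[OF U i w]])
    have c: "- (f p i *\<^sub>v x) + (t p i *\<^sub>v z - df U (p - 1) i *\<^sub>v w) \<in> cochains U (p + 1 - 1) i"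
      using chain_map_vec[OF f i x] chain_map_vec[OF tc i z] is_cpx_df_vec[OF U i w] by simp
    show "u (p + 1) i *\<^sub>v (df T.T p i *\<^sub>v v) = df Z p i *\<^sub>v (u p i *\<^sub>v v)"
      unfolding v T_df[OF i x z w] u_vec[OF x z w]
      by (rule u_vec[OF is_cpx_df_vec[OF A i x] is_cpx_df_vec[OF Z i z] c])
  qed
  moreover have "homotopic n T.T U (f \<circ>\<^sub>g T.pr) (t \<circ>\<^sub>g u)"
  proof (rule homotopicI[OF T.T_cpx U, where h = h])
    show "(f \<circ>\<^sub>g T.pr) p i \<in> graded_maps T.T p i U p i" if "i < n" for p i
      by (rule chain_map_carrier[OF chain_map_comp[OF f T.pr_chain_map T.T_cpx A U] that])
    show "(t \<circ>\<^sub>g u) p i \<in> graded_maps T.T p i U p i" if "i < n" for p i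
      by (rule chain_map_carrier[OF chain_map_comp[OF tc uc T.T_cpx Z U] that])
    show "h p \<in> rep_hom n (ob T.T p) (ob U (p - 1))" for p
    proof (rule rep_homI[OF is_cpx_rep[OF T.T_cpx] is_cpx_rep[OF U]])
      fix i assume i: "i < n"
      show "h p i \<in> graded_maps T.T p i U (p - 1) i" unfolding h_def
        using sel_mat_carrier by simp
      fix v :: "'k vec" assume "v \<in> cochains T.T p i"
      then obtain x z w where x: "x \<in> cochains A p i" and z: "z \<in> cochains Z p i"
        and w: "w \<in> cochains U (p - 1) i" and v: "v = x @\<^sub>v (z @\<^sub>v w)" using split by blast
      show "h p (Suc i mod n) *\<^sub>v (arr (ob T.T p) i *\<^sub>v v) = arr (ob U (p - 1)) i *\<^sub>v (h p i *\<^sub>v v)"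
        unfolding v T_arr[OF i x z w] h_vec[OF x z w] mult_mat_uminus_vec[OF is_cpx_arr[OF U i] w]
        by (rule h_vec[OF is_cpx_arr_vec[OF A i x] is_cpx_arr_vec[OF Z i z] is_cpx_arr_vec[OF U i w]])
    qed
    fix p i assume i: "i < n"
    fix v :: "'k vec" assume v': "v \<in> cochains T.T p i"
    then obtain x z w where x: "x \<in> cochains A p i" and z: "z \<in> cochains Z p i"
      and w: "w \<in> cochains U (p - 1) i" and v: "v = x @\<^sub>v (z @\<^sub>v w)" using split by blast
    have fx: "f p i *\<^sub>v x \<in> cochains U p i" and tz: "t p i *\<^sub>v z \<in> cochains U p i"
      and dw: "df U (p - 1) i *\<^sub>v w \<in> cochains U p i"
      using chain_map_vec[OF f i x] chain_map_vec[OF tc i z] is_cpx_df_vec[OF U i w] by simp_all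
    have c: "- (f p i *\<^sub>v x) + (t p i *\<^sub>v z - df U (p - 1) i *\<^sub>v w) \<in> cochains U (p + 1 - 1) i"
      using fx tz dw by simp
    have uw: "df U (p - 1) i *\<^sub>v (- w) = - (df U (p - 1) i *\<^sub>v w)"
      by (rule mult_mat_uminus_vec[OF is_cpx_df[OF U i] w])
    have "f p i *\<^sub>v x - t p i *\<^sub>v z = - (df U (p - 1) i *\<^sub>v w) + - (- (f p i *\<^sub>v x) + (t p i *\<^sub>v z - df U (p - 1) i *\<^sub>v w))"
      by (rule eq_vecI) (insert carrier_vecD[OF fx] carrier_vecD[OF tz] carrier_vecD[OF dw],
        simp_all del: index_mult_mat_vec dim_mult_mat_vec)
    then show "(f \<circ>\<^sub>g T.pr) p i *\<^sub>v v - (t \<circ>\<^sub>g u) p i *\<^sub>v v = df U (p - 1) i *\<^sub>v (h p i *\<^sub>v v) + h (p + 1) i *\<^sub>v (df T.T p i *\<^sub>v v)"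
      unfolding comp_map_vec[OF f T.pr_chain_map i v'] comp_map_vec[OF tc uc i v']
      unfolding v p_vec[OF x z w] u_vec[OF x z w] h_vec[OF x z w] T_df[OF i x z w]
        h_vec[OF is_cpx_df_vec[OF A i x] is_cpx_df_vec[OF Z i z] c] uw .
  qed
  ultimately show thesis using that T.T_cpx by blast
qed

text \<open>The cyclic quiver is hereditary, so a morphism $Z \to Y$ of the derived category is given by linear
  maps $h$ of degree $0$ that need not commute with the arrows, together with $e$ of degree $-1$ along
  the arrows that accounts for the defect. The lemma turns such a pair into a roof; without the
  assumption $hd = dh$ it produces null-homotopies in the same way. The resolution \<open>T\<close> is $Z$ glued to
  the cone of the identity of $Y$, on which the class of $e$ becomes a coboundary.\<close>

lemma realize:
  fixes Z Y :: "'k::field cpx" and h e :: "'k gmap"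
  assumes Z: "is_cpx n Z" and Y: "is_cpx n Y"
    and h: "\<And>p i. i < n \<Longrightarrow> h p i \<in> graded_maps Z p i Y p i"
    and e: "\<And>p i. i < n \<Longrightarrow> e p i \<in> graded_maps Z p i Y (p - 1) (Suc i mod n)"
    and he: "\<And>p i z. i < n \<Longrightarrow> z \<in> cochains Z p i \<Longrightarrow>
      h p (Suc i mod n) *\<^sub>v (arr (ob Z p) i *\<^sub>v z) - arr (ob Y p) i *\<^sub>v (h p i *\<^sub>v z)
       = df Y (p - 1) (Suc i mod n) *\<^sub>v (e p i *\<^sub>v z) + e (p + 1) i *\<^sub>v (df Z p i *\<^sub>v z)"
  obtains T \<pi> H where "is_cpx n T" "quasi_iso n T Z \<pi>" "\<And>p. H p \<in> rep_hom n (ob T p) (ob Y p)"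
    "\<And>p i x. i < n \<Longrightarrow> x \<in> cochains T p i \<Longrightarrow>
      H (p + 1) i *\<^sub>v (df T p i *\<^sub>v x) - df Y p i *\<^sub>v (H p i *\<^sub>v x)
      = h (p + 1) i *\<^sub>v (df Z p i *\<^sub>v (\<pi> p i *\<^sub>v x)) - df Y p i *\<^sub>v (h p i *\<^sub>v (\<pi> p i *\<^sub>v x))"
    "\<And>p i z. i < n \<Longrightarrow> z \<in> cochains Z p i \<Longrightarrow> df Z p i *\<^sub>v z = zero_cochain Z (p + 1) i \<Longrightarrow>
      \<exists>x \<in> cocycles T p i. \<pi> p i *\<^sub>v x = z \<and> H p i *\<^sub>v x = h p i *\<^sub>v z"
proof -
  define B where "B = cocone n Y Y (id_map Y)"
  note idc = id_map_chain_map[OF Y]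
  note Bc = cocone_cpx[OF Y Y idc, folded B_def] and dB = dimv_cocone[OF Y Y idc, folded B_def]
    and B_df = cocone_df[OF Y Y idc, folded B_def] and B_arr = cocone_arr[OF Y Y idc, folded B_def]
    and B_acyc = cocone_acyclic[OF Y Y idc quasi_iso_id[OF Y], folded B_def]
  \<comment> \<open>The choice is forced: with \<open>\<sigma> = 0\<close>, \<open>sig_arr\<close>
    says that \<epsilon> commutes with the differentials, and in the cone of the identity the second
    component of this equation reads \<open>\<alpha> - d e = e d\<close>.\<close>
  define \<alpha> where "\<alpha> p i = df Y (p - 1) (Suc i mod n) * e p i + e (p + 1) i * df Z p i" for p i
  define \<epsilon> where "\<epsilon> p i = \<alpha> p i @\<^sub>r e p i" for p i
  define \<sigma> where "\<sigma> p i = (0\<^sub>m (dimv (ob B (p + 1)) i) (dimv (ob Z p) i) :: 'k mat)" for p i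
  have e': "e (p + 1) i \<in> graded_maps Z (p + 1) i Y p (Suc i mod n)" if "i < n" for p i
    using e[OF that, of "p + 1"] by simp
  have e_vec: "e p i *\<^sub>v z \<in> cochains Y (p - 1) (Suc i mod n)" if "i < n" "z \<in> cochains Z p i" for p i z
    using e[OF that(1)] that(2) by (rule mult_mat_vec_carrier)
  have e'_vec: "e (p + 1) i *\<^sub>v z \<in> cochains Y p (Suc i mod n)" if "i < n" "z \<in> cochains Z (p + 1) i" for p i z
    using e'[OF that(1)] that(2) by (rule mult_mat_vec_carrier)
  have h_vec: "h p i *\<^sub>v z \<in> cochains Y p i" if "i < n" "z \<in> cochains Z p i" for p i z
    using h[OF that(1)] that(2) by (rule mult_mat_vec_carrier)
  have \<alpha>c: "\<alpha> p i \<in> graded_maps Z p i Y p (Suc i mod n)" if i: "i < n" for p i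
    unfolding \<alpha>_def by (rule add_carrier_mat[OF mult_carrier_mat[OF e'[OF i] is_cpx_df[OF Z i]]])
  have \<alpha>_vec: "\<alpha> p i *\<^sub>v z = df Y (p - 1) (Suc i mod n) *\<^sub>v (e p i *\<^sub>v z) + e (p + 1) i *\<^sub>v (df Z p i *\<^sub>v z)"
    if i: "i < n" and z: "z \<in> cochains Z p i" for p i z
  proof -
    have j: "Suc i mod n < n" using i by simp
    show ?thesis unfolding \<alpha>_def
      add_mult_distrib_mat_vec[OF mult_carrier_mat[OF df_carrier'[OF Y j] e[OF i]] mult_carrier_mat[OF e'[OF i] is_cpx_df[OF Z i]] z]
      assoc_mult_mat_vec[OF df_carrier'[OF Y j] e[OF i] z] assoc_mult_mat_vec[OF e'[OF i] is_cpx_df[OF Z i] z] ..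
  qed
  have \<alpha>_vc: "\<alpha> p i *\<^sub>v z \<in> cochains Y p (Suc i mod n)" if "i < n" "z \<in> cochains Z p i" for p i z
    using \<alpha>c[OF that(1)] that(2) by (rule mult_mat_vec_carrier)
  have \<epsilon>_vec: "\<epsilon> p i *\<^sub>v z = (\<alpha> p i *\<^sub>v z) @\<^sub>v (e p i *\<^sub>v z)" if i: "i < n" and z: "z \<in> cochains Z p i" for p i z
    unfolding \<epsilon>_def by (rule mat_mult_append[OF \<alpha>c[OF i] e[OF i] z])
  have \<sigma>_vec: "\<sigma> p i *\<^sub>v z = zero_cochain B (p + 1) i" if z: "z \<in> cochains Z p i" for p i z
    unfolding \<sigma>_def by (rule zero_mat_mult_vec[OF z])
  interpret T: twisting n Z B \<epsilon> \<sigma>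
  proof
    show "is_cpx n Z" by (rule Z)
    show "is_cpx n B" by (rule Bc)
    fix p i assume i: "i < n"
    then have j: "Suc i mod n < n" by simp
    show "\<epsilon> p i \<in> graded_maps Z p i B p (Suc i mod n)"
      unfolding \<epsilon>_def dB by (rule carrier_append_rows[OF \<alpha>c[OF i] e[OF i]])
    show "\<sigma> p i \<in> graded_maps Z p i B (p + 1) i" by (simp add: \<sigma>_def)
    fix z :: "'k vec" assume z: "z \<in> cochains Z p i"
    note dz = is_cpx_df_vec[OF Z i z] and az = is_cpx_arr_vec[OF Z i z]
    have pp: "p + 1 + 1 = p + 2" by simp
    show "\<sigma> (p + 1) i *\<^sub>v (df Z p i *\<^sub>v z) + df B (p + 1) i *\<^sub>v (\<sigma> p i *\<^sub>v z) = zero_cochain B (p + 2) i"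
      unfolding \<sigma>_vec[OF z] \<sigma>_vec[OF dz] mult_mat_zero_vec[OF is_cpx_df[OF Bc i]] pp by simp
    note ez = e_vec[OF i z] and edz = e'_vec[OF i dz] and \<alpha>z = \<alpha>_vc[OF i z] and \<alpha>dz = \<alpha>_vc[OF i dz]
    have dez: "df Y (p - 1) (Suc i mod n) *\<^sub>v (e p i *\<^sub>v z) \<in> cochains Y p (Suc i mod n)"
      using is_cpx_df_vec[OF Y j ez] by simp
    have "df Y p (Suc i mod n) *\<^sub>v (\<alpha> p i *\<^sub>v z) = \<alpha> (p + 1) i *\<^sub>v (df Z p i *\<^sub>v z)"
    proof -
      have dd: "df Y p (Suc i mod n) *\<^sub>v (df Y (p - 1) (Suc i mod n) *\<^sub>v (e p i *\<^sub>v z)) = zero_cochain Y (p + 1) (Suc i mod n)"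
        using is_cpx_df_df[OF Y j ez] by (simp add: add.commute)
      have ed0: "e (p + 1 + 1) i *\<^sub>v zero_cochain Z (p + 2) i = zero_cochain Y (p + 1) (Suc i mod n)"
        using mult_mat_zero_vec[OF e'[OF i, of "p + 1"]] by (simp add: add.commute)
      have dedz: "df Y p (Suc i mod n) *\<^sub>v (e (p + 1) i *\<^sub>v (df Z p i *\<^sub>v z)) \<in> cochains Y (p + 1) (Suc i mod n)"
        by (rule is_cpx_df_vec[OF Y j edz])
      show ?thesis
        unfolding \<alpha>_vec[OF i z] \<alpha>_vec[OF i dz] mult_add_distrib_mat_vec[OF is_cpx_df[OF Y j] dez edz] dd
          is_cpx_df_df[OF Z i z] ed0 using dedz by simp
    qed
    moreover have "id_map Y p (Suc i mod n) *\<^sub>v (\<alpha> p i *\<^sub>v z) - df Y (p - 1) (Suc i mod n) *\<^sub>v (e p i *\<^sub>v z)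
        = e (p + 1) i *\<^sub>v (df Z p i *\<^sub>v z)"
      unfolding id_map_vec[OF \<alpha>z]
      unfolding \<alpha>_vec[OF i z]
      by (rule eq_vecI) (insert carrier_vecD[OF dez] carrier_vecD[OF edz], simp_all del: index_mult_mat_vec dim_mult_mat_vec)
    moreover have "(\<alpha> (p + 1) i *\<^sub>v (df Z p i *\<^sub>v z)) @\<^sub>v (e (p + 1) i *\<^sub>v (df Z p i *\<^sub>v z)) \<in> cochains B (p + 1) (Suc i mod n)"
      using \<alpha>dz edz by (simp add: dB)
    ultimately show "\<sigma> p (Suc i mod n) *\<^sub>v (arr (ob Z p) i *\<^sub>v z) + df B p (Suc i mod n) *\<^sub>v (\<epsilon> p i *\<^sub>v z) =
        \<epsilon> (p + 1) i *\<^sub>v (df Z p i *\<^sub>v z) + arr (ob B (p + 1)) i *\<^sub>v (\<sigma> p i *\<^sub>v z)"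
      unfolding \<sigma>_vec[OF z] \<sigma>_vec[OF az] \<epsilon>_vec[OF i z] \<epsilon>_vec[OF i dz] B_df[OF j \<alpha>z ez]
        mult_mat_zero_vec[OF is_cpx_arr[OF Bc i]] by simp
  qed
  have dT: "dimv (ob T.T p) i = dimv (ob Z p) i + (dimv (ob Y p) i + dimv (ob Y (p - 1)) i)" for p i
    by (simp add: T.dimv_T dB)
  define S where "S p i = (sel_mat (dimv (ob Y p) i) (dimv (ob T.T p) i) (dimv (ob Z p) i) :: 'k mat)" for p i
  \<comment> \<open>On \<open>(z, y, w)\<close> this is \<open>h z - y\<close>. The arrows of
    \<open>T\<close> add \<open>\<alpha> z\<close> to \<open>y\<close>, which by \<open>he\<close>
    cancels the failure of \<open>h\<close> to commute with arrows. The component \<open>y\<close>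
    commutes with differentials, so \<open>H\<close> inherits exactly the failure of
    \<open>h\<close> to do so.\<close>
  define H where "H p i = h p i * T.pr p i - S p i" for p i
  have split: "\<exists>z\<in>cochains Z p i. \<exists>y\<in>cochains Y p i. \<exists>w\<in>cochains Y (p - 1) i. v = z @\<^sub>v (y @\<^sub>v w)"
    if "v \<in> cochains T.T p i" for v p i
    using that unfolding dT by (elim append_vec_split) blast
  have Sc: "S p i \<in> graded_maps T.T p i Y p i" for p i unfolding S_def by (rule sel_mat_carrier)
  have Hc: "H p i \<in> graded_maps T.T p i Y p i" for p i
    unfolding H_def by (rule minus_carrier_mat[OF Sc])
  have p_vec: "T.pr p i *\<^sub>v (z @\<^sub>v (y @\<^sub>v w)) = z"
    if "z \<in> cochains Z p i" "y \<in> cochains Y p i" "w \<in> cochains Y (p - 1) i" for p i z y w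
    using T.pr_vec[OF that(1), of "y @\<^sub>v w"] that by (simp add: dB)
  have H_vec: "H p i *\<^sub>v (z @\<^sub>v (y @\<^sub>v w)) = h p i *\<^sub>v z - y"
    if i: "i < n" and "z \<in> cochains Z p i" "y \<in> cochains Y p i" "w \<in> cochains Y (p - 1) i" for p i z y w
  proof -
    have v: "z @\<^sub>v (y @\<^sub>v w) \<in> cochains T.T p i" unfolding dT using that by simp
    have prc: "T.pr p i \<in> graded_maps T.T p i Z p i" by (rule chain_map_carrier[OF T.pr_chain_map i])
    have "S p i *\<^sub>v (z @\<^sub>v (y @\<^sub>v w)) = y" unfolding S_def dT by (rule sel_mat_mid[OF that(2-4)])
    then show ?thesis
      unfolding H_def minus_mult_distrib_mat_vec[OF mult_carrier_mat[OF h[OF i] prc] Sc v] assoc_mult_mat_vec[OF h[OF i] prc v]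
      using p_vec[OF that(2-4)] by simp
  qed
  have T_arr: "arr (ob T.T p) i *\<^sub>v (z @\<^sub>v (y @\<^sub>v w)) = (arr (ob Z p) i *\<^sub>v z) @\<^sub>v
      ((\<alpha> p i *\<^sub>v z + arr (ob Y p) i *\<^sub>v y) @\<^sub>v (e p i *\<^sub>v z + arr (ob Y (p - 1)) i *\<^sub>v w))"
    if i: "i < n" and z: "z \<in> cochains Z p i" and y: "y \<in> cochains Y p i"
      and w: "w \<in> cochains Y (p - 1) i" for p i z y w
  proof -
    have yw: "y @\<^sub>v w \<in> cochains B p i" using y w by (simp add: dB)
    show ?thesis unfolding T.T_arr[OF i z yw] \<epsilon>_vec[OF i z] B_arr[OF i y w]
      append_vec_add[OF \<alpha>_vc[OF i z] is_cpx_arr_vec[OF Y i y] e_vec[OF i z] is_cpx_arr_vec[OF Y i w]] ..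
  qed
  have T_df: "df T.T p i *\<^sub>v (z @\<^sub>v (y @\<^sub>v w)) = (df Z p i *\<^sub>v z) @\<^sub>v ((df Y p i *\<^sub>v y) @\<^sub>v (y - df Y (p - 1) i *\<^sub>v w))"
    if i: "i < n" and z: "z \<in> cochains Z p i" and y: "y \<in> cochains Y p i"
      and w: "w \<in> cochains Y (p - 1) i" for p i z y w
  proof -
    have yw: "y @\<^sub>v w \<in> cochains B p i" using y w by (simp add: dB)
    have "df B p i *\<^sub>v (y @\<^sub>v w) \<in> cochains B (p + 1) i" by (rule is_cpx_df_vec[OF Bc i yw])
    then show ?thesis unfolding T.T_df[OF i z yw] \<sigma>_vec[OF z] 
      using B_df[OF i y w] by (simp add: id_map_vec[OF y])
  qed
  show thesis
  proof (rule that[of T.T T.pr H])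
    show "is_cpx n T.T" by (rule T.T_cpx)
    show "quasi_iso n T.T Z T.pr" by (rule T.pr_quasi_iso[OF B_acyc])
    show "H p \<in> rep_hom n (ob T.T p) (ob Y p)" for p
    proof (rule rep_homI[OF is_cpx_rep[OF T.T_cpx] is_cpx_rep[OF Y] Hc])
      fix i assume i: "i < n"
      then have j: "Suc i mod n < n" by simp
      fix v :: "'k vec" assume "v \<in> cochains T.T p i"
      then obtain z y w where z: "z \<in> cochains Z p i" and y: "y \<in> cochains Y p i"
        and w: "w \<in> cochains Y (p - 1) i" and v: "v = z @\<^sub>v (y @\<^sub>v w)" using split by blast
      note az = is_cpx_arr_vec[OF Z i z] and ay = is_cpx_arr_vec[OF Y i y] and aw = is_cpx_arr_vec[OF Y i w]
      note hz = h_vec[OF i z] and haz = h_vec[OF j az] and \<alpha>z = \<alpha>_vc[OF i z] and ahz = is_cpx_arr_vec[OF Y i hz]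
      have "h p (Suc i mod n) *\<^sub>v (arr (ob Z p) i *\<^sub>v z) - (\<alpha> p i *\<^sub>v z + arr (ob Y p) i *\<^sub>v y)
        = arr (ob Y p) i *\<^sub>v (h p i *\<^sub>v z) - arr (ob Y p) i *\<^sub>v y"
        unfolding \<alpha>_vec[OF i z] he[OF i z, symmetric]
        by (rule eq_vecI) (insert carrier_vecD[OF haz] carrier_vecD[OF ahz] carrier_vecD[OF ay], simp_all del: index_mult_mat_vec dim_mult_mat_vec)
      then show "H p (Suc i mod n) *\<^sub>v (arr (ob T.T p) i *\<^sub>v v) = arr (ob Y p) i *\<^sub>v (H p i *\<^sub>v v)"
        unfolding v T_arr[OF i z y w] H_vec[OF i z y w]
          H_vec[OF j az add_carrier_vec[OF \<alpha>z ay] add_carrier_vec[OF e_vec[OF i z] aw]]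
          mult_minus_distrib_mat_vec[OF is_cpx_arr[OF Y i] hz y] .
    qed
    fix p i assume i: "i < n"
    show "H (p + 1) i *\<^sub>v (df T.T p i *\<^sub>v v) - df Y p i *\<^sub>v (H p i *\<^sub>v v)
      = h (p + 1) i *\<^sub>v (df Z p i *\<^sub>v (T.pr p i *\<^sub>v v)) - df Y p i *\<^sub>v (h p i *\<^sub>v (T.pr p i *\<^sub>v v))"
      if "v \<in> cochains T.T p i" for v
    proof -
      obtain z y w where z: "z \<in> cochains Z p i" and y: "y \<in> cochains Y p i"
        and w: "w \<in> cochains Y (p - 1) i" and v: "v = z @\<^sub>v (y @\<^sub>v w)" using split \<open>v \<in> _\<close> by blast
      note dz = is_cpx_df_vec[OF Z i z] and dy = is_cpx_df_vec[OF Y i y] and dw = is_cpx_df_vec[OF Y i w]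
      have c: "y - df Y (p - 1) i *\<^sub>v w \<in> cochains Y (p + 1 - 1) i" using y dw by simp
      note hz = h_vec[OF i z] and hdz = h_vec[OF i dz]
      note dhz = is_cpx_df_vec[OF Y i hz]
      show ?thesis
        unfolding v T_df[OF i z y w] H_vec[OF i z y w] H_vec[OF i dz dy c] p_vec[OF z y w]
          mult_minus_distrib_mat_vec[OF is_cpx_df[OF Y i] hz y]
        by (rule eq_vecI) (insert carrier_vecD[OF hdz] carrier_vecD[OF dhz] carrier_vecD[OF dy], simp_all del: index_mult_mat_vec dim_mult_mat_vec)
    qed
    fix z assume z: "z \<in> cochains Z p i" and dz: "df Z p i *\<^sub>v z = zero_cochain Z (p + 1) i"
    let ?v = "z @\<^sub>v (zero_cochain Y p i @\<^sub>v zero_cochain Y (p - 1) i)"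
    note v = z zero_carrier_vec[of "dimv (ob Y p) i"] zero_carrier_vec[of "dimv (ob Y (p - 1)) i"]
    have d0: "df Y (p - 1) i *\<^sub>v zero_cochain Y (p - 1) i = zero_cochain Y p i"
      by (rule mult_mat_zero_vec[OF df_carrier'[OF Y i]])
    have "df T.T p i *\<^sub>v ?v = zero_cochain T.T (p + 1) i"
      unfolding T_df[OF i v] dz d0 mult_mat_zero_vec[OF is_cpx_df[OF Y i]] dT by (simp add: append_zero_vec)
    then have "?v \<in> cocycles T.T p i" using z by (simp add: cocycles_def dT)
    moreover have "H p i *\<^sub>v ?v = h p i *\<^sub>v z" unfolding H_vec[OF i v] using h_vec[OF i z] by simp
    ultimately show "\<exists>x \<in> cocycles T.T p i. T.pr p i *\<^sub>v x = z \<and> H p i *\<^sub>v x = h p i *\<^sub>v z"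
      using p_vec[OF v] by blast
  qed
qed

section \<open>Roofs to a stalk complex\<close>

lemma chain_map_diff:
  assumes f: "chain_map n X Y f" and g: "chain_map n X Y g" and X: "is_cpx n X" and Y: "is_cpx n Y"
  shows "chain_map n X Y (\<lambda>p i. f p i - g p i)"
proof (rule chain_mapI[OF X Y])
  fix p i assume i: "i < n"
  then have j: "Suc i mod n < n" by simp
  note cf = chain_map_carrier[OF f] and cg = chain_map_carrier[OF g]
  show "f p i - g p i \<in> graded_maps X p i Y p i" using cg[OF i] by (rule minus_carrier_mat)
  fix x :: "'a vec" assume x: "x \<in> cochains X p i"
  note ax = is_cpx_arr_vec[OF X i x] and dx = is_cpx_df_vec[OF X i x]
  show "(f p (Suc i mod n) - g p (Suc i mod n)) *\<^sub>v (arr (ob X p) i *\<^sub>v x) = arr (ob Y p) i *\<^sub>v ((f p i - g p i) *\<^sub>v x)"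
    unfolding minus_mult_distrib_mat_vec[OF cf[OF j] cg[OF j] ax] minus_mult_distrib_mat_vec[OF cf[OF i] cg[OF i] x]
      mult_minus_distrib_mat_vec[OF is_cpx_arr[OF Y i] chain_map_vec[OF f i x] chain_map_vec[OF g i x]]
      chain_map_arr[OF f X Y i x] chain_map_arr[OF g X Y i x] ..
  show "(f (p + 1) i - g (p + 1) i) *\<^sub>v (df X p i *\<^sub>v x) = df Y p i *\<^sub>v ((f p i - g p i) *\<^sub>v x)"
    unfolding minus_mult_distrib_mat_vec[OF cf[OF i] cg[OF i] dx] minus_mult_distrib_mat_vec[OF cf[OF i] cg[OF i] x]
      mult_minus_distrib_mat_vec[OF is_cpx_df[OF Y i] chain_map_vec[OF f i x] chain_map_vec[OF g i x]]
      chain_map_df[OF f X Y i x] chain_map_df[OF g X Y i x] ..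
qed

lemma homotopic_comp:
  assumes fg: "homotopic n W Y f g" and f: "chain_map n W Y f" and g: "chain_map n W Y g" and \<pi>: "chain_map n T W \<pi>"
    and T: "is_cpx n T" and W: "is_cpx n W" and Y: "is_cpx n Y"
  shows "homotopic n T Y (f \<circ>\<^sub>g \<pi>) (g \<circ>\<^sub>g \<pi>)"
proof -
  obtain h where h: "\<And>p. h p \<in> rep_hom n (ob W p) (ob Y (p - 1))"
    and eq: "\<And>p i x. i < n \<Longrightarrow> x \<in> cochains W p i \<Longrightarrow>
      f p i *\<^sub>v x - g p i *\<^sub>v x = df Y (p - 1) i *\<^sub>v (h p i *\<^sub>v x) + h (p + 1) i *\<^sub>v (df W p i *\<^sub>v x)"
    using homotopicE[OF fg W Y chain_map_carrier[OF f] chain_map_carrier[OF g]] by blast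
  note hc = rep_hom_carrier[OF h] and pc = chain_map_carrier[OF \<pi>]
  note ac = assoc_mult_mat_vec[OF hc pc]
  show ?thesis
  proof (rule homotopicI[OF T Y, where h = "h \<circ>\<^sub>g \<pi>"])
    show "(f \<circ>\<^sub>g \<pi>) p i \<in> graded_maps T p i Y p i" if "i < n" for p i
      by (rule chain_map_carrier[OF chain_map_comp[OF f \<pi> T W Y] that])
    show "(g \<circ>\<^sub>g \<pi>) p i \<in> graded_maps T p i Y p i" if "i < n" for p i
      by (rule chain_map_carrier[OF chain_map_comp[OF g \<pi> T W Y] that])
    show "(h \<circ>\<^sub>g \<pi>) p \<in> rep_hom n (ob T p) (ob Y (p - 1))" for p
    proof (rule rep_homI[OF is_cpx_rep[OF T] is_cpx_rep[OF Y]])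
      fix i assume i: "i < n"
      then have j: "Suc i mod n < n" by simp
      show "(h \<circ>\<^sub>g \<pi>) p i \<in> graded_maps T p i Y (p - 1) i"
        unfolding comp_map_def using hc[OF i] pc[OF i] by (rule mult_carrier_mat)
      fix x :: "'a vec" assume x: "x \<in> cochains T p i"
      show "(h \<circ>\<^sub>g \<pi>) p (Suc i mod n) *\<^sub>v (arr (ob T p) i *\<^sub>v x) = arr (ob Y (p - 1)) i *\<^sub>v ((h \<circ>\<^sub>g \<pi>) p i *\<^sub>v x)"
        unfolding comp_map_def ac[OF i i x] ac[OF j j is_cpx_arr_vec[OF T i x]] chain_map_arr[OF \<pi> T W i x]
        by (rule rep_hom_arr[OF h is_cpx_rep[OF W] is_cpx_rep[OF Y] i chain_map_vec[OF \<pi> i x]])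
    qed
    fix p i assume i: "i < n"
    fix x :: "'a vec" assume x: "x \<in> cochains T p i"
    show "(f \<circ>\<^sub>g \<pi>) p i *\<^sub>v x - (g \<circ>\<^sub>g \<pi>) p i *\<^sub>v x
      = df Y (p - 1) i *\<^sub>v ((h \<circ>\<^sub>g \<pi>) p i *\<^sub>v x) + (h \<circ>\<^sub>g \<pi>) (p + 1) i *\<^sub>v (df T p i *\<^sub>v x)"
      unfolding comp_map_vec[OF f \<pi> i x] comp_map_vec[OF g \<pi> i x] eq[OF i chain_map_vec[OF \<pi> i x]]
      unfolding comp_map_def ac[OF i i x] ac[OF i i is_cpx_df_vec[OF T i x]] chain_map_df[OF \<pi> T W i x] ..
  qed
qed

lemma Suc_mod_eq_vertex_shift: "n > 0 \<Longrightarrow> Suc i mod n = vertex_shift n (- 1) i"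
  by (simp add: vertex_shift_def nat_mod_as_int add.commute)

text \<open>An abstraction of the targets \<open>F^m (X[1])\<close> for uniserial \<open>X\<close>:
  a stalk in degree \<open>q\<close> with socle at \<open>j\<close> and top at \<open>j + 2\<close>,
  so that only the arrow leaving \<open>j\<close> may have a kernel and only the arrow leaving
  \<open>j + 1\<close> a cokernel. Morphisms from \<open>C\<close> to it are made of
  \<open>Hom(H^q C, N)\<close>, controlled at the vertex \<open>j\<close>, and
  \<open>Ext^1(H^(q+1) C, N)\<close>, controlled at \<open>j + 1\<close>.\<close>

locale stalk_target =
  fixes n :: nat and N :: "'k::field cpx" and q :: int and j :: nat
  assumes n: "n > 0" and N: "is_cpx n N" and j: "j < n"
    and stalk: "\<And>p i. i < n \<Longrightarrow> p \<noteq> q \<Longrightarrow> dimv (ob N p) i = 0"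
    and inj: "\<And>i x. i < n \<Longrightarrow> i \<noteq> j \<Longrightarrow> x \<in> cochains N q i \<Longrightarrow>
      arr (ob N q) i *\<^sub>v x = zero_cochain N q (Suc i mod n) \<Longrightarrow> x = zero_cochain N q i"
    and surj: "\<And>i y. i < n \<Longrightarrow> i \<noteq> Suc j mod n \<Longrightarrow> y \<in> cochains N q (Suc i mod n) \<Longrightarrow>
      \<exists>x \<in> cochains N q i. arr (ob N q) i *\<^sub>v x = y"
begin

lemma N_eq:
  assumes "i < n" "p \<noteq> q" "x \<in> cochains N p i" "y \<in> cochains N p i"
  shows "x = y"
  using assms stalk[OF assms(1,2)] carrier_vec_0_eq by metis

text \<open>A homomorphism into a representation with socle at \<open>j\<close> vanishes once it
  vanishes at \<open>j\<close>. There every cocycle is a coboundary, and \<open>f\<close> kills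
  coboundaries because \<open>N\<close> is zero in degree \<open>q - 1\<close>. Injectivity of the
  other arrows carries the vanishing backwards from \<open>j\<close>.\<close>

lemma kills_cocycles:
  assumes Z: "is_cpx n Z" and f: "chain_map n Z N f" and H: "cocycles Z q j \<subseteq> coboundaries Z q j"
    and i: "i < n" and z: "z \<in> cocycles Z q i"
  shows "f q i *\<^sub>v z = zero_cochain N q i"
proof -
  have base: "f q j *\<^sub>v z = zero_cochain N q j" if z: "z \<in> cocycles Z q j" for z
  proof -
    have "z \<in> coboundaries Z q j" using H z by blast
    then obtain y where y: "y \<in> cochains Z (q - 1) j" "z = df Z (q - 1) j *\<^sub>v y"
      by (rule coboundariesE)
    have "f q j *\<^sub>v z = df N (q - 1) j *\<^sub>v (f (q - 1) j *\<^sub>v y)"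
      using chain_map_df[OF f Z N j y(1)] y(2) by simp
    also have "f (q - 1) j *\<^sub>v y = zero_cochain N (q - 1) j"
      by (rule N_eq[OF j _ chain_map_vec[OF f j y(1)]]) simp_all
    also have "df N (q - 1) j *\<^sub>v \<dots> = zero_cochain N q j" by (rule mult_mat_zero_vec[OF df_carrier'[OF N j]])
    finally show ?thesis .
  qed
  have "\<forall>i z. i < n \<longrightarrow> (i + s) mod n = j \<longrightarrow> z \<in> cocycles Z q i \<longrightarrow> f q i *\<^sub>v z = zero_cochain N q i" for s
  proof (induction s)
    case 0
    show ?case using base by auto
  next
    case (Suc s)
    show ?case
    proof (intro allI impI)
      fix i z assume i: "i < n" and ij: "(i + Suc s) mod n = j" and z: "z \<in> cocycles Z q i"
      show "f q i *\<^sub>v z = zero_cochain N q i"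
      \<comment> \<open>If \<open>Suc s\<close> is a multiple of \<open>n\<close>, then
        \<open>i\<close> is \<open>j\<close> itself, whose arrow need not be injective.\<close>
      proof (cases "i = j")
        case True
        then show ?thesis using base z by simp
      next
        case False
        have "(Suc i mod n + s) mod n = j" using ij by (simp add: mod_add_left_eq)
        moreover have "Suc i mod n < n" using i by simp
        ultimately have "f q (Suc i mod n) *\<^sub>v (arr (ob Z q) i *\<^sub>v z) = zero_cochain N q (Suc i mod n)"
          using Suc arr_cocycles[OF Z i z] by blast
        then have "arr (ob N q) i *\<^sub>v (f q i *\<^sub>v z) = zero_cochain N q (Suc i mod n)"
          using chain_map_arr[OF f Z N i cocyclesD(1)[OF z]] by simp
        then show ?thesis by (rule inj[OF i False chain_map_vec[OF f i cocyclesD(1)[OF z]]])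
      qed
    qed
  qed
  moreover have "(i + (j + n - i)) mod n = j" using i j by simp
  ultimately show ?thesis using i z by blast
qed

text \<open>As \<open>f\<close> kills cocycles of degree \<open>q\<close>, it factors through the
  differential. The factorization \<open>f q i * G\<close> is found at each vertex separately, so it
  need not respect arrows.\<close>

lemma linear_extension:
  assumes Z: "is_cpx n Z" and f: "chain_map n Z N f" and H: "cocycles Z q j \<subseteq> coboundaries Z q j" and i: "i < n"
  shows "\<exists>M \<in> graded_maps Z (q + 1) i N q i.
    \<forall>z \<in> cochains Z q i. M *\<^sub>v (df Z q i *\<^sub>v z) = f q i *\<^sub>v z"
proof -
  obtain G where G: "G \<in> graded_maps Z (q + 1) i Z q i"
    "\<And>x. x \<in> cochains Z q i \<Longrightarrow> df Z q i *\<^sub>v (G *\<^sub>v (df Z q i *\<^sub>v x)) = df Z q i *\<^sub>v x"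
    using gen_inverse_vec[OF is_cpx_df[OF Z i]] by blast
  note fc = chain_map_carrier[OF f i]
  show ?thesis
  proof (intro bexI[of _ "f q i * G"] ballI)
    show "f q i * G \<in> graded_maps Z (q + 1) i N q i" using fc G(1) by (rule mult_carrier_mat)
    fix z :: "'k vec" assume z: "z \<in> cochains Z q i"
    note dz = is_cpx_df_vec[OF Z i z]
    note gdz = mult_mat_vec_carrier[OF G(1) dz]
    have "G *\<^sub>v (df Z q i *\<^sub>v z) - z \<in> cocycles Z q i"
      using mult_minus_distrib_mat_vec[OF is_cpx_df[OF Z i] gdz z] G(2)[OF z] z gdz dz by (simp add: cocycles_def)
    then have "f q i *\<^sub>v (G *\<^sub>v (df Z q i *\<^sub>v z) - z) = zero_cochain N q i" by (rule kills_cocycles[OF Z f H i])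
    then have "f q i *\<^sub>v (G *\<^sub>v (df Z q i *\<^sub>v z)) - f q i *\<^sub>v z = zero_cochain N q i"
      using mult_minus_distrib_mat_vec[OF fc gdz z] by simp
    then have "f q i *\<^sub>v (G *\<^sub>v (df Z q i *\<^sub>v z)) = f q i *\<^sub>v z"
      using add_diff_vec[OF chain_map_vec[OF f i z] mult_mat_vec_carrier[OF fc gdz]] chain_map_vec[OF f i z] by simp
    then show "f q i * G *\<^sub>v (df Z q i *\<^sub>v z) = f q i *\<^sub>v z"
      using assoc_mult_mat_vec[OF fc G(1) dz] by simp
  qed
qed

text \<open>One step of integrating a cochain for \<open>Ext^1\<close>. The arrow at
  \<open>i\<close> is surjective on \<open>N\<close>, so a right inverse \<open>G\<close> corrects
  an arbitrary extension \<open>h\<close> by \<open>G c\<close>, where \<open>c\<close> is its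
  defect. The defect vanishes on the image of the differential, since \<open>f\<close> commutes with
  arrows, so the prescribed values survive.\<close>

lemma compatible_extension:
  assumes Z: "is_cpx n Z" and f: "chain_map n Z N f" and H: "cocycles Z q j \<subseteq> coboundaries Z q j" and i: "i < n"
    and ij: "i \<noteq> Suc j mod n"
    and M: "M \<in> graded_maps Z (q + 1) (Suc i mod n) N q (Suc i mod n)"
    and Mf: "\<forall>z \<in> cochains Z q (Suc i mod n). M *\<^sub>v (df Z q (Suc i mod n) *\<^sub>v z) = f q (Suc i mod n) *\<^sub>v z"
  shows "\<exists>M' \<in> graded_maps Z (q + 1) i N q i.
    (\<forall>z \<in> cochains Z q i. M' *\<^sub>v (df Z q i *\<^sub>v z) = f q i *\<^sub>v z) \<and>
    (\<forall>x \<in> cochains Z (q + 1) i. arr (ob N q) i *\<^sub>v (M' *\<^sub>v x) = M *\<^sub>v (arr (ob Z (q + 1)) i *\<^sub>v x))"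
proof -
  obtain h where h: "h \<in> graded_maps Z (q + 1) i N q i"
    "\<And>z. z \<in> cochains Z q i \<Longrightarrow> h *\<^sub>v (df Z q i *\<^sub>v z) = f q i *\<^sub>v z"
    using linear_extension[OF Z f H i] by blast
  let ?b = "arr (ob N q) i" and ?a = "arr (ob Z (q + 1)) i"
  note b = is_cpx_arr[OF N i, of q] and a = is_cpx_arr[OF Z i, of "q + 1"]
  obtain G where G: "G \<in> graded_maps N q (Suc i mod n) N q i"
    "\<And>x. x \<in> cochains N q i \<Longrightarrow> ?b *\<^sub>v (G *\<^sub>v (?b *\<^sub>v x)) = ?b *\<^sub>v x"
    using gen_inverse_vec[OF b] by blast
  have bG: "?b *\<^sub>v (G *\<^sub>v y) = y" if "y \<in> cochains N q (Suc i mod n)" for y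
    using surj[OF i ij that] G(2) by blast
  define c where "c = M * ?a - ?b * h"
  have c: "c \<in> graded_maps Z (q + 1) i N q (Suc i mod n)"
    unfolding c_def using mult_carrier_mat[OF b h(1)] by (rule minus_carrier_mat)
  have c_vec: "c *\<^sub>v x = M *\<^sub>v (?a *\<^sub>v x) - ?b *\<^sub>v (h *\<^sub>v x)" if x: "x \<in> cochains Z (q + 1) i" for x
    unfolding c_def minus_mult_distrib_mat_vec[OF mult_carrier_mat[OF M a] mult_carrier_mat[OF b h(1)] x]
      assoc_mult_mat_vec[OF M a x] assoc_mult_mat_vec[OF b h(1) x] ..
  let ?M = "h + G * c"
  have M': "?M *\<^sub>v x = h *\<^sub>v x + G *\<^sub>v (c *\<^sub>v x)" if x: "x \<in> cochains Z (q + 1) i" for x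
    unfolding add_mult_distrib_mat_vec[OF h(1) mult_carrier_mat[OF G(1) c] x] assoc_mult_mat_vec[OF G(1) c x] ..
  show ?thesis
  proof (intro bexI[of _ ?M] conjI ballI)
    show "?M \<in> graded_maps Z (q + 1) i N q i" using mult_carrier_mat[OF G(1) c] by (rule add_carrier_mat)
    show "?M *\<^sub>v (df Z q i *\<^sub>v z) = f q i *\<^sub>v z" if z: "z \<in> cochains Z q i" for z
    proof -
      have afz: "?b *\<^sub>v (f q i *\<^sub>v z) \<in> cochains N q (Suc i mod n)"
        by (rule is_cpx_arr_vec[OF N i chain_map_vec[OF f i z]])
      have "c *\<^sub>v (df Z q i *\<^sub>v z) = zero_cochain N q (Suc i mod n)"
        unfolding c_vec[OF is_cpx_df_vec[OF Z i z]] h(2)[OF z] is_cpx_df_arr[OF Z i z, symmetric]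
          Mf[rule_format, OF is_cpx_arr_vec[OF Z i z]] chain_map_arr[OF f Z N i z]
        using afz by simp
      then show ?thesis
        unfolding M'[OF is_cpx_df_vec[OF Z i z]] h(2)[OF z] using mult_mat_zero_vec[OF G(1)] chain_map_vec[OF f i z] by simp
    qed
    show "?b *\<^sub>v (?M *\<^sub>v x) = M *\<^sub>v (?a *\<^sub>v x)" if x: "x \<in> cochains Z (q + 1) i" for x
    proof -
      note cx = mult_mat_vec_carrier[OF c x] and hx = mult_mat_vec_carrier[OF h(1) x]
      show ?thesis
        unfolding M'[OF x] mult_add_distrib_mat_vec[OF b hx mult_mat_vec_carrier[OF G(1) cx]] bG[OF cx]
        unfolding c_vec[OF x]
        by (rule add_diff_vec[OF mult_mat_vec_carrier[OF b hx] mult_mat_vec_carrier[OF M mult_mat_vec_carrier[OF a x]]])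
    qed
  qed
qed

text \<open>Walking backwards from \<open>Suc j\<close>, each vertex is made compatible with its
  successor. The arrow leaving \<open>Suc j\<close>, which may fail to be surjective, would be met
  only when the cycle closes; what happens there is left open and settled in
  \<open>null_homotopic\<close>.\<close>

lemma extension:
  assumes Z: "is_cpx n Z" and f: "chain_map n Z N f" and H: "cocycles Z q j \<subseteq> coboundaries Z q j"
  obtains h where "\<And>i. i < n \<Longrightarrow> h i \<in> graded_maps Z (q + 1) i N q i"
    "\<And>i z. i < n \<Longrightarrow> z \<in> cochains Z q i \<Longrightarrow> h i *\<^sub>v (df Z q i *\<^sub>v z) = f q i *\<^sub>v z"
    "\<And>i x. i < n \<Longrightarrow> i \<noteq> Suc j mod n \<Longrightarrow> x \<in> cochains Z (q + 1) i \<Longrightarrow>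
      arr (ob N q) i *\<^sub>v (h i *\<^sub>v x) = h (Suc i mod n) *\<^sub>v (arr (ob Z (q + 1)) i *\<^sub>v x)"
proof -
  define v where "v t = vertex_shift n (int t) (Suc j mod n)" for t :: nat
  have v: "v t < n" for t unfolding v_def using n by (rule vertex_shift_less)
  have Sv: "Suc (v (Suc t)) mod n = v t" for t
    unfolding v_def Suc_mod_eq_vertex_shift[OF n] vertex_shift_add[OF n] by simp
  define P where "P t M \<longleftrightarrow> M \<in> graded_maps Z (q + 1) (v t) N q (v t) \<and>
    (\<forall>z \<in> cochains Z q (v t). M *\<^sub>v (df Z q (v t) *\<^sub>v z) = f q (v t) *\<^sub>v z)" for t M
  define Q where "Q t M M' \<longleftrightarrow> (v (Suc t) \<noteq> Suc j mod n \<longrightarrow> (\<forall>x \<in> cochains Z (q + 1) (v (Suc t)).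
    arr (ob N q) (v (Suc t)) *\<^sub>v (M' *\<^sub>v x) = M *\<^sub>v (arr (ob Z (q + 1)) (v (Suc t)) *\<^sub>v x)))" for t M M'
  have ex: "\<exists>M. P t M" for t using linear_extension[OF Z f H v[of t]] unfolding P_def by blast
  have "\<exists>M'. P (Suc t) M' \<and> Q t M M'" if M: "P t M" for t M
  proof (cases "v (Suc t) = Suc j mod n")
    case True
    then show ?thesis using ex[of "Suc t"] unfolding Q_def by blast
  next
    case False
    show ?thesis using compatible_extension[OF Z f H v False, unfolded Sv, of M] M unfolding P_def Q_def by blast
  qed
  then obtain g where g: "\<And>t. P t (g t)" "\<And>t. Q t (g t) (g (Suc t))"
    using dependent_nat_choice[of P Q] ex by blast
  \<comment> \<open>Dependent choice gives a matrix \<open>g t\<close> for every \<open>t\<close>.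
    The number \<open>d i < n\<close> picks the first visit of the walk to \<open>i\<close>, so
    \<open>d i = 0\<close> happens only at the excepted vertex \<open>Suc j\<close>.\<close>
  define d where "d i = nat ((int (Suc j mod n) - int i) mod int n)" for i
  have vd: "v (d i) = i" if "i < n" for i
    using that n by (simp add: v_def d_def vertex_shift_def mod_diff_right_eq)
  have dv: "d (v t) = t" if "t < n" for t
    using that n by (simp add: v_def d_def vertex_shift_def mod_diff_right_eq)
  have dn: "d i < n" for i using n by (simp add: d_def nat_less_iff)
  have step: "\<exists>t. d i = Suc t \<and> d (Suc i mod n) = t" if i: "i < n" "i \<noteq> Suc j mod n" for i
  proof (cases "d i")
    case 0
    then have "i = v 0" using vd[OF i(1)] by simp
    then show ?thesis using i n by (simp add: v_def vertex_shift_0)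
  next
    case (Suc t)
    then have "v t = Suc i mod n" using Sv[of t] vd[OF i(1)] by simp
    then show ?thesis using Suc dv[of t] dn[of i] by simp
  qed
  show thesis
  proof (rule that[of "\<lambda>i. g (d i)"])
    show "g (d i) \<in> graded_maps Z (q + 1) i N q i" if "i < n" for i
      using g(1)[of "d i"] vd[OF that] by (simp add: P_def)
    show "g (d i) *\<^sub>v (df Z q i *\<^sub>v z) = f q i *\<^sub>v z" if "i < n" "z \<in> cochains Z q i" for i z
      using g(1)[of "d i"] vd[OF that(1)] that(2) by (simp add: P_def)
    show "arr (ob N q) i *\<^sub>v (g (d i) *\<^sub>v x) = g (d (Suc i mod n)) *\<^sub>v (arr (ob Z (q + 1)) i *\<^sub>v x)"
      if i: "i < n" "i \<noteq> Suc j mod n" and x: "x \<in> cochains Z (q + 1) i" for i x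
    proof -
      obtain t where t: "d i = Suc t" "d (Suc i mod n) = t" using step[OF i] by blast
      have "v (Suc t) = i" using vd[OF i(1)] t(1) by simp
      then show ?thesis using g(2)[of t] i(2) x unfolding Q_def t by simp
    qed
  qed
qed

text \<open>The defect of \<open>h\<close> from \<open>extension\<close> kills cocycles of degree
  \<open>q + 1\<close>, hence equals \<open>e d\<close> for some \<open>e\<close>, and
  \<open>realize\<close> applies to the pair \<open>(h, e)\<close>. The null-homotopy exists only
  after pulling \<open>f\<close> back along a quasi-isomorphism.\<close>

lemma null_homotopic:
  assumes Z: "is_cpx n Z" and f: "chain_map n Z N f" and H1: "cocycles Z q j \<subseteq> coboundaries Z q j"
    and H2: "cocycles Z (q + 1) (Suc j mod n) \<subseteq> coboundaries Z (q + 1) (Suc j mod n)"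
  obtains T \<pi> H where "is_cpx n T" "quasi_iso n T Z \<pi>" "\<And>p. H p \<in> rep_hom n (ob T p) (ob N (p - 1))"
    "\<And>p i x. i < n \<Longrightarrow> x \<in> cochains T p i \<Longrightarrow>
      f p i *\<^sub>v (\<pi> p i *\<^sub>v x) = df N (p - 1) i *\<^sub>v (H p i *\<^sub>v x) + H (p + 1) i *\<^sub>v (df T p i *\<^sub>v x)"
proof -
  obtain h where hc: "\<And>i. i < n \<Longrightarrow> h i \<in> graded_maps Z (q + 1) i N q i"
    and hf: "\<And>i z. i < n \<Longrightarrow> z \<in> cochains Z q i \<Longrightarrow> h i *\<^sub>v (df Z q i *\<^sub>v z) = f q i *\<^sub>v z"
    and ha: "\<And>i x. i < n \<Longrightarrow> i \<noteq> Suc j mod n \<Longrightarrow> x \<in> cochains Z (q + 1) i \<Longrightarrow>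
      arr (ob N q) i *\<^sub>v (h i *\<^sub>v x) = h (Suc i mod n) *\<^sub>v (arr (ob Z (q + 1)) i *\<^sub>v x)"
    using extension[OF Z f H1] by blast
  have "\<exists>e \<in> graded_maps Z (q + 2) i N q (Suc i mod n).
      \<forall>x \<in> cochains Z (q + 1) i.
        h (Suc i mod n) *\<^sub>v (arr (ob Z (q + 1)) i *\<^sub>v x) - arr (ob N q) i *\<^sub>v (h i *\<^sub>v x) = e *\<^sub>v (df Z (q + 1) i *\<^sub>v x)"
    if i: "i < n" for i
  proof -
    have i': "Suc i mod n < n" using i by simp
    let ?b = "arr (ob N q) i" and ?a = "arr (ob Z (q + 1)) i"
    note b = is_cpx_arr[OF N i, of q] and a = is_cpx_arr[OF Z i, of "q + 1"]
    define c where "c = h (Suc i mod n) * ?a - ?b * h i"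
    have c: "c \<in> graded_maps Z (q + 1) i N q (Suc i mod n)"
      unfolding c_def using mult_carrier_mat[OF b hc[OF i]] by (rule minus_carrier_mat)
    have c_vec: "c *\<^sub>v x = h (Suc i mod n) *\<^sub>v (?a *\<^sub>v x) - ?b *\<^sub>v (h i *\<^sub>v x)" if x: "x \<in> cochains Z (q + 1) i" for x
      unfolding c_def minus_mult_distrib_mat_vec[OF mult_carrier_mat[OF hc[OF i'] a] mult_carrier_mat[OF b hc[OF i]] x]
        assoc_mult_mat_vec[OF hc[OF i'] a x] assoc_mult_mat_vec[OF b hc[OF i] x] ..
    \<comment> \<open>Away from \<open>Suc j\<close> the defect is zero by \<open>extension\<close>.
      At \<open>Suc j\<close> a cocycle is some \<open>d z\<close> by \<open>H2\<close>, and there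
      the values of \<open>h\<close> are those of \<open>f\<close>, which commutes with
      arrows.\<close>
    have c0: "c *\<^sub>v x = zero_cochain N q (Suc i mod n)" if x: "x \<in> cocycles Z (q + 1) i" for x
    proof (cases "i = Suc j mod n")
      case False
      then show ?thesis unfolding c_vec[OF cocyclesD(1)[OF x]] ha[OF i False cocyclesD(1)[OF x]]
        using mult_mat_vec_carrier[OF hc[OF i'] is_cpx_arr_vec[OF Z i cocyclesD(1)[OF x]]] by simp
    next
      case True
      then have "x \<in> coboundaries Z (q + 1) i" using H2 x by blast
      then obtain z where z: "z \<in> cochains Z q i" "x = df Z q i *\<^sub>v z"
        by (auto elim: coboundariesE)
      have "?b *\<^sub>v (f q i *\<^sub>v z) \<in> cochains N q (Suc i mod n)"
        by (rule is_cpx_arr_vec[OF N i chain_map_vec[OF f i z(1)]])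
      then show ?thesis
        unfolding c_vec[OF cocyclesD(1)[OF x]]
        unfolding z(2) hf[OF i z(1)] is_cpx_df_arr[OF Z i z(1), symmetric]
          hf[OF i' is_cpx_arr_vec[OF Z i z(1)]] chain_map_arr[OF f Z N i z(1)] by simp
    qed
    have D: "df Z (q + 1) i \<in> graded_maps Z (q + 1) i Z (q + 2) i"
      using is_cpx_df[OF Z i, of "q + 1"] by (simp add: add.assoc)
    obtain G where G: "G \<in> graded_maps Z (q + 2) i Z (q + 1) i"
      "\<And>x. x \<in> cochains Z (q + 1) i \<Longrightarrow> df Z (q + 1) i *\<^sub>v (G *\<^sub>v (df Z (q + 1) i *\<^sub>v x)) = df Z (q + 1) i *\<^sub>v x"
      using gen_inverse_vec[OF D] by blast
    show ?thesis
    proof (intro bexI[of _ "c * G"] ballI)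
      show "c * G \<in> graded_maps Z (q + 2) i N q (Suc i mod n)" using c G(1) by (rule mult_carrier_mat)
      fix x :: "'k vec" assume x: "x \<in> cochains Z (q + 1) i"
      note dx = mult_mat_vec_carrier[OF D x]
      note gdx = mult_mat_vec_carrier[OF G(1) dx]
      have dx': "df Z (q + 1) i *\<^sub>v x \<in> cochains Z (q + 1 + 1) i" by (rule is_cpx_df_vec[OF Z i x])
      have "G *\<^sub>v (df Z (q + 1) i *\<^sub>v x) - x \<in> cocycles Z (q + 1) i"
        using mult_minus_distrib_mat_vec[OF D gdx x] G(2)[OF x] x gdx dx' by (simp add: cocycles_def)
      from c0[OF this] have "c *\<^sub>v (G *\<^sub>v (df Z (q + 1) i *\<^sub>v x)) - c *\<^sub>v x = zero_cochain N q (Suc i mod n)"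
        using mult_minus_distrib_mat_vec[OF c gdx x] by simp
      then have "c *\<^sub>v (G *\<^sub>v (df Z (q + 1) i *\<^sub>v x)) = c *\<^sub>v x"
        using add_diff_vec[OF mult_mat_vec_carrier[OF c x] mult_mat_vec_carrier[OF c gdx]] mult_mat_vec_carrier[OF c x] by simp
      then show "h (Suc i mod n) *\<^sub>v (?a *\<^sub>v x) - ?b *\<^sub>v (h i *\<^sub>v x) = (c * G) *\<^sub>v (df Z (q + 1) i *\<^sub>v x)"
        using assoc_mult_mat_vec[OF c G(1) dx] c_vec[OF x] by simp
    qed
  qed
  then obtain e where ec: "\<And>i. i < n \<Longrightarrow> e i \<in> graded_maps Z (q + 2) i N q (Suc i mod n)"
    and he: "\<And>i x. i < n \<Longrightarrow> x \<in> cochains Z (q + 1) i \<Longrightarrow>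
        h (Suc i mod n) *\<^sub>v (arr (ob Z (q + 1)) i *\<^sub>v x) - arr (ob N q) i *\<^sub>v (h i *\<^sub>v x) = e i *\<^sub>v (df Z (q + 1) i *\<^sub>v x)"
    by metis
  \<comment> \<open>Relative to \<open>N\<close>, \<open>h\<close> has degree \<open>-1\<close> and
    \<open>e\<close> degree \<open>-2\<close>. With the target \<open>Y = N[-1]\<close> these become
    the degrees \<open>0\<close> and \<open>-1\<close> that \<open>realize\<close> expects.\<close>
  define hh where "hh p i = (if p = q + 1 then h i else 0\<^sub>m (dimv (ob N (p - 1)) i) (dimv (ob Z p) i))" for p i
  define ee where "ee p i = (if p = q + 2 then e i else 0\<^sub>m (dimv (ob N (p - 2)) (Suc i mod n)) (dimv (ob Z p) i))" for p i
  define Y where "Y = shift_cpx (- 1) N"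
  have Y: "is_cpx n Y" unfolding Y_def by (rule is_cpx_shift[OF N])
  have obY: "ob Y p = ob N (p - 1)" for p by (simp add: Y_def ob_shift_m1)
  have hhc: "hh p i \<in> graded_maps Z p i N (p - 1) i" if "i < n" for p i
    using hc[OF that] by (simp add: hh_def)
  have eec: "ee p i \<in> graded_maps Z p i N (p - 2) (Suc i mod n)" if "i < n" for p i
    using ec[OF that] by (simp add: ee_def)
  note hhv = mult_mat_vec_carrier[OF hhc] and eev = mult_mat_vec_carrier[OF eec]
  obtain T \<pi> H where T: "is_cpx n T" "quasi_iso n T Z \<pi>" "\<And>p. H p \<in> rep_hom n (ob T p) (ob Y p)"
    and eq: "\<And>p i x. i < n \<Longrightarrow> x \<in> cochains T p i \<Longrightarrow>
      H (p + 1) i *\<^sub>v (df T p i *\<^sub>v x) - df Y p i *\<^sub>v (H p i *\<^sub>v x)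
      = hh (p + 1) i *\<^sub>v (df Z p i *\<^sub>v (\<pi> p i *\<^sub>v x)) - df Y p i *\<^sub>v (hh p i *\<^sub>v (\<pi> p i *\<^sub>v x))"
  proof (rule realize[OF Z Y, of hh ee])
    fix p i assume i: "i < n"
    then have i': "Suc i mod n < n" by simp
    show "hh p i \<in> graded_maps Z p i Y p i" using hhc[OF i] by (simp add: obY)
    show eeY: "ee p i \<in> graded_maps Z p i Y (p - 1) (Suc i mod n)" using eec[OF i, of p] by (simp add: obY)
    fix z :: "'k vec" assume z: "z \<in> cochains Z p i"
    note dz = is_cpx_df_vec[OF Z i z] and az = is_cpx_arr_vec[OF Z i z]
    have e2: "ee (p + 1) i *\<^sub>v (df Z p i *\<^sub>v z) \<in> cochains N (p - 1) (Suc i mod n)"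
      using eev[OF i dz] by simp
    have "df Y (p - 1) (Suc i mod n) *\<^sub>v (ee p i *\<^sub>v z) \<in> cochains Y (p - 1 + 1) (Suc i mod n)"
      by (rule is_cpx_df_vec[OF Y i' mult_mat_vec_carrier[OF eeY z]])
    then have e1: "df Y (p - 1) (Suc i mod n) *\<^sub>v (ee p i *\<^sub>v z) \<in> cochains N (p - 1) (Suc i mod n)"
      by (simp add: obY)
    show "hh p (Suc i mod n) *\<^sub>v (arr (ob Z p) i *\<^sub>v z) - arr (ob Y p) i *\<^sub>v (hh p i *\<^sub>v z)
       = df Y (p - 1) (Suc i mod n) *\<^sub>v (ee p i *\<^sub>v z) + ee (p + 1) i *\<^sub>v (df Z p i *\<^sub>v z)"
    proof (cases "p = q + 1")
      case True
      have "ee p i *\<^sub>v z = zero_cochain Y (p - 1) (Suc i mod n)"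
        using zero_mat_mult_vec[OF z] True by (simp add: ee_def obY)
      then have d0: "df Y (p - 1) (Suc i mod n) *\<^sub>v (ee p i *\<^sub>v z) = zero_cochain N (p - 1) (Suc i mod n)"
        using mult_mat_zero_vec[OF df_carrier'[OF Y i']] by (simp add: obY)
      have "ee (p + 1) i *\<^sub>v (df Z p i *\<^sub>v z) = e i *\<^sub>v (df Z (q + 1) i *\<^sub>v z)" using True by (simp add: ee_def)
      then show ?thesis unfolding d0 using he[OF i] z True e2 by (simp add: hh_def obY)
    next
      case False
      then have "p - 1 \<noteq> q" by simp
      then show ?thesis
        by (intro N_eq[OF i', of "p - 1"])
          (use hhv[OF i' az] is_cpx_arr_vec[OF N i hhv[OF i z]] e1 e2 in \<open>auto simp: obY\<close>)
    qed
  qed blast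
  show thesis
  proof (rule that[of T \<pi> H])
    show "is_cpx n T" "quasi_iso n T Z \<pi>" by fact+
    show Hr: "H p \<in> rep_hom n (ob T p) (ob N (p - 1))" for p using T(3)[of p] by (simp add: obY)
    fix p i and x :: "'k vec" assume i: "i < n" and x: "x \<in> cochains T p i"
    have w: "\<pi> p i *\<^sub>v x \<in> cochains Z p i" by (rule chain_map_vec[OF quasi_iso_chain_map[OF T(2)] i x])
    have Hx: "H p i *\<^sub>v x \<in> cochains N (p - 1) i"
      using rep_hom_carrier[OF Hr i] x by (rule mult_mat_vec_carrier)
    have dHx: "df N (p - 1) i *\<^sub>v (H p i *\<^sub>v x) \<in> cochains N p i"
      using df_carrier'[OF N i] Hx by (rule mult_mat_vec_carrier)
    have Hdx: "H (p + 1) i *\<^sub>v (df T p i *\<^sub>v x) \<in> cochains N p i"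
      using mult_mat_vec_carrier[OF rep_hom_carrier[OF Hr i] is_cpx_df_vec[OF T(1) i x]] by simp
    show "f p i *\<^sub>v (\<pi> p i *\<^sub>v x) = df N (p - 1) i *\<^sub>v (H p i *\<^sub>v x) + H (p + 1) i *\<^sub>v (df T p i *\<^sub>v x)"
    proof (cases "p = q")
      case False
      show ?thesis by (rule N_eq[OF i False chain_map_vec[OF f i w] add_carrier_vec[OF dHx Hdx]])
    next
      case True
      have hh0: "hh p i *\<^sub>v (\<pi> p i *\<^sub>v x) = zero_cochain N (p - 1) i"
        using zero_mat_mult_vec[OF w] True by (simp add: hh_def)
      have "df Y p i *\<^sub>v (hh p i *\<^sub>v (\<pi> p i *\<^sub>v x)) = zero_cochain N p i"
        unfolding hh0 using mult_mat_zero_vec[OF is_cpx_df[OF Y i]] by (simp add: obY)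
      moreover have "hh (p + 1) i *\<^sub>v (df Z p i *\<^sub>v (\<pi> p i *\<^sub>v x)) = f p i *\<^sub>v (\<pi> p i *\<^sub>v x)"
        using hf[OF i] w True by (simp add: hh_def)
      \<comment> \<open>The sign in the differential of \<open>N[-1]\<close> turns the difference
        delivered by \<open>realize\<close> into the sum of the homotopy formula.\<close>
      moreover have "df Y p i *\<^sub>v (H p i *\<^sub>v x) = - (df N (p - 1) i *\<^sub>v (H p i *\<^sub>v x))"
        unfolding Y_def by (rule df_shift_m1_vec[OF N i Hx])
      moreover have fw: "f p i *\<^sub>v (\<pi> p i *\<^sub>v x) \<in> cochains N p i" by (rule chain_map_vec[OF f i w])
      ultimately have "f p i *\<^sub>v (\<pi> p i *\<^sub>v x) = H (p + 1) i *\<^sub>v (df T p i *\<^sub>v x) - - (df N (p - 1) i *\<^sub>v (H p i *\<^sub>v x))"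
        using eq[OF i x] by simp
      also have "\<dots> = df N (p - 1) i *\<^sub>v (H p i *\<^sub>v x) + H (p + 1) i *\<^sub>v (df T p i *\<^sub>v x)"
        by (rule eq_vecI) (insert carrier_vecD[OF dHx] carrier_vecD[OF Hdx], simp_all del: index_mult_mat_vec dim_mult_mat_vec)
      finally show ?thesis .
    qed
  qed
qed

text \<open>An Ore square brings both roofs over one \<open>W\<close>, and the difference of their
  right legs becomes null-homotopic over a further resolution \<open>T\<close>. In particular every
  roof is equivalent to the zero roof.\<close>

lemma roofs_equivalent:
  assumes C: "is_cpx n C" and H1: "cocycles C q j \<subseteq> coboundaries C q j"
    and H2: "cocycles C (q + 1) (Suc j mod n) \<subseteq> coboundaries C (q + 1) (Suc j mod n)"
    and r: "r \<in> roofs n C N" and r': "r' \<in> roofs n C N"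
  shows "roof_equiv n C N r r'"
proof -
  obtain Z s f where rr: "r = (Z, s, f)" and Z: "is_cpx n Z" and s: "quasi_iso n Z C s" and f: "chain_map n Z N f"
    using r by (auto simp: roofs_def)
  obtain Z' s' f' where rr': "r' = (Z', s', f')" and Z': "is_cpx n Z'" and s': "quasi_iso n Z' C s'" and f': "chain_map n Z' N f'"
    using r' by (auto simp: roofs_def)
  note sc = quasi_iso_chain_map[OF s] and sc' = quasi_iso_chain_map[OF s']
  obtain W u v where W: "is_cpx n W" and u: "quasi_iso n W Z u" and v: "chain_map n W Z' v"
    and hom: "homotopic n W C (s \<circ>\<^sub>g u) (s' \<circ>\<^sub>g v)"
    using ore_square[OF Z Z' C sc s'] by blast
  note uc = quasi_iso_chain_map[OF u]
  note su = quasi_iso_comp[OF s u W Z C]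
  \<comment> \<open>The quasi-isomorphism from \<open>W\<close> to \<open>C\<close> is injective on
    cohomology, so vanishing of cohomology passes from \<open>C\<close> to \<open>W\<close>.\<close>
  have tr: "cocycles W p i \<subseteq> coboundaries W p i" if "i < n" "cocycles C p i \<subseteq> coboundaries C p i" for p i
    using quasi_iso_inj[OF su that(1)] chain_map_cocycles[OF quasi_iso_chain_map[OF su] W C that(1)] that(2) by blast
  have j': "Suc j mod n < n" using n by simp
  note fu = chain_map_comp[OF f uc W Z N] and fv = chain_map_comp[OF f' v W Z' N]
  obtain T \<pi> H where T: "is_cpx n T" "quasi_iso n T W \<pi>" "\<And>p. H p \<in> rep_hom n (ob T p) (ob N (p - 1))"
    and eq: "\<And>p i x. i < n \<Longrightarrow> x \<in> cochains T p i \<Longrightarrow>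
      ((f \<circ>\<^sub>g u) p i - (f' \<circ>\<^sub>g v) p i) *\<^sub>v (\<pi> p i *\<^sub>v x) = df N (p - 1) i *\<^sub>v (H p i *\<^sub>v x) + H (p + 1) i *\<^sub>v (df T p i *\<^sub>v x)"
    using null_homotopic[OF W chain_map_diff[OF fu fv W N] tr[OF j H1] tr[OF j' H2]] by blast
  note \<pi> = quasi_iso_chain_map[OF T(2)]
  have up: "chain_map n T Z (u \<circ>\<^sub>g \<pi>)" by (rule chain_map_comp[OF uc \<pi> T(1) W Z])
  have vp: "chain_map n T Z' (v \<circ>\<^sub>g \<pi>)" by (rule chain_map_comp[OF v \<pi> T(1) W Z'])
  have q: "quasi_iso n T C (s \<circ>\<^sub>g (u \<circ>\<^sub>g \<pi>))"
    by (rule quasi_iso_comp[OF s quasi_iso_comp[OF u T(2) T(1) W Z] T(1) Z C])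
  have h1: "homotopic n T C (s \<circ>\<^sub>g (u \<circ>\<^sub>g \<pi>)) (s' \<circ>\<^sub>g (v \<circ>\<^sub>g \<pi>))"
  proof -
    have c1: "chain_map n W C (s \<circ>\<^sub>g u)" and c2: "chain_map n W C (s' \<circ>\<^sub>g v)"
      by (rule chain_map_comp[OF sc uc W Z C], rule chain_map_comp[OF sc' v W Z' C])
    have k1: "chain_map n T C ((s \<circ>\<^sub>g u) \<circ>\<^sub>g \<pi>)" and k2: "chain_map n T C ((s' \<circ>\<^sub>g v) \<circ>\<^sub>g \<pi>)"
      by (rule chain_map_comp[OF c1 \<pi> T(1) W C], rule chain_map_comp[OF c2 \<pi> T(1) W C])
    obtain h where h: "\<And>p. h p \<in> rep_hom n (ob T p) (ob C (p - 1))"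
      and he: "\<And>p i x. i < n \<Longrightarrow> x \<in> cochains T p i \<Longrightarrow>
        ((s \<circ>\<^sub>g u) \<circ>\<^sub>g \<pi>) p i *\<^sub>v x - ((s' \<circ>\<^sub>g v) \<circ>\<^sub>g \<pi>) p i *\<^sub>v x = df C (p - 1) i *\<^sub>v (h p i *\<^sub>v x) + h (p + 1) i *\<^sub>v (df T p i *\<^sub>v x)"
      using homotopicE[OF homotopic_comp[OF hom c1 c2 \<pi> T(1) W C] T(1) C chain_map_carrier[OF k1] chain_map_carrier[OF k2]] by blast
    show ?thesis
    proof (rule homotopicI[OF T(1) C chain_map_carrier[OF chain_map_comp[OF sc up T(1) Z C]]
          chain_map_carrier[OF chain_map_comp[OF sc' vp T(1) Z' C]] h])
      fix p i and x :: "'k vec" assume i: "i < n" and x: "x \<in> cochains T p i"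
      note px = chain_map_vec[OF \<pi> i x]
      show "(s \<circ>\<^sub>g (u \<circ>\<^sub>g \<pi>)) p i *\<^sub>v x - (s' \<circ>\<^sub>g (v \<circ>\<^sub>g \<pi>)) p i *\<^sub>v x = df C (p - 1) i *\<^sub>v (h p i *\<^sub>v x) + h (p + 1) i *\<^sub>v (df T p i *\<^sub>v x)"
        using he[OF i x]
        unfolding comp_map_vec[OF c1 \<pi> i x] comp_map_vec[OF c2 \<pi> i x] comp_map_vec[OF sc uc i px] comp_map_vec[OF sc' v i px]
          comp_map_vec[OF sc up i x] comp_map_vec[OF sc' vp i x] comp_map_vec[OF uc \<pi> i x] comp_map_vec[OF v \<pi> i x] .
    qed
  qed
  have h2: "homotopic n T N (f \<circ>\<^sub>g (u \<circ>\<^sub>g \<pi>)) (f' \<circ>\<^sub>g (v \<circ>\<^sub>g \<pi>))"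
  proof (rule homotopicI[OF T(1) N chain_map_carrier[OF chain_map_comp[OF f up T(1) Z N]]
        chain_map_carrier[OF chain_map_comp[OF f' vp T(1) Z' N]] T(3)])
    fix p i and x :: "'k vec" assume i: "i < n" and x: "x \<in> cochains T p i"
    note px = chain_map_vec[OF \<pi> i x]
    show "(f \<circ>\<^sub>g (u \<circ>\<^sub>g \<pi>)) p i *\<^sub>v x - (f' \<circ>\<^sub>g (v \<circ>\<^sub>g \<pi>)) p i *\<^sub>v x = df N (p - 1) i *\<^sub>v (H p i *\<^sub>v x) + H (p + 1) i *\<^sub>v (df T p i *\<^sub>v x)"
      using eq[OF i x]
      unfolding minus_mult_distrib_mat_vec[OF chain_map_carrier[OF fu i] chain_map_carrier[OF fv i] px]
        comp_map_vec[OF f uc i px] comp_map_vec[OF f' v i px]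
        comp_map_vec[OF f up i x] comp_map_vec[OF f' vp i x] comp_map_vec[OF uc \<pi> i x] comp_map_vec[OF v \<pi> i x] .
  qed
  show ?thesis unfolding roof_equiv_def rr rr' using T(1) up vp q h1 h2 by blast
qed

end

section \<open>Actions of paths on cohomology\<close>

lemma vertex_shift_plus:
  assumes "n > 0"
  shows "vertex_shift n m ((i + l) mod n) = (vertex_shift n m i + l) mod n"
proof -
  have "int (vertex_shift n m ((i + l) mod n)) = int ((vertex_shift n m i + l) mod n)"
    using assms by (simp add: vertex_shift_def zmod_int mod_diff_left_eq mod_add_left_eq) (simp add: algebra_simps)
  then show ?thesis by simp
qed

lemma vertex_shift_Suc: "n > 0 \<Longrightarrow> vertex_shift n m (Suc i mod n) = Suc (vertex_shift n m i) mod n"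
  using vertex_shift_plus[of n m i 1] by simp

lemma path_mat_tau_rep:
  assumes "n > 0" "i < n"
  shows "path_mat n (tau_rep n m V) i l = path_mat n V (vertex_shift n m i) l"
  by (induction l) (simp_all add: tau_rep_def vertex_shift_plus[OF assms(1)])

lemma tau_rep_tube:
  assumes n: "n > 0" and V: "V \<in> tube n"
  shows "tau_rep n m V \<in> tube n"
proof -
  have "is_rep n (tau_rep n m V)"
    using V vertex_shift_less[OF n] by (simp add: tube_def is_rep_def tau_rep_def vertex_shift_Suc[OF n])
  moreover obtain l where l: "\<And>i. i < n \<Longrightarrow> path_mat n V i l = 0\<^sub>m (dimv V ((i + l) mod n)) (dimv V i)"
    using V by (auto simp: tube_def nilpotent_rep_def)
  have "path_mat n (tau_rep n m V) i l = 0\<^sub>m (dimv (tau_rep n m V) ((i + l) mod n)) (dimv (tau_rep n m V) i)" if "i < n" for i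
    unfolding path_mat_tau_rep[OF n that] l[OF vertex_shift_less[OF n]]
    by (simp add: tau_rep_def vertex_shift_plus[OF n])
  ultimately show ?thesis by (auto simp: tube_def nilpotent_rep_def)
qed

lemma is_cpx_tau:
  assumes n: "n > 0" and X: "is_cpx n X"
  shows "is_cpx n (tau_cpx n m X)"
proof -
  obtain b where b: "\<And>p i. \<bar>p\<bar> > b \<Longrightarrow> i < n \<Longrightarrow> dimv (ob X p) i = 0" using X unfolding is_cpx_def by blast
  note v = vertex_shift_less[OF n]
  show ?thesis
  proof (rule is_cpxI[where b = b])
    show "ob (tau_cpx n m X) p \<in> tube n" for p
      using tau_rep_tube[OF n, of "ob X p"] X by (simp add: tau_cpx_def is_cpx_def)
    show "dimv (ob (tau_cpx n m X) p) i = 0" if "\<bar>p\<bar> > b" "i < n" for p i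
      using b[OF that(1) v] by (simp add: tau_cpx_def tau_rep_def)
    fix p i assume i: "i < n"
    show "df (tau_cpx n m X) p i \<in> graded_maps (tau_cpx n m X) p i (tau_cpx n m X) (p + 1) i"
      using is_cpx_df[OF X v] by (simp add: tau_cpx_def tau_rep_def)
    fix x :: "'a vec" assume x: "x \<in> cochains (tau_cpx n m X) p i"
    show "df (tau_cpx n m X) p (Suc i mod n) *\<^sub>v (arr (ob (tau_cpx n m X) p) i *\<^sub>v x)
      = arr (ob (tau_cpx n m X) (p + 1)) i *\<^sub>v (df (tau_cpx n m X) p i *\<^sub>v x)"
      using is_cpx_df_arr[OF X v, of x p] x by (simp add: tau_cpx_def tau_rep_def vertex_shift_Suc[OF n])
    show "df (tau_cpx n m X) (p + 1) i *\<^sub>v (df (tau_cpx n m X) p i *\<^sub>v x) = zero_cochain (tau_cpx n m X) (p + 2) i"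
      using is_cpx_df_df[OF X v, of x p] x by (simp add: tau_cpx_def tau_rep_def)
  qed
qed

lemma is_cpx_F: "n > 0 \<Longrightarrow> is_cpx n X \<Longrightarrow> is_cpx n (F_cpx n m X)"
  unfolding F_cpx_def by (intro is_cpx_shift is_cpx_tau)

lemma ob_F: "ob (F_cpx n m X) p = tau_rep n (- m) (ob X (p + m))"
  by (simp add: F_cpx_def shift_cpx_def tau_cpx_def)

lemma dimv_F: "dimv (ob (F_cpx n m X) p) i = dimv (ob X (p + m)) (vertex_shift n (- m) i)"
  by (simp add: ob_F tau_rep_def)

lemma arr_F: "arr (ob (F_cpx n m X) p) i = arr (ob X (p + m)) (vertex_shift n (- m) i)"
  by (simp add: ob_F tau_rep_def)

lemma cocycles_shift:
  assumes X: "is_cpx n X" and i: "i < n"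
  shows "cocycles (shift_cpx m X) p i = cocycles X (p + m) i"
proof -
  have 0: "- v = 0\<^sub>v d \<longleftrightarrow> v = 0\<^sub>v d" if "v \<in> carrier_vec d" for v :: "'a vec" and d
    using that by (auto simp: vec_eq_iff)
  have pm: "p + 1 + m = p + m + 1" by simp
  show ?thesis
    using df_shift_vec[OF X i, of _ p m] 0[OF is_cpx_df_vec[OF X i, of _ "p + m"]]
    by (auto simp: cocycles_def ob_shift pm split: if_splits)
qed

lemma coboundaries_shift:
  assumes X: "is_cpx n X" and i: "i < n"
  shows "coboundaries (shift_cpx m X) p i = coboundaries X (p + m) i"
proof -
  have pm: "p - 1 + m = p + m - 1" by simp
  have d: "df (shift_cpx m X) (p - 1) i *\<^sub>v y = (if even m then df X (p + m - 1) i *\<^sub>v y else df X (p + m - 1) i *\<^sub>v (- y))"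
    if "y \<in> cochains X (p + m - 1) i" for y
    using df_shift_vec[OF X i, of y "p - 1" m] that mult_mat_uminus_vec[OF is_cpx_df[OF X i] that] by (simp add: pm)
  show ?thesis
  proof (intro subset_antisym subsetI)
    fix x assume "x \<in> coboundaries (shift_cpx m X) p i"
    then obtain y where y: "y \<in> cochains X (p + m - 1) i" "x = df (shift_cpx m X) (p - 1) i *\<^sub>v y"
      by (auto simp: ob_shift pm elim!: coboundariesE)
    show "x \<in> coboundaries X (p + m) i"
      by (rule coboundariesI[of "if even m then y else - y"]) (use y d[OF y(1)] in auto)
  next
    fix x assume "x \<in> coboundaries X (p + m) i"
    then obtain y where y: "y \<in> cochains X (p + m - 1) i" "x = df X (p + m - 1) i *\<^sub>v y"
      by (rule coboundariesE)
    have uy: "- y \<in> cochains X (p + m - 1) i" using y(1) by simp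
    show "x \<in> coboundaries (shift_cpx m X) p i"
      by (rule coboundariesI[of "if even m then y else - y"]) (use y d[OF y(1)] d[OF uy] in \<open>auto simp: ob_shift pm\<close>)
  qed
qed

text \<open>The sign in the differential of a shift changes neither kernels nor images, so the
  cohomology of \<open>F^m X\<close> is that of \<open>X\<close> with other indices; likewise for
  coboundaries below.\<close>

lemma cocycles_F:
  assumes n: "n > 0" and X: "is_cpx n X" and i: "i < n"
  shows "cocycles (F_cpx n m X) p i = cocycles X (p + m) (vertex_shift n (- m) i)"
  unfolding F_cpx_def cocycles_shift[OF is_cpx_tau[OF n X] i]
  by (simp add: cocycles_def tau_cpx_def tau_rep_def)

lemma coboundaries_F:
  assumes n: "n > 0" and X: "is_cpx n X" and i: "i < n"
  shows "coboundaries (F_cpx n m X) p i = coboundaries X (p + m) (vertex_shift n (- m) i)"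
  unfolding F_cpx_def coboundaries_shift[OF is_cpx_tau[OF n X] i]
  by (simp add: coboundaries_def tau_cpx_def tau_rep_def)

text \<open>Annihilation of the cohomology by the \<open>l\<close>-th power of the arrow ideal of
  the path algebra, phrased on representatives.\<close>

definition path_kills :: "nat \<Rightarrow> nat \<Rightarrow> 'k::field cpx \<Rightarrow> bool" where
  "path_kills n l X \<longleftrightarrow> (\<forall>p. \<forall>i<n. \<forall>x \<in> cocycles X p i.
     path_mat n (ob X p) i l *\<^sub>v x \<in> coboundaries X p ((i + l) mod n))"

lemma path_kills_F:
  assumes n: "n > 0" and X: "is_cpx n X" and k: "path_kills n l X"
  shows "path_kills n l (F_cpx n m X)"
  unfolding path_kills_def
proof (intro allI impI ballI)
  fix p i x assume i: "i < n" and "x \<in> cocycles (F_cpx n m X) p i"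
  then have x: "x \<in> cocycles X (p + m) (vertex_shift n (- m) i)" using cocycles_F[OF n X] by blast
  have i': "(i + l) mod n < n" using n by simp
  show "path_mat n (ob (F_cpx n m X) p) i l *\<^sub>v x \<in> coboundaries (F_cpx n m X) p ((i + l) mod n)"
    unfolding coboundaries_F[OF n X i'] ob_F path_mat_tau_rep[OF n i] vertex_shift_plus[OF n]
    using k x vertex_shift_less[OF n] by (simp add: path_kills_def)
qed

text \<open>The statement that the morphism of cohomology induced by \<open>\<phi>\<close> is annihilated by the paths of length
  \<open>l\<close>, phrased without choosing a representative. For \<open>l = 0\<close> it says that this morphism is
  zero.\<close>

definition path_kills_roofs :: "nat \<Rightarrow> nat \<Rightarrow> 'k::field cpx \<Rightarrow> 'k roof set \<Rightarrow> bool" where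
  "path_kills_roofs n l Y \<phi> \<longleftrightarrow> (\<forall>(Z, s, f) \<in> \<phi>. \<forall>p. \<forall>i<n. \<forall>z \<in> cocycles Z p i.
     path_mat n (ob Y p) i l *\<^sub>v (f p i *\<^sub>v z) \<in> coboundaries Y p ((i + l) mod n))"

text \<open>Independence of the representative. Over a common roof \<open>W\<close>, surjectivity of
  \<open>s u\<close> on cohomology finds a cocycle \<open>w\<close> with the same image in
  \<open>X\<close> as \<open>z\<close>, and injectivity of \<open>s'\<close> identifies
  \<open>z\<close> with \<open>u' w\<close>. Then \<open>f' z\<close>, \<open>f' u' w\<close> and
  \<open>f u w\<close> agree modulo coboundaries.\<close>

lemma path_kills_roof_class:
  assumes X: "is_cpx n X" and Y: "is_cpx n Y" and Z: "is_cpx n Z"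
    and s: "chain_map n Z X s" and f: "chain_map n Z Y f" and k: "path_kills_roofs n l Y {(Z, s, f)}"
  shows "path_kills_roofs n l Y (roof_class n X Y (Z, s, f))"
  unfolding path_kills_roofs_def
proof (clarify)
  fix Z' s' f' p i z
  assume mem: "(Z', s', f') \<in> roof_class n X Y (Z, s, f)" and i: "i < n" and z: "z \<in> cocycles Z' p i"
  have Z': "is_cpx n Z'" and s': "quasi_iso n Z' X s'" and f': "chain_map n Z' Y f'"
    and eqv: "roof_equiv n X Y (Z, s, f) (Z', s', f')"
    using mem by (auto simp: roof_class_def roofs_def)
  note sc' = quasi_iso_chain_map[OF s']
  obtain W u u' where W: "is_cpx n W" and u: "chain_map n W Z u" and u': "chain_map n W Z' u'"
    and su: "quasi_iso n W X (s \<circ>\<^sub>g u)" and hs: "homotopic n W X (s \<circ>\<^sub>g u) (s' \<circ>\<^sub>g u')"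
    and hf: "homotopic n W Y (f \<circ>\<^sub>g u) (f' \<circ>\<^sub>g u')"
    using eqv unfolding roof_equiv_def by auto
  have i': "(i + l) mod n < n" using i by simp
  note sz = chain_map_cocycles[OF sc' Z' X i z]
  obtain w where w: "w \<in> cocycles W p i" and sw: "s' p i *\<^sub>v z - (s \<circ>\<^sub>g u) p i *\<^sub>v w \<in> coboundaries X p i"
    using quasi_iso_surj[OF su i sz] .
  note wc = cocyclesD(1)[OF w] and zc = cocyclesD(1)[OF z]
  have c: "chain_map n W X (s \<circ>\<^sub>g u)" "chain_map n W X (s' \<circ>\<^sub>g u')" "chain_map n W Y (f \<circ>\<^sub>g u)" "chain_map n W Y (f' \<circ>\<^sub>g u')"
    by (rule chain_map_comp[OF s u W Z X], rule chain_map_comp[OF sc' u' W Z' X],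
        rule chain_map_comp[OF f u W Z Y], rule chain_map_comp[OF f' u' W Z' Y])
  have "(s \<circ>\<^sub>g u) p i *\<^sub>v w - (s' \<circ>\<^sub>g u') p i *\<^sub>v w \<in> coboundaries X p i"
    by (rule homotopicD[OF hs W X chain_map_carrier[OF c(1)] chain_map_carrier[OF c(2)] i w])
  from coboundaries_diff_trans[OF X i sw this chain_map_vec[OF sc' i zc] chain_map_vec[OF c(1) i wc] chain_map_vec[OF c(2) i wc]]
  have "s' p i *\<^sub>v z - s' p i *\<^sub>v (u' p i *\<^sub>v w) \<in> coboundaries X p i"
    unfolding comp_map_vec[OF sc' u' i wc] .
  moreover note u'w = chain_map_cocycles[OF u' W Z' i w]
  ultimately have "s' p i *\<^sub>v (z - u' p i *\<^sub>v w) \<in> coboundaries X p i"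
    using mult_minus_distrib_mat_vec[OF chain_map_carrier[OF sc' i] zc cocyclesD(1)[OF u'w]] by simp
  then have "z - u' p i *\<^sub>v w \<in> coboundaries Z' p i"
    by (rule quasi_iso_inj[OF s' i cocycles_minus[OF Z' i z u'w]])
  from chain_map_coboundaries[OF f' Z' Y i this]
  have 1: "f' p i *\<^sub>v z - f' p i *\<^sub>v (u' p i *\<^sub>v w) \<in> coboundaries Y p i"
    using mult_minus_distrib_mat_vec[OF chain_map_carrier[OF f' i] zc cocyclesD(1)[OF u'w]] by simp
  have "(f \<circ>\<^sub>g u) p i *\<^sub>v w - (f' \<circ>\<^sub>g u') p i *\<^sub>v w \<in> coboundaries Y p i"
    by (rule homotopicD[OF hf W Y chain_map_carrier[OF c(3)] chain_map_carrier[OF c(4)] i w])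
  then have 2: "f p i *\<^sub>v (u p i *\<^sub>v w) - f' p i *\<^sub>v (u' p i *\<^sub>v w) \<in> coboundaries Y p i"
    unfolding comp_map_vec[OF f' u' i wc] comp_map_vec[OF f u i wc] .
  note uw = chain_map_cocycles[OF u W Z i w]
  note k1 = chain_map_vec[OF f i cocyclesD(1)[OF uw]] and k2 = chain_map_vec[OF f' i cocyclesD(1)[OF u'w]]
    and k3 = chain_map_vec[OF f' i zc]
  have "f p i *\<^sub>v (u p i *\<^sub>v w) - f' p i *\<^sub>v z \<in> coboundaries Y p i"
    by (rule coboundaries_diff_trans[OF Y i 2 coboundaries_diff_sym[OF Y i 1 k3 k2] k1 k2 k3])
  from path_coboundaries[OF Y i this, of l]
  have "path_mat n (ob Y p) i l *\<^sub>v (f p i *\<^sub>v (u p i *\<^sub>v w)) - path_mat n (ob Y p) i l *\<^sub>v (f' p i *\<^sub>v z)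
      \<in> coboundaries Y p ((i + l) mod n)"
    using mult_minus_distrib_mat_vec[OF path_mat_carrier[OF is_cpx_rep[OF Y] i] k1 k3] by simp
  moreover have "path_mat n (ob Y p) i l *\<^sub>v (f p i *\<^sub>v (u p i *\<^sub>v w)) \<in> coboundaries Y p ((i + l) mod n)"
    using k uw i by (auto simp: path_kills_roofs_def)
  ultimately show "path_mat n (ob Y p) i l *\<^sub>v (f' p i *\<^sub>v z) \<in> coboundaries Y p ((i + l) mod n)"
    by (rule coboundaries_diff_cong[OF Y i' _ _ path_vec_carrier[OF is_cpx_rep[OF Y] i k1] path_vec_carrier[OF is_cpx_rep[OF Y] i k3]])
qed

lemma chain_map_add:
  assumes f: "chain_map n X Y f" and g: "chain_map n X Y g" and X: "is_cpx n X" and Y: "is_cpx n Y"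
  shows "chain_map n X Y (f +\<^sub>g g)"
proof (rule chain_mapI[OF X Y])
  fix p i assume i: "i < n"
  then have j: "Suc i mod n < n" by simp
  note cf = chain_map_carrier[OF f] and cg = chain_map_carrier[OF g]
  show "(f +\<^sub>g g) p i \<in> graded_maps X p i Y p i" unfolding add_map_def using cg[OF i] by (rule add_carrier_mat)
  fix x :: "'a vec" assume x: "x \<in> cochains X p i"
  note ax = is_cpx_arr_vec[OF X i x] and dx = is_cpx_df_vec[OF X i x]
  show "(f +\<^sub>g g) p (Suc i mod n) *\<^sub>v (arr (ob X p) i *\<^sub>v x) = arr (ob Y p) i *\<^sub>v ((f +\<^sub>g g) p i *\<^sub>v x)"
    unfolding add_map_def add_mult_distrib_mat_vec[OF cf[OF j] cg[OF j] ax] add_mult_distrib_mat_vec[OF cf[OF i] cg[OF i] x]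
      mult_add_distrib_mat_vec[OF is_cpx_arr[OF Y i] chain_map_vec[OF f i x] chain_map_vec[OF g i x]]
      chain_map_arr[OF f X Y i x] chain_map_arr[OF g X Y i x] ..
  show "(f +\<^sub>g g) (p + 1) i *\<^sub>v (df X p i *\<^sub>v x) = df Y p i *\<^sub>v ((f +\<^sub>g g) p i *\<^sub>v x)"
    unfolding add_map_def add_mult_distrib_mat_vec[OF cf[OF i] cg[OF i] dx] add_mult_distrib_mat_vec[OF cf[OF i] cg[OF i] x]
      mult_add_distrib_mat_vec[OF is_cpx_df[OF Y i] chain_map_vec[OF f i x] chain_map_vec[OF g i x]]
      chain_map_df[OF f X Y i x] chain_map_df[OF g X Y i x] ..
qed

lemma roofsD:
  assumes "(Z, s, f) \<in> roofs n X Y"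
  shows "is_cpx n Z" "quasi_iso n Z X s" "chain_map n Z X s" "chain_map n Z Y f"
  using assms by (auto simp: roofs_def quasi_iso_def)

lemma roof_class_roofs: "roof_class n X Y r \<subseteq> roofs n X Y"
  by (auto simp: roof_class_def)

lemma homotopic_refl:
  assumes X: "is_cpx n X" and Y: "is_cpx n Y" and f: "chain_map n X Y f"
  shows "homotopic n X Y f f"
proof (rule homotopicI[OF X Y chain_map_carrier[OF f] chain_map_carrier[OF f]])
  let ?h = "\<lambda>p i. 0\<^sub>m (dimv (ob Y (p - 1)) i) (dimv (ob X p) i)"
  show "?h p \<in> rep_hom n (ob X p) (ob Y (p - 1))" for p
    by (rule rep_homI[OF is_cpx_rep[OF X] is_cpx_rep[OF Y]])
      (simp_all add: zero_mat_mult_vec is_cpx_arr_vec[OF X] mult_mat_zero_vec[OF is_cpx_arr[OF Y]])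
  fix p i and x :: "'a vec" assume i: "i < n" and x: "x \<in> cochains X p i"
  show "f p i *\<^sub>v x - f p i *\<^sub>v x = df Y (p - 1) i *\<^sub>v (?h p i *\<^sub>v x) + ?h (p + 1) i *\<^sub>v (df X p i *\<^sub>v x)"
    using chain_map_vec[OF f i x]
    by (simp add: zero_mat_mult_vec x is_cpx_df_vec[OF X i x] mult_mat_zero_vec[OF df_carrier'[OF Y i]])
qed

lemma roof_class_self:
  assumes X: "is_cpx n X" and Y: "is_cpx n Y" and r: "r \<in> roofs n X Y"
  shows "r \<in> roof_class n X Y r"
proof -
  obtain Z s f where rr: "r = (Z, s, f)" by (cases r)
  note Z = roofsD[OF r[unfolded rr]]
  note id = id_map_chain_map[OF Z(1)]
  have "quasi_iso n Z X (s \<circ>\<^sub>g id_map Z)" by (rule quasi_iso_comp[OF Z(2) quasi_iso_id[OF Z(1)] Z(1,1) X])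
  moreover have "homotopic n Z X (s \<circ>\<^sub>g id_map Z) (s \<circ>\<^sub>g id_map Z)" by (rule homotopic_refl[OF Z(1) X chain_map_comp[OF Z(3) id Z(1,1) X]])
  moreover have "homotopic n Z Y (f \<circ>\<^sub>g id_map Z) (f \<circ>\<^sub>g id_map Z)" by (rule homotopic_refl[OF Z(1) Y chain_map_comp[OF Z(4) id Z(1,1) Y]])
  ultimately show ?thesis using r id Z(1) unfolding roof_class_def roof_equiv_def rr by auto
qed

lemma zero_roof: "is_cpx n X \<Longrightarrow> is_cpx n Y \<Longrightarrow> (X, id_map X, zero_map X Y) \<in> roofs n X Y"
  by (simp add: roofs_def quasi_iso_id zero_map_chain_map)

lemma id_roof: "is_cpx n X \<Longrightarrow> (X, id_map X, id_map X) \<in> roofs n X X"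
  by (simp add: roofs_def quasi_iso_id id_map_chain_map)

section \<open>Annihilation by paths under the operations of the derived and the orbit
  category\<close>

lemma Zer_roofs: "Zer (derived_cat n) X Y \<subseteq> roofs n X Y"
  by (simp add: derived_cat_def roof_class_roofs)

lemma Add_roofs: "Add (derived_cat n) X Y \<phi> \<psi> \<subseteq> roofs n X Y"
  using roof_class_roofs by (fastforce simp: derived_cat_def)

lemma Cmp_roofs: "Cmp (derived_cat n) X Y Z \<psi> \<phi> \<subseteq> roofs n X Z"
  using roof_class_roofs by (fastforce simp: derived_cat_def)

lemma path_kills_Zer:
  assumes X: "is_cpx n X" and Y: "is_cpx n Y"
  shows "path_kills_roofs n l Y (Zer (derived_cat n) X Y)"
proof -
  note z = roofsD[OF zero_roof[OF X Y]]
  have "path_kills_roofs n l Y {(X, id_map X, zero_map X Y)}"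
    unfolding path_kills_roofs_def
  proof clarify
    fix p i x assume i: "i < n" and x: "x \<in> cocycles X p i"
    have i': "(i + l) mod n < n" using i by simp
    show "path_mat n (ob Y p) i l *\<^sub>v (zero_map X Y p i *\<^sub>v x) \<in> coboundaries Y p ((i + l) mod n)"
      unfolding zero_map_vec[OF cocyclesD(1)[OF x]] mult_mat_zero_vec[OF path_mat_carrier[OF is_cpx_rep[OF Y] i]]
      by (rule coboundaries_zero[OF Y i'])
  qed
  then show ?thesis using path_kills_roof_class[OF X Y z(1,3,4)] by (simp add: derived_cat_def)
qed

text \<open>Here \<phi> and \<psi> may be arbitrary sets of roofs, so sums can be handled as unions
  of classes before anything is said about these unions being single classes.\<close>

lemma path_kills_Add:
  assumes X: "is_cpx n X" and Y: "is_cpx n Y" and \<phi>: "\<phi> \<subseteq> roofs n X Y" and \<psi>: "\<psi> \<subseteq> roofs n X Y"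
    and k: "path_kills_roofs n l Y \<phi>" "path_kills_roofs n l Y \<psi>"
  shows "path_kills_roofs n l Y (Add (derived_cat n) X Y \<phi> \<psi>)"
proof -
  have "path_kills_roofs n l Y (roof_class n X Y (Z, s, f +\<^sub>g g))" if f: "(Z, s, f) \<in> \<phi>" and g: "(Z, s, g) \<in> \<psi>" for Z s f g
  proof -
    note zf = roofsD[OF subsetD[OF \<phi> f]] and zg = roofsD[OF subsetD[OF \<psi> g]]
    show ?thesis
    proof (rule path_kills_roof_class[OF X Y zf(1,3) chain_map_add[OF zf(4) zg(4) zf(1) Y]])
      show "path_kills_roofs n l Y {(Z, s, f +\<^sub>g g)}"
        unfolding path_kills_roofs_def
      proof clarify
        fix p i z assume i: "i < n" and z: "z \<in> cocycles Z p i"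
        have i': "(i + l) mod n < n" using i by simp
        note zc = cocyclesD(1)[OF z]
        have "path_mat n (ob Y p) i l *\<^sub>v ((f +\<^sub>g g) p i *\<^sub>v z)
          = path_mat n (ob Y p) i l *\<^sub>v (f p i *\<^sub>v z) + path_mat n (ob Y p) i l *\<^sub>v (g p i *\<^sub>v z)"
          unfolding add_map_def add_mult_distrib_mat_vec[OF chain_map_carrier[OF zf(4) i] chain_map_carrier[OF zg(4) i] zc]
          by (rule mult_add_distrib_mat_vec[OF path_mat_carrier[OF is_cpx_rep[OF Y] i] chain_map_vec[OF zf(4) i zc] chain_map_vec[OF zg(4) i zc]])
        moreover have "path_mat n (ob Y p) i l *\<^sub>v (f p i *\<^sub>v z) \<in> coboundaries Y p ((i + l) mod n)"
          "path_mat n (ob Y p) i l *\<^sub>v (g p i *\<^sub>v z) \<in> coboundaries Y p ((i + l) mod n)"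
          using k f g i z unfolding path_kills_roofs_def by blast+
        ultimately show "path_mat n (ob Y p) i l *\<^sub>v ((f +\<^sub>g g) p i *\<^sub>v z) \<in> coboundaries Y p ((i + l) mod n)"
          using coboundaries_add[OF Y i'] by simp
      qed
    qed
  qed
  then show ?thesis unfolding derived_cat_def path_kills_roofs_def by fastforce
qed

text \<open>The right leg of a composite passes through the complex \<open>B\<close>, which is
  quasi-isomorphic to \<open>Y\<close>. Paths of length \<open>l\<close> therefore annihilate the
  cohomology of \<open>B\<close>, and the homomorphism \<open>g\<close> carries this over to
  \<open>Z\<close>.\<close>

lemma path_kills_Cmp:
  assumes X: "is_cpx n X" and Y: "is_cpx n Y" and Z: "is_cpx n Z" and \<phi>: "\<phi> \<subseteq> roofs n X Y" and \<psi>: "\<psi> \<subseteq> roofs n Y Z"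
    and k: "path_kills n l Y"
  shows "path_kills_roofs n l Z (Cmp (derived_cat n) X Y Z \<psi> \<phi>)"
proof -
  have "path_kills_roofs n l Z (roof_class n X Z (W, s \<circ>\<^sub>g u, g \<circ>\<^sub>g v))"
    if f: "(A, s, f) \<in> \<phi>" and g: "(B, t, g) \<in> \<psi>" and W: "is_cpx n W" and u: "quasi_iso n W A u" and v: "chain_map n W B v"
    for W u v A s f B t g
  proof -
    note A = roofsD[OF subsetD[OF \<phi> f]] and B = roofsD[OF subsetD[OF \<psi> g]]
    show ?thesis
    proof (rule path_kills_roof_class[OF X Z W chain_map_comp[OF A(3) quasi_iso_chain_map[OF u] W A(1) X] chain_map_comp[OF B(4) v W B(1) Z]])
      show "path_kills_roofs n l Z {(W, s \<circ>\<^sub>g u, g \<circ>\<^sub>g v)}"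
        unfolding path_kills_roofs_def
      proof clarify
        fix p i w assume i: "i < n" and w: "w \<in> cocycles W p i"
        have i': "(i + l) mod n < n" using i by simp
        note vw = chain_map_cocycles[OF v W B(1) i w]
        note vwc = cocyclesD(1)[OF vw]
        note pvw = path_cocycles[OF B(1) i vw, of l]
        have "t p ((i + l) mod n) *\<^sub>v (path_mat n (ob B p) i l *\<^sub>v (v p i *\<^sub>v w)) = path_mat n (ob Y p) i l *\<^sub>v (t p i *\<^sub>v (v p i *\<^sub>v w))"
          by (rule rep_hom_path[OF chain_map_hom[OF B(3)] is_cpx_rep[OF B(1)] is_cpx_rep[OF Y] i vwc])
        also have "\<dots> \<in> coboundaries Y p ((i + l) mod n)"
          using k i chain_map_cocycles[OF B(3) B(1) Y i vw] by (simp add: path_kills_def)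
        finally have "path_mat n (ob B p) i l *\<^sub>v (v p i *\<^sub>v w) \<in> coboundaries B p ((i + l) mod n)"
          by (rule quasi_iso_inj[OF B(2) i' pvw])
        from chain_map_coboundaries[OF B(4) B(1) Z i' this]
        show "path_mat n (ob Z p) i l *\<^sub>v ((g \<circ>\<^sub>g v) p i *\<^sub>v w) \<in> coboundaries Z p ((i + l) mod n)"
          unfolding comp_map_vec[OF B(4) v i cocyclesD(1)[OF w]]
            rep_hom_path[OF chain_map_hom[OF B(4)] is_cpx_rep[OF B(1)] is_cpx_rep[OF Z] i vwc] .
      qed
    qed
  qed
  then show ?thesis unfolding derived_cat_def path_kills_roofs_def by fastforce
qed

lemma path_kills_Sum:
  assumes X: "is_cpx n X" and Y: "is_cpx n Y"
    and k: "\<And>\<phi>. \<phi> \<in> set fs \<Longrightarrow> \<phi> \<subseteq> roofs n X Y \<and> path_kills_roofs n l Y \<phi>"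
  shows "Sum_hom (derived_cat n) X Y fs \<subseteq> roofs n X Y \<and> path_kills_roofs n l Y (Sum_hom (derived_cat n) X Y fs)"
  using k
proof (induction fs)
  case Nil
  then show ?case using Zer_roofs path_kills_Zer[OF X Y] by (simp add: Sum_hom_def)
next
  case (Cons \<phi> fs)
  have "Sum_hom (derived_cat n) X Y (\<phi> # fs) = Add (derived_cat n) X Y \<phi> (Sum_hom (derived_cat n) X Y fs)"
    by (simp add: Sum_hom_def)
  then show ?case using Cons Add_roofs path_kills_Add[OF X Y] by simp
qed

text \<open>The target is \<open>F_cpx n 0 X\<close> because the component in degree
  \<open>0\<close> of an endomorphism in the orbit category is read there. It has the same data as
  \<open>X\<close> at the vertices below \<open>n\<close>, but need not be equal to \<open>X\<close>
  as a record.\<close>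

lemma path_kills_Idn:
  assumes n: "n > 0" and X: "is_cpx n X" and k: "path_kills_roofs n l (F_cpx n 0 X) (Idn (derived_cat n) X)"
  shows "path_kills n l X"
  unfolding path_kills_def
proof (intro allI impI ballI)
  fix p i x assume i: "i < n" and x: "x \<in> cocycles X p i"
  have i': "(i + l) mod n < n" using i by simp
  have "(X, id_map X, id_map X) \<in> Idn (derived_cat n) X"
    using roof_class_self[OF X X id_roof[OF X]] by (simp add: derived_cat_def)
  then have "path_mat n (ob (F_cpx n 0 X) p) i l *\<^sub>v (id_map X p i *\<^sub>v x) \<in> coboundaries (F_cpx n 0 X) p ((i + l) mod n)"
    using k i x unfolding path_kills_roofs_def by blast
  then show "path_mat n (ob X p) i l *\<^sub>v x \<in> coboundaries X p ((i + l) mod n)"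
    unfolding id_map_vec[OF cocyclesD(1)[OF x]] coboundaries_F[OF n X i'] ob_F
    by (simp add: path_mat_tau_rep[OF n i] vertex_shift_0 i n)
qed

lemma derived_Hom_roofs: "\<phi> \<in> Hom (derived_cat n) X Y \<Longrightarrow> \<phi> \<subseteq> roofs n X Y"
  using roof_class_roofs by (fastforce simp: derived_cat_def)

text \<open>The component in degree \<open>0\<close> is a sum of composites
  \<open>X -> F^a Q -> F^a F^(-a) X\<close>. Each factors through \<open>F^a Q\<close>, whose
  cohomology is annihilated because that of \<open>Q\<close> is.\<close>

lemma path_kills_orbit_Cmp:
  assumes n: "n > 0" and X: "is_cpx n X" and Q: "is_cpx n Q" and k: "path_kills n l Q"
    and \<iota>: "\<iota> \<in> Hom (cluster_tube n) X Q" and \<pi>: "\<pi> \<in> Hom (cluster_tube n) Q X"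
  shows "Cmp (cluster_tube n) X Q X \<pi> \<iota> 0 \<subseteq> roofs n X (F_cpx n 0 X) \<and>
    path_kills_roofs n l (F_cpx n 0 X) (Cmp (cluster_tube n) X Q X \<pi> \<iota> 0)"
proof -
  define fs where "fs = map (\<lambda>a. Cmp (derived_cat n) X (F_cpx n a Q) (F_cpx n 0 X)
      (F_class n a Q (F_cpx n (0 - a) X) (\<pi> (0 - a))) (\<iota> a))
      (sorted_list_of_set {a. \<iota> a \<noteq> Zer (derived_cat n) X (F_cpx n a Q)})"
  have eq: "Cmp (cluster_tube n) X Q X \<pi> \<iota> 0 = Sum_hom (derived_cat n) X (F_cpx n 0 X) fs"
    by (simp add: cluster_tube_def orbit_cat_def fs_def)
  have "\<phi> \<subseteq> roofs n X (F_cpx n 0 X) \<and> path_kills_roofs n l (F_cpx n 0 X) \<phi>" if \<phi>: "\<phi> \<in> set fs" for \<phi>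
  proof -
    obtain a where a: "\<phi> = Cmp (derived_cat n) X (F_cpx n a Q) (F_cpx n 0 X)
      (F_class n a Q (F_cpx n (0 - a) X) (\<pi> (0 - a))) (\<iota> a)" using \<phi> by (auto simp: fs_def)
    have \<iota>a: "\<iota> a \<subseteq> roofs n X (F_cpx n a Q)"
      using \<iota> by (intro derived_Hom_roofs) (simp add: cluster_tube_def orbit_cat_def)
    have "F_class n a Q (F_cpx n (0 - a) X) (\<pi> (0 - a)) \<subseteq> roofs n (F_cpx n a Q) (F_cpx n a (F_cpx n (0 - a) X))"
      using roof_class_roofs by (fastforce simp: F_class_def)
    then have \<pi>a: "F_class n a Q (F_cpx n (0 - a) X) (\<pi> (0 - a)) \<subseteq> roofs n (F_cpx n a Q) (F_cpx n 0 X)"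
      using F_cpx_add[OF n, of a "0 - a" X] by simp
    show ?thesis unfolding a
      using Cmp_roofs path_kills_Cmp[OF X is_cpx_F[OF n Q] is_cpx_F[OF n X] \<iota>a \<pi>a path_kills_F[OF n Q k]] by blast
  qed
  then show ?thesis unfolding eq by (rule path_kills_Sum[OF X is_cpx_F[OF n X]])
qed

lemma orbit_Idn_0: "Idn (cluster_tube n) X 0 = Idn (derived_cat n) X"
  by (simp add: cluster_tube_def orbit_cat_def)

lemma orbit_Sum_0:
  "Sum_hom (cluster_tube n) X Y fs 0 = Sum_hom (derived_cat n) X (F_cpx n 0 Y) (map (\<lambda>f. f 0) fs)"
  by (induction fs) (simp_all add: Sum_hom_def cluster_tube_def orbit_cat_def)

lemma cluster_tube_Obj: "X \<in> Obj (cluster_tube n) \<longleftrightarrow> is_cpx n X"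
  by (simp add: cluster_tube_def orbit_cat_def derived_cat_def)

text \<open>The same argument twice: the identity of \<open>P\<close> is a sum of morphisms through
  copies of \<open>C\<close>, and the identity of \<open>X\<close> factors through \<open>P\<close>.
  Both identities are evaluated in degree \<open>0\<close>.\<close>

lemma path_kills_add_closure:
  fixes C :: "'k::field cpx"
  assumes n: "n > 0" and C: "is_cpx n C" and k: "path_kills n l C" and X: "X \<in> add_closure (cluster_tube n) C"
  shows "path_kills n l X"
proof -
  obtain Y P m where CP: "is_direct_sum (cluster_tube n) (replicate m C) P" and XP: "is_direct_sum (cluster_tube n) [X, Y] P"
    using X by (auto simp: add_closure_def)
  have P: "is_cpx n P" using CP by (simp add: is_direct_sum_def cluster_tube_Obj)
  have Xc: "is_cpx n X" using XP by (simp add: is_direct_sum_def cluster_tube_Obj)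
  have kP: "path_kills n l P"
  proof -
    obtain \<iota> \<pi> where hom: "\<And>j. j < m \<Longrightarrow> \<iota> j \<in> Hom (cluster_tube n) C P \<and> \<pi> j \<in> Hom (cluster_tube n) P C"
      and sum: "Sum_hom (cluster_tube n) P P (map (\<lambda>j. Cmp (cluster_tube n) P (replicate m C ! j) P (\<iota> j) (\<pi> j)) [0..<m]) = Idn (cluster_tube n) P"
      using CP by (auto simp: is_direct_sum_def)
    define fs where "fs = map (\<lambda>f. f 0) (map (\<lambda>j. Cmp (cluster_tube n) P (replicate m C ! j) P (\<iota> j) (\<pi> j)) [0..<m])"
    have "Idn (derived_cat n) P = Sum_hom (derived_cat n) P (F_cpx n 0 P) fs"
      unfolding fs_def orbit_Sum_0[symmetric] sum orbit_Idn_0 ..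
    moreover have "\<phi> \<subseteq> roofs n P (F_cpx n 0 P) \<and> path_kills_roofs n l (F_cpx n 0 P) \<phi>" if \<phi>: "\<phi> \<in> set fs" for \<phi>
    proof -
      obtain j where "j < m" "\<phi> = Cmp (cluster_tube n) P C P (\<iota> j) (\<pi> j) 0" using \<phi> by (auto simp: fs_def)
      then show ?thesis using hom path_kills_orbit_Cmp[OF n P C k] by blast
    qed
    ultimately have "path_kills_roofs n l (F_cpx n 0 P) (Idn (derived_cat n) P)"
      using path_kills_Sum[OF P is_cpx_F[OF n P]] by metis
    then show ?thesis by (rule path_kills_Idn[OF n P])
  qed
  obtain \<iota> \<pi> where "\<iota> \<in> Hom (cluster_tube n) X P" "\<pi> \<in> Hom (cluster_tube n) P X"
    and "Cmp (cluster_tube n) X P X \<pi> \<iota> = Idn (cluster_tube n) X"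
    using XP unfolding is_direct_sum_def by (auto dest!: spec[of _ 0])
  then have "path_kills_roofs n l (F_cpx n 0 X) (Idn (derived_cat n) X)"
    using path_kills_orbit_Cmp[OF n Xc P kP] orbit_Idn_0 by metis
  then show ?thesis by (rule path_kills_Idn[OF n Xc])
qed

section \<open>Nonzero roofs\<close>

lemma Suc_mod_cancel: "n > 0 \<Longrightarrow> Suc x mod n = Suc y mod n \<longleftrightarrow> x mod n = y mod n"
  by (auto simp: mod_Suc split: if_splits)

text \<open>Only finitely many degrees are nonzero, and the sum of their nilpotency lengths bounds
  each of them.\<close>

lemma uniformly_nilpotent:
  assumes X: "is_cpx n X"
  obtains l where "\<And>p i x. i < n \<Longrightarrow> x \<in> cochains X p i \<Longrightarrow>
    path_mat n (ob X p) i l *\<^sub>v x = zero_cochain X p ((i + l) mod n)"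
proof -
  obtain b where b: "\<And>p i. \<bar>p\<bar> > b \<Longrightarrow> i < n \<Longrightarrow> dimv (ob X p) i = 0" using X unfolding is_cpx_def by blast
  have "\<exists>l. \<forall>i<n. path_mat n (ob X p) i l = 0\<^sub>m (dimv (ob X p) ((i + l) mod n)) (dimv (ob X p) i)" for p
    using is_cpx_nilpotent[OF X] by blast
  then obtain L where L: "\<And>p i. i < n \<Longrightarrow> path_mat n (ob X p) i (L p) = 0\<^sub>m (dimv (ob X p) ((i + L p) mod n)) (dimv (ob X p) i)"
    by metis
  define l where "l = (\<Sum>p \<in> {- b..b}. L p)"
  show thesis
  proof (rule that[of l])
    fix p i and x :: "'a vec" assume i: "i < n" and x: "x \<in> cochains X p i"
    have il: "(i + l) mod n < n" using i by simp
    show "path_mat n (ob X p) i l *\<^sub>v x = zero_cochain X p ((i + l) mod n)"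
    proof (cases "\<bar>p\<bar> > b")
      case True
      then show ?thesis
        using path_vec_carrier[OF is_cpx_rep[OF X] i x, of l] b[OF True il] carrier_vec_0_eq zero_carrier_vec by metis
    next
      case False
      then have "L p \<le> l" unfolding l_def by (intro member_le_sum) auto
      then have l: "l = L p + (l - L p)" by simp
      have iL: "(i + L p) mod n < n" using i by simp
      have "path_mat n (ob X p) i (L p + (l - L p)) *\<^sub>v x = zero_cochain X p (((i + L p) mod n + (l - L p)) mod n)"
        unfolding path_mat_add_vec[OF is_cpx_rep[OF X] i x] L[OF i] zero_mat_mult_vec[OF x]
        by (rule mult_mat_zero_vec[OF path_mat_carrier[OF is_cpx_rep[OF X] iL]])
      moreover have "((i + L p) mod n + (l - L p)) mod n = (i + (L p + (l - L p))) mod n"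
        by (simp add: mod_add_left_eq add.assoc)
      ultimately show ?thesis using l by simp
    qed
  qed
qed

text \<open>The vectors \<open>w r\<close> will lie along a path, at varying vertices and in varying
  dimensions. The filter \<open>P\<close> retains those that sit at the current vertex.\<close>

definition lin_comb :: "nat \<Rightarrow> nat \<Rightarrow> (nat \<Rightarrow> bool) \<Rightarrow> (nat \<Rightarrow> 'k::field) \<Rightarrow> (nat \<Rightarrow> 'k vec) \<Rightarrow> 'k vec" where
  "lin_comb d t P c w = vec d (\<lambda>\<alpha>. \<Sum>r<t. if P r then c r * w r $ \<alpha> else 0)"

lemma lin_comb_carrier: "lin_comb d t P c w \<in> carrier_vec d"
  by (simp add: lin_comb_def)

lemma lin_comb_Suc:
  assumes "P t \<Longrightarrow> w t \<in> carrier_vec d"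
  shows "lin_comb d (Suc t) P c w = lin_comb d t P c w + (if P t then c t \<cdot>\<^sub>v w t else 0\<^sub>v d)"
  using assms by (intro eq_vecI) (auto simp: lin_comb_def)

lemma lin_comb_Suc_shift:
  assumes "P 0 \<Longrightarrow> w 0 \<in> carrier_vec d"
  shows "lin_comb d (Suc t) P c w = (if P 0 then c 0 \<cdot>\<^sub>v w 0 else 0\<^sub>v d) + lin_comb d t (\<lambda>r. P (Suc r)) (\<lambda>r. c (Suc r)) (\<lambda>r. w (Suc r))"
  using assms by (intro eq_vecI) (auto simp: lin_comb_def sum.lessThan_Suc_shift simp del: sum.lessThan_Suc)

lemma lin_comb_cong:
  assumes "\<And>r. r < t \<Longrightarrow> P r = P' r" "\<And>r. r < t \<Longrightarrow> P r \<Longrightarrow> c r = c' r" "\<And>r. r < t \<Longrightarrow> P r \<Longrightarrow> w r = w' r"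
  shows "lin_comb d t P c w = lin_comb d t P' c' w'"
  unfolding lin_comb_def using assms by (intro eq_vecI) (auto intro!: sum.cong)

lemma lin_comb_zero: "lin_comb d t P (\<lambda>r. 0) w = 0\<^sub>v d"
  by (intro eq_vecI) (auto simp: lin_comb_def intro!: sum.neutral)

lemma lin_comb_closed:
  assumes "\<And>r. r < t \<Longrightarrow> P r \<Longrightarrow> w r \<in> S" and "S \<subseteq> carrier_vec d" and "0\<^sub>v d \<in> S"
    and "\<And>u v. u \<in> S \<Longrightarrow> v \<in> S \<Longrightarrow> u + v \<in> S" and "\<And>a u. u \<in> S \<Longrightarrow> a \<cdot>\<^sub>v u \<in> S"
  shows "lin_comb d t P c w \<in> S"
  using assms(1)
proof (induction t)
  case 0
  have "lin_comb d 0 P c w = 0\<^sub>v d" by (intro eq_vecI) (auto simp: lin_comb_def)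
  then show ?case using assms(3) by simp
next
  case (Suc t)
  have "lin_comb d (Suc t) P c w = lin_comb d t P c w + (if P t then c t \<cdot>\<^sub>v w t else 0\<^sub>v d)"
    by (rule lin_comb_Suc) (use Suc.prems assms(2) in auto)
  then show ?case using Suc assms by auto
qed

lemma mult_lin_comb:
  assumes A: "A \<in> carrier_mat m d" and w: "\<And>r. r < t \<Longrightarrow> P r \<Longrightarrow> w r \<in> carrier_vec d"
  shows "A *\<^sub>v lin_comb d t P c w = lin_comb m t P c (\<lambda>r. A *\<^sub>v w r)"
  using w
proof (induction t)
  case 0
  have "lin_comb d 0 P c w = 0\<^sub>v d" "lin_comb m 0 P c (\<lambda>r. A *\<^sub>v w r) = 0\<^sub>v m" by (intro eq_vecI; auto simp: lin_comb_def)+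
  then show ?case using mult_mat_zero_vec[OF A] by simp
next
  case (Suc t)
  have 1: "lin_comb d (Suc t) P c w = lin_comb d t P c w + (if P t then c t \<cdot>\<^sub>v w t else 0\<^sub>v d)"
    by (rule lin_comb_Suc) (use Suc.prems in auto)
  have 2: "lin_comb m (Suc t) P c (\<lambda>r. A *\<^sub>v w r) = lin_comb m t P c (\<lambda>r. A *\<^sub>v w r) + (if P t then c t \<cdot>\<^sub>v (A *\<^sub>v w t) else 0\<^sub>v m)"
    by (rule lin_comb_Suc) (use Suc.prems mult_mat_vec_carrier[OF A] in auto)
  have c: "(if P t then c t \<cdot>\<^sub>v w t else 0\<^sub>v d) \<in> carrier_vec d" using Suc.prems by auto
  have "A *\<^sub>v (if P t then c t \<cdot>\<^sub>v w t else 0\<^sub>v d) = (if P t then c t \<cdot>\<^sub>v (A *\<^sub>v w t) else 0\<^sub>v m)"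
    using mult_mat_vec[OF A] Suc.prems mult_mat_zero_vec[OF A] by auto
  then show ?case unfolding 1 2 mult_add_distrib_mat_vec[OF A lin_comb_carrier c] using Suc by simp
qed

text \<open>The roof realizes $y \mapsto \sum_{r \le k} \varphi(\alpha^{k-r} y)\,\alpha^r x$, where $\alpha^s$
  is the path of length $s$ and $\varphi$ is a linear form on $C^p$ that vanishes on coboundaries. On
  cohomology the sum telescopes to a homomorphism because $\alpha^{k+1}$ acts as zero. The cocycle
  \<open>z1\<close> is chosen such that only the summand $r = k$ contributes to its image.\<close>

lemma nonzero_roof:
  fixes C Y :: "'k::field cpx"
  assumes n: "n > 0" and C: "is_cpx n C" and Y: "is_cpx n Y" and i0: "i0 < n"
    and x: "x \<in> cocycles Y p i0"
    and xk: "path_mat n (ob Y p) i0 k *\<^sub>v x \<notin> coboundaries Y p ((i0 + k) mod n)"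
    and xk1: "path_mat n (ob Y p) i0 (Suc k) *\<^sub>v x \<in> coboundaries Y p ((i0 + Suc k) mod n)"
    and kill: "\<And>i y. i < n \<Longrightarrow> y \<in> cocycles C p i \<Longrightarrow> path_mat n (ob C p) i (Suc k) *\<^sub>v y \<in> coboundaries C p ((i + Suc k) mod n)"
    and H: "\<not> cocycles C p ((i0 + k) mod n) \<subseteq> coboundaries C p ((i0 + k) mod n)"
  obtains T \<pi> h z where "(T, \<pi>, h) \<in> roofs n C Y" "z \<in> cocycles T p ((i0 + k) mod n)"
    "h p ((i0 + k) mod n) *\<^sub>v z \<notin> coboundaries Y p ((i0 + k) mod n)"
proof -
  define v where "v = (i0 + k) mod n"
  have v: "v < n" using n by (simp add: v_def)
  obtain z0 where z0: "z0 \<in> cocycles C p v" "z0 \<notin> coboundaries C p v" using H by (auto simp: v_def)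
  note D = df_carrier'[OF C v, of p]
  obtain G where G: "G \<in> graded_maps C p v C (p - 1) v"
    "\<And>x. x \<in> cochains C (p - 1) v \<Longrightarrow> df C (p - 1) v *\<^sub>v (G *\<^sub>v (df C (p - 1) v *\<^sub>v x)) = df C (p - 1) v *\<^sub>v x"
    using gen_inverse_vec[OF D] by blast
  \<comment> \<open>The kernel of \<open>R\<close> consists of the coboundaries. Hence some
    coordinate of \<open>R z0\<close> is nonzero, and that coordinate of \<open>R\<close> is a
    linear form \<phi> that vanishes on coboundaries but not at \<open>z0\<close>.\<close>
  define R where "R = 1\<^sub>m (dimv (ob C p) v) - df C (p - 1) v * G"
  have R: "R \<in> graded_maps C p v C p v"
    unfolding R_def using mult_carrier_mat[OF D G(1)] by (rule minus_carrier_mat)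
  have R_vec: "R *\<^sub>v y = y - df C (p - 1) v *\<^sub>v (G *\<^sub>v y)" if y: "y \<in> cochains C p v" for y
    unfolding R_def minus_mult_distrib_mat_vec[OF one_carrier_mat mult_carrier_mat[OF D G(1)] y]
      assoc_mult_mat_vec[OF D G(1) y] using y by simp
  have RB: "R *\<^sub>v y = zero_cochain C p v" if y: "y \<in> coboundaries C p v" for y
  proof -
    obtain u where u: "u \<in> cochains C (p - 1) v" "y = df C (p - 1) v *\<^sub>v u" using y by (rule coboundariesE)
    note du = mult_mat_vec_carrier[OF D u(1)]
    show ?thesis using R_vec[OF du] G(2)[OF u(1)] du u(2) by simp
  qed
  have "R *\<^sub>v z0 \<noteq> zero_cochain C p v"
  proof
    note zc = cocyclesD(1)[OF z0(1)]
    note gz = mult_mat_vec_carrier[OF G(1) zc]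
    note dgz = mult_mat_vec_carrier[OF D gz]
    assume "R *\<^sub>v z0 = zero_cochain C p v"
    then have "z0 = df C (p - 1) v *\<^sub>v (G *\<^sub>v z0)"
      using add_diff_vec[OF dgz zc] R_vec[OF zc] dgz by simp
    then show False using z0(2) coboundariesI[OF gz] by blast
  qed
  moreover have "dim_vec (R *\<^sub>v z0) = dimv (ob C p) v" using R by simp
  ultimately obtain r0 where r0: "r0 < dimv (ob C p) v" "(R *\<^sub>v z0) $ r0 \<noteq> 0"
    by (metis eq_vecI index_zero_vec)
  define \<phi> where "\<phi> y = (R *\<^sub>v y) $ r0" for y
  have \<phi>B: "\<phi> y = 0" if "y \<in> coboundaries C p v" for y
    using RB[OF that] r0(1) by (simp add: \<phi>_def)
  obtain l0 where l0: "\<And>p i x. i < n \<Longrightarrow> x \<in> cochains C p i \<Longrightarrow>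
    path_mat n (ob C p) i l0 *\<^sub>v x = zero_cochain C p ((i + l0) mod n)"
    using uniformly_nilpotent[OF C] by blast
  have vs: "(v + s * n) mod n = v" for s using v by simp
  \<comment> \<open>Summands with \<open>r < k\<close> at the vertex \<open>v\<close> evaluate
    \<phi> after \<open>t > 0\<close> full turns. To silence them, \<open>s\<close> is the largest
    number of turns after which \<phi> is still nonzero on some cocycle, and \<open>z1\<close> is
    that cocycle moved by \<open>s\<close> turns.\<close>
  obtain z1 where z1: "z1 \<in> cocycles C p v" "\<phi> z1 \<noteq> 0" "\<And>t. t > 0 \<Longrightarrow> \<phi> (path_mat n (ob C p) v (t * n) *\<^sub>v z1) = 0"
  proof -
    define S where "S s \<longleftrightarrow> (\<exists>z \<in> cocycles C p v. \<phi> (path_mat n (ob C p) v (s * n) *\<^sub>v z) \<noteq> 0)" for s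
    have S0: "S 0" unfolding S_def using z0(1) r0(2) cocyclesD(1)[OF z0(1)] by (intro bexI[of _ z0]) (simp_all add: \<phi>_def)
    have Sn: "\<not> S s" if "s \<ge> l0" for s
      unfolding S_def
    proof clarify
      fix z assume z: "z \<in> cocycles C p v" and "\<phi> (path_mat n (ob C p) v (s * n) *\<^sub>v z) \<noteq> 0"
      note zc = cocyclesD(1)[OF z]
      have "l0 \<le> s * n" using that n by (simp add: le_trans)
      then have sn: "s * n = l0 + (s * n - l0)" by simp
      have j: "(v + l0) mod n < n" using n by simp
      have "path_mat n (ob C p) v (l0 + (s * n - l0)) *\<^sub>v z = zero_cochain C p (((v + l0) mod n + (s * n - l0)) mod n)"
        unfolding path_mat_add_vec[OF is_cpx_rep[OF C] v zc] l0[OF v zc]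
        by (rule mult_mat_zero_vec[OF path_mat_carrier[OF is_cpx_rep[OF C] j]])
      also have "((v + l0) mod n + (s * n - l0)) mod n = v"
        using vs[of s] sn mod_add_left_eq[of "v + l0" n "s * n - l0"] by (metis add.assoc)
      finally have "path_mat n (ob C p) v (s * n) *\<^sub>v z = zero_cochain C p v" using sn by simp
      then have "\<phi> (path_mat n (ob C p) v (s * n) *\<^sub>v z) = 0" using \<phi>B coboundaries_zero[OF C v] by simp
      then show False using \<open>\<phi> _ \<noteq> 0\<close> by simp
    qed
    define s where "s = Max {s. S s}"
    have "{s. S s} \<subseteq> {..l0}" using Sn by (auto intro: ccontr simp: not_le)
    then have fin: "finite {s. S s}" by (rule finite_subset) simp
    have Ss: "S s" using Max_in[OF fin] S0 by (auto simp: s_def)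
    have Sg: "\<not> S t" if "t > s" for t using Max_ge[OF fin, of t] that by (auto simp: s_def)
    obtain z where z: "z \<in> cocycles C p v" "\<phi> (path_mat n (ob C p) v (s * n) *\<^sub>v z) \<noteq> 0" using Ss by (auto simp: S_def)
    show thesis
    proof (rule that)
      show "path_mat n (ob C p) v (s * n) *\<^sub>v z \<in> cocycles C p v"
        using path_cocycles[OF C v z(1), of "s * n"] vs by simp
      show "\<phi> (path_mat n (ob C p) v (s * n) *\<^sub>v z) \<noteq> 0" by (rule z(2))
      fix t :: nat assume t: "t > 0"
      have "path_mat n (ob C p) v (t * n) *\<^sub>v (path_mat n (ob C p) v (s * n) *\<^sub>v z) = path_mat n (ob C p) v ((s + t) * n) *\<^sub>v z"
        using path_mat_add_vec[OF is_cpx_rep[OF C] v cocyclesD(1)[OF z(1)], of "s * n" "t * n"] vs[of s]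
        by (simp add: add_mult_distrib)
      then show "\<phi> (path_mat n (ob C p) v (t * n) *\<^sub>v (path_mat n (ob C p) v (s * n) *\<^sub>v z)) = 0"
        using Sg[of "s + t"] t z(1) by (auto simp: S_def)
    qed
  qed
  define w where "w r = path_mat n (ob Y p) i0 r *\<^sub>v x" for r
  note xc = cocyclesD(1)[OF x]
  have w: "w r \<in> cocycles Y p ((i0 + r) mod n)" for r
    unfolding w_def by (rule path_cocycles[OF Y i0 x])
  have w_Suc: "w (Suc r) = arr (ob Y p) ((i0 + r) mod n) *\<^sub>v w r" for r
    unfolding w_def by (rule path_mat_Suc_vec[OF is_cpx_rep[OF Y] i0 xc])
  \<comment> \<open>Row \<open>r0\<close> of \<open>R\<close> times a path matrix is the linear form
    \<phi> after that path, so each summand is a column \<open>w r\<close> times a linear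
    form.\<close>
  define h where "h i = mat (dimv (ob Y p) i) (dimv (ob C p) i) (\<lambda>(\<alpha>, \<beta>). \<Sum>r<Suc k.
    if (i0 + r) mod n = i then row (R * path_mat n (ob C p) i (k - r)) r0 $ \<beta> * w r $ \<alpha> else 0)" for i
  have hc: "h i \<in> graded_maps C p i Y p i" for i by (simp add: h_def)
  \<comment> \<open>If \<open>w r\<close> sits at the vertex \<open>i\<close>, the path of
    complementary length \<open>k - r\<close> from \<open>i\<close> ends at \<open>v\<close>, where
    \<phi> is defined.\<close>
  have tgt: "(i + (k - r)) mod n = v" if "(i0 + r) mod n = i" "r < Suc k" for r i
  proof -
    have "(i + (k - r)) mod n = (i0 + r + (k - r)) mod n" using that(1) by (metis mod_add_left_eq)
    then show ?thesis using that(2) by (simp add: v_def)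
  qed
  have h_vec: "h i *\<^sub>v y = lin_comb (dimv (ob Y p) i) (Suc k) (\<lambda>r. (i0 + r) mod n = i) (\<lambda>r. \<phi> (path_mat n (ob C p) i (k - r) *\<^sub>v y)) w"
    if i: "i < n" and y: "y \<in> cochains C p i" for i y
  proof (rule eq_vecI)
    fix \<alpha> assume "\<alpha> < dim_vec (lin_comb (dimv (ob Y p) i) (Suc k) (\<lambda>r. (i0 + r) mod n = i) (\<lambda>r. \<phi> (path_mat n (ob C p) i (k - r) *\<^sub>v y)) w)"
    then have \<alpha>: "\<alpha> < dimv (ob Y p) i" by (simp add: lin_comb_def)
    have row: "(\<Sum>\<beta> = 0..<dimv (ob C p) i. row (R * path_mat n (ob C p) i (k - r)) r0 $ \<beta> * y $ \<beta>) = \<phi> (path_mat n (ob C p) i (k - r) *\<^sub>v y)"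
      if r: "(i0 + r) mod n = i" "r < Suc k" for r
    proof -
      have P: "path_mat n (ob C p) i (k - r) \<in> graded_maps C p i C p v"
        using path_mat_carrier[OF is_cpx_rep[OF C] i] tgt[OF r] by metis
      have "\<phi> (path_mat n (ob C p) i (k - r) *\<^sub>v y) = ((R * path_mat n (ob C p) i (k - r)) *\<^sub>v y) $ r0"
        unfolding \<phi>_def assoc_mult_mat_vec[OF R P y] ..
      also have "\<dots> = row (R * path_mat n (ob C p) i (k - r)) r0 \<bullet> y"
        using R P r0(1) by (intro index_mult_mat_vec) simp
      finally show ?thesis using y by (simp add: scalar_prod_def)
    qed
    have "(h i *\<^sub>v y) $ \<alpha> = (\<Sum>\<beta> = 0..<dimv (ob C p) i. (\<Sum>r<Suc k.
      if (i0 + r) mod n = i then row (R * path_mat n (ob C p) i (k - r)) r0 $ \<beta> * w r $ \<alpha> else 0) * y $ \<beta>)"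
      using \<alpha> y by (simp add: h_def scalar_prod_def del: sum.lessThan_Suc)
    also have "\<dots> = (\<Sum>\<beta> = 0..<dimv (ob C p) i. \<Sum>r<Suc k.
      (if (i0 + r) mod n = i then row (R * path_mat n (ob C p) i (k - r)) r0 $ \<beta> * w r $ \<alpha> else 0) * y $ \<beta>)"
      by (simp add: sum_distrib_right del: sum.lessThan_Suc)
    also have "\<dots> = (\<Sum>r<Suc k. \<Sum>\<beta> = 0..<dimv (ob C p) i.
      (if (i0 + r) mod n = i then row (R * path_mat n (ob C p) i (k - r)) r0 $ \<beta> * w r $ \<alpha> else 0) * y $ \<beta>)"
      by (rule sum.swap)
    also have "\<dots> = (\<Sum>r<Suc k. if (i0 + r) mod n = i then \<phi> (path_mat n (ob C p) i (k - r) *\<^sub>v y) * w r $ \<alpha> else 0)"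
    proof (rule sum.cong[OF refl])
      fix r assume "r \<in> {..<Suc k}"
      then have r: "r < Suc k" by simp
      show "(\<Sum>\<beta> = 0..<dimv (ob C p) i. (if (i0 + r) mod n = i then row (R * path_mat n (ob C p) i (k - r)) r0 $ \<beta> * w r $ \<alpha> else 0) * y $ \<beta>)
        = (if (i0 + r) mod n = i then \<phi> (path_mat n (ob C p) i (k - r) *\<^sub>v y) * w r $ \<alpha> else 0)"
      proof (cases "(i0 + r) mod n = i")
        case True
        show ?thesis unfolding row[OF True r, symmetric] using True by (simp add: sum_distrib_left sum_distrib_right mult_ac)
      qed simp
    qed
    finally show "(h i *\<^sub>v y) $ \<alpha> = lin_comb (dimv (ob Y p) i) (Suc k) (\<lambda>r. (i0 + r) mod n = i) (\<lambda>r. \<phi> (path_mat n (ob C p) i (k - r) *\<^sub>v y)) w $ \<alpha>"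
      unfolding lin_comb_def using \<alpha> by simp
  qed (simp add: h_def lin_comb_def)
  have h_cocycle: "h i *\<^sub>v y \<in> cocycles Y p i" if i: "i < n" and y: "y \<in> cochains C p i" for i y
    unfolding h_vec[OF i y]
  proof (rule lin_comb_closed)
    show "w r \<in> cocycles Y p i" if "(i0 + r) mod n = i" for r using w[of r] that by simp
    show "cocycles Y p i \<subseteq> cochains Y p i" by (auto dest: cocyclesD)
    show "zero_cochain Y p i \<in> cocycles Y p i" by (rule cocycles_zero[OF Y i])
    show "a \<cdot>\<^sub>v u \<in> cocycles Y p i" if "u \<in> cocycles Y p i" for a u
      using that mult_mat_vec[OF is_cpx_df[OF Y i]] by (auto simp: cocycles_def)
  qed (rule cocycles_add[OF Y i])
  \<comment> \<open>With \<open>h_cocycle\<close> this gives \<open>d h = 0\<close> and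
    \<open>h d = 0\<close>, so \<open>h\<close>, extended by zero to the other degrees, commutes
    with differentials. What remains is its failure to commute with arrows.\<close>
  have h_df: "h i *\<^sub>v y = zero_cochain Y p i" if i: "i < n" and y: "y \<in> coboundaries C p i" for i y
  proof -
    note yc = coboundaries_carrier[OF C i y]
    have "\<phi> (path_mat n (ob C p) i (k - r) *\<^sub>v y) = 0" if "r < Suc k" "(i0 + r) mod n = i" for r
      using path_coboundaries[OF C i y, of "k - r"] tgt[OF that(2,1)] \<phi>B by simp
    then have "h i *\<^sub>v y = lin_comb (dimv (ob Y p) i) (Suc k) (\<lambda>r. (i0 + r) mod n = i) (\<lambda>r. 0) w"
      unfolding h_vec[OF i yc] by (intro lin_comb_cong) auto
    also have "\<dots> = zero_cochain Y p i" by (rule lin_comb_zero)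
    finally show ?thesis .
  qed
  have h_arr: "h (Suc i mod n) *\<^sub>v (arr (ob C p) i *\<^sub>v y) - arr (ob Y p) i *\<^sub>v (h i *\<^sub>v y) \<in> coboundaries Y p (Suc i mod n)"
    if i: "i < n" and y: "y \<in> cocycles C p i" for i y
  proof -
    note yc = cocyclesD(1)[OF y]
    let ?i = "Suc i mod n" and ?d = "dimv (ob Y p) (Suc i mod n)"
    have i': "?i < n" using n by simp
    \<comment> \<open>Both composites are sums of \<open>c r\<close> times \<open>w r\<close>, one
      over \<open>r = 0..k\<close>, the other over \<open>r = 1..k+1\<close>, so only the ends
      matter. The coefficient \<open>c 0\<close> vanishes by \<open>kill\<close>, since \<phi> kills
      coboundaries, and \<open>w (Suc k)\<close> is a coboundary by \<open>xk1\<close>.\<close>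
    define c where "c r = \<phi> (path_mat n (ob C p) i (Suc k - r) *\<^sub>v y)" for r
    define P where "P r \<longleftrightarrow> (i0 + r) mod n = ?i" for r
    have PSuc: "P (Suc r) \<longleftrightarrow> (i0 + r) mod n = i" for r
      using Suc_mod_cancel[OF n, of "i0 + r" i] i by (simp add: P_def)
    have wP: "P r \<Longrightarrow> w r \<in> carrier_vec ?d" for r using cocyclesD(1)[OF w[of r]] by (simp add: P_def)
    have 1: "h ?i *\<^sub>v (arr (ob C p) i *\<^sub>v y) = lin_comb ?d (Suc k) P c w"
      unfolding h_vec[OF i' is_cpx_arr_vec[OF C i yc]]
      by (rule lin_comb_cong) (simp_all add: P_def c_def Suc_diff_le path_mat_Suc_vec'[OF is_cpx_rep[OF C] i yc] del: path_mat.simps)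
    have "arr (ob Y p) i *\<^sub>v (h i *\<^sub>v y) = lin_comb ?d (Suc k) (\<lambda>r. (i0 + r) mod n = i)
      (\<lambda>r. \<phi> (path_mat n (ob C p) i (k - r) *\<^sub>v y)) (\<lambda>r. arr (ob Y p) i *\<^sub>v w r)"
      unfolding h_vec[OF i yc] by (rule mult_lin_comb[OF is_cpx_arr[OF Y i]]) (use cocyclesD(1)[OF w] in auto)
    also have "\<dots> = lin_comb ?d (Suc k) (\<lambda>r. P (Suc r)) (\<lambda>r. c (Suc r)) (\<lambda>r. w (Suc r))"
      by (rule lin_comb_cong) (auto simp: PSuc c_def w_Suc)
    finally have 2: "arr (ob Y p) i *\<^sub>v (h i *\<^sub>v y) = lin_comb ?d (Suc k) (\<lambda>r. P (Suc r)) (\<lambda>r. c (Suc r)) (\<lambda>r. w (Suc r))" .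
    define u where "u = (if P (Suc k) then c (Suc k) \<cdot>\<^sub>v w (Suc k) else 0\<^sub>v ?d)"
    have u: "u \<in> coboundaries Y p ?i"
      using coboundaries_smult[OF Y i' , of "w (Suc k)" p "c (Suc k)"] xk1 coboundaries_zero[OF Y i', of p]
      by (auto simp: u_def P_def w_def)
    have "P 0 \<Longrightarrow> c 0 = 0"
    proof -
      assume "P 0"
      then have "(i + Suc k) mod n = v" using i0 by (simp add: P_def v_def) (metis add_Suc mod_add_left_eq)
      then show "c 0 = 0" using kill[OF i y] \<phi>B by (simp add: c_def del: path_mat.simps)
    qed
    then have 0: "(if P 0 then c 0 \<cdot>\<^sub>v w 0 else 0\<^sub>v ?d) = 0\<^sub>v ?d"
      using wP[of 0] by (auto intro!: eq_vecI)
    have "lin_comb ?d (Suc k) P c w + u = lin_comb ?d (Suc k) (\<lambda>r. P (Suc r)) (\<lambda>r. c (Suc r)) (\<lambda>r. w (Suc r))"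
      using lin_comb_Suc[of P "Suc k" w ?d c, OF wP] lin_comb_Suc_shift[of P w ?d "Suc k" c, OF wP]
      unfolding 0 left_zero_vec[OF lin_comb_carrier] u_def by simp
    then have "lin_comb ?d (Suc k) P c w - lin_comb ?d (Suc k) (\<lambda>r. P (Suc r)) (\<lambda>r. c (Suc r)) (\<lambda>r. w (Suc r))
      = lin_comb ?d (Suc k) P c w - (lin_comb ?d (Suc k) P c w + u)" by simp
    also have "\<dots> = 0\<^sub>v ?d - u"
      using carrier_vecD[OF lin_comb_carrier[of ?d "Suc k" P c w]] carrier_vecD[OF coboundaries_carrier[OF Y i' u]]
      by (intro eq_vecI) simp_all
    also have "\<dots> \<in> coboundaries Y p ?i" by (rule coboundaries_minus[OF Y i' coboundaries_zero[OF Y i'] u])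
    finally show ?thesis unfolding 1 2 .
  qed
  \<comment> \<open>The choice of \<open>z1\<close> leaves \<open>\<phi> z1\<close> times
    \<open>w k\<close>, and \<open>w k\<close> is not a coboundary by \<open>xk\<close>.\<close>
  have hz1: "h v *\<^sub>v z1 \<notin> coboundaries Y p v"
  proof
    assume a: "h v *\<^sub>v z1 \<in> coboundaries Y p v"
    have c0: "\<phi> (path_mat n (ob C p) v (k - r) *\<^sub>v z1) = 0" if r: "r < k" "(i0 + r) mod n = v" for r
    proof -
      have "(i0 + k) mod n = (i0 + r) mod n" using r(2) by (simp add: v_def)
      then have "n dvd (i0 + k) - (i0 + r)" using r(1) mod_eq_dvd_iff_nat[of "i0 + r" "i0 + k" n] by simp
      then have "n dvd k - r" by simp
      then obtain t where t: "k - r = t * n" by (metis dvd_def mult.commute)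
      then have "t > 0" using r(1) by (cases t) auto
      then show ?thesis using z1(3)[of t] t by simp
    qed
    have wk: "w k \<in> cochains Y p v" using cocyclesD(1)[OF w[of k]] by (simp add: v_def)
    have "h v *\<^sub>v z1 = lin_comb (dimv (ob Y p) v) k (\<lambda>r. (i0 + r) mod n = v) (\<lambda>r. \<phi> (path_mat n (ob C p) v (k - r) *\<^sub>v z1)) w
      + \<phi> (path_mat n (ob C p) v 0 *\<^sub>v z1) \<cdot>\<^sub>v w k"
      unfolding h_vec[OF v cocyclesD(1)[OF z1(1)]]
      using lin_comb_Suc[of "\<lambda>r. (i0 + r) mod n = v" k w "dimv (ob Y p) v" "\<lambda>r. \<phi> (path_mat n (ob C p) v (k - r) *\<^sub>v z1)", OF wk]
      by (simp only: v_def[symmetric] diff_self_eq_0 simp_thms if_True)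
    also have "lin_comb (dimv (ob Y p) v) k (\<lambda>r. (i0 + r) mod n = v) (\<lambda>r. \<phi> (path_mat n (ob C p) v (k - r) *\<^sub>v z1)) w
      = lin_comb (dimv (ob Y p) v) k (\<lambda>r. (i0 + r) mod n = v) (\<lambda>r. 0) w"
      by (rule lin_comb_cong) (use c0 in auto)
    also have "\<dots> = zero_cochain Y p v" by (rule lin_comb_zero)
    also have "path_mat n (ob C p) v 0 *\<^sub>v z1 = z1" by (rule path_mat_0_vec[OF cocyclesD(1)[OF z1(1)]])
    finally have "h v *\<^sub>v z1 = \<phi> z1 \<cdot>\<^sub>v w k" using cocyclesD(1)[OF w[of k]] by (simp add: v_def)
    then have "inverse (\<phi> z1) \<cdot>\<^sub>v (\<phi> z1 \<cdot>\<^sub>v w k) \<in> coboundaries Y p v"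
      using coboundaries_smult[OF Y v a] by simp
    then have "w k \<in> coboundaries Y p v" using z1(2) by (simp add: smult_smult_assoc)
    then show False using xk by (simp add: w_def v_def)
  qed
  \<comment> \<open>The defect of \<open>h\<close> on arrows is split as \<open>d e1 + e2 d\<close>.
    The two further conditions, \<open>e1\<close> zero on coboundaries and \<open>d e2 = 0\<close>,
    are what the identity required by \<open>realize\<close> says in degrees \<open>p - 1\<close>
    and \<open>p + 1\<close>, where \<open>h\<close> is extended by zero.\<close>
  define Q where "Q i e1 e2 \<longleftrightarrow> e1 \<in> graded_maps C p i Y (p - 1) (Suc i mod n) \<and>
      e2 \<in> graded_maps C (p + 1) i Y p (Suc i mod n) \<and>
      (\<forall>y \<in> cochains C p i.
        h (Suc i mod n) *\<^sub>v (arr (ob C p) i *\<^sub>v y) - arr (ob Y p) i *\<^sub>v (h i *\<^sub>v y)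
          = df Y (p - 1) (Suc i mod n) *\<^sub>v (e1 *\<^sub>v y) + e2 *\<^sub>v (df C p i *\<^sub>v y)) \<and>
      (\<forall>y \<in> coboundaries C p i. e1 *\<^sub>v y = zero_cochain Y (p - 1) (Suc i mod n)) \<and>
      (\<forall>y \<in> cochains C (p + 1) i. df Y p (Suc i mod n) *\<^sub>v (e2 *\<^sub>v y) = zero_cochain Y (p + 1) (Suc i mod n))"
    for i e1 e2
  have Q_ex: "\<exists>e. Q i (fst e) (snd e)"
    if i: "i < n" for i
  proof -
    let ?i = "Suc i mod n"
    have i': "?i < n" using n by simp
    define \<alpha> where "\<alpha> = h ?i * arr (ob C p) i - arr (ob Y p) i * h i"
    note a = is_cpx_arr[OF C i, of p] and b = is_cpx_arr[OF Y i, of p]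
    have \<alpha>: "\<alpha> \<in> carrier_mat (dimv (ob Y p) ?i) (dimv (ob C p) i)"
      unfolding \<alpha>_def using mult_carrier_mat[OF b hc] by (rule minus_carrier_mat)
    have \<alpha>_vec: "\<alpha> *\<^sub>v y = h ?i *\<^sub>v (arr (ob C p) i *\<^sub>v y) - arr (ob Y p) i *\<^sub>v (h i *\<^sub>v y)"
      if y: "y \<in> cochains C p i" for y
      unfolding \<alpha>_def minus_mult_distrib_mat_vec[OF mult_carrier_mat[OF hc a] mult_carrier_mat[OF b hc] y]
        assoc_mult_mat_vec[OF hc a y] assoc_mult_mat_vec[OF b hc y] ..
    have \<alpha>_cocycle: "\<alpha> *\<^sub>v y \<in> cocycles Y p ?i" if y: "y \<in> cochains C p i" for y
      unfolding \<alpha>_vec[OF y]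
      by (rule cocycles_minus[OF Y i' h_cocycle[OF i' is_cpx_arr_vec[OF C i y]] arr_cocycles[OF Y i h_cocycle[OF i y]]])
    have \<alpha>B: "\<alpha> *\<^sub>v y = 0\<^sub>v (dimv (ob Y p) ?i)" if y: "y \<in> coboundaries C p i" for y
    proof -
      have "path_mat n (ob C p) i 1 *\<^sub>v y \<in> coboundaries C p ((i + 1) mod n)" by (rule path_coboundaries[OF C i y])
      then have "arr (ob C p) i *\<^sub>v y \<in> coboundaries C p ?i"
        using path_mat_Suc_vec[OF is_cpx_rep[OF C] i coboundaries_carrier[OF C i y], of 0]
          path_mat_0_vec[OF coboundaries_carrier[OF C i y]] i by (simp del: path_mat.simps)
      then show ?thesis
        unfolding \<alpha>_vec[OF coboundaries_carrier[OF C i y]] h_df[OF i y] mult_mat_zero_vec[OF b]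
        using h_df[OF i'] by simp
    qed
    note D2 = is_cpx_df[OF C i, of p] and D1 = df_carrier'[OF Y i', of p]
    obtain G2 where G2: "G2 \<in> graded_maps C (p + 1) i C p i"
      "\<And>x. x \<in> cochains C p i \<Longrightarrow> df C p i *\<^sub>v (G2 *\<^sub>v (df C p i *\<^sub>v x)) = df C p i *\<^sub>v x"
      using gen_inverse_vec[OF D2] by blast
    obtain G1 where G1: "G1 \<in> carrier_mat (dimv (ob Y (p - 1)) ?i) (dimv (ob Y p) ?i)"
      "\<And>x. x \<in> carrier_vec (dimv (ob Y (p - 1)) ?i) \<Longrightarrow> df Y (p - 1) ?i *\<^sub>v (G1 *\<^sub>v (df Y (p - 1) ?i *\<^sub>v x)) = df Y (p - 1) ?i *\<^sub>v x"
      using gen_inverse_vec[OF D1] by blast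
    \<comment> \<open>\<open>e2\<close> takes the defect \<alpha> at the chosen preimage
      \<open>G2 (d y)\<close>. What remains is \<alpha> at \<open>y - G2 (d y)\<close>, a cocycle;
      by \<open>h_arr\<close> its value is a coboundary, which \<open>G1\<close> lifts
      linearly.\<close>
    define e2 where "e2 = \<alpha> * G2"
    define e1 where "e1 = G1 * (\<alpha> - e2 * df C p i)"
    have e2: "e2 \<in> carrier_mat (dimv (ob Y p) ?i) (dimv (ob C (p + 1)) i)"
      unfolding e2_def using \<alpha> G2(1) by (rule mult_carrier_mat)
    have \<beta>: "\<alpha> - e2 * df C p i \<in> carrier_mat (dimv (ob Y p) ?i) (dimv (ob C p) i)"
      using mult_carrier_mat[OF e2 D2] by (rule minus_carrier_mat)
    have e1: "e1 \<in> carrier_mat (dimv (ob Y (p - 1)) ?i) (dimv (ob C p) i)"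
      unfolding e1_def using G1(1) \<beta> by (rule mult_carrier_mat)
    have e2_vec: "e2 *\<^sub>v y = \<alpha> *\<^sub>v (G2 *\<^sub>v y)" if "y \<in> cochains C (p + 1) i" for y
      unfolding e2_def by (rule assoc_mult_mat_vec[OF \<alpha> G2(1) that])
    have e1_vec: "e1 *\<^sub>v y = G1 *\<^sub>v (\<alpha> *\<^sub>v y - e2 *\<^sub>v (df C p i *\<^sub>v y))" if y: "y \<in> cochains C p i" for y
      unfolding e1_def assoc_mult_mat_vec[OF G1(1) \<beta> y] minus_mult_distrib_mat_vec[OF \<alpha> mult_carrier_mat[OF e2 D2] y]
        assoc_mult_mat_vec[OF e2 D2 y] ..
    have "Q i e1 e2"
      unfolding Q_def
    proof (intro conjI ballI)
      show "e1 \<in> carrier_mat (dimv (ob Y (p - 1)) ?i) (dimv (ob C p) i)" by (rule e1)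
      show "e2 \<in> carrier_mat (dimv (ob Y p) ?i) (dimv (ob C (p + 1)) i)" by (rule e2)
    next
      fix y :: "'k vec" assume y: "y \<in> cochains C p i"
      note dy = is_cpx_df_vec[OF C i y]
      note gdy = mult_mat_vec_carrier[OF G2(1) dy]
      have \<alpha>y: "\<alpha> *\<^sub>v y \<in> carrier_vec (dimv (ob Y p) ?i)" using \<alpha> y by (rule mult_mat_vec_carrier)
      have edy: "e2 *\<^sub>v (df C p i *\<^sub>v y) \<in> carrier_vec (dimv (ob Y p) ?i)" using e2 dy by (rule mult_mat_vec_carrier)
      have cy: "y - G2 *\<^sub>v (df C p i *\<^sub>v y) \<in> cocycles C p i"
        using mult_minus_distrib_mat_vec[OF D2 y gdy] G2(2)[OF y] y gdy dy by (simp add: cocycles_def)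
      have "\<alpha> *\<^sub>v (y - G2 *\<^sub>v (df C p i *\<^sub>v y)) = \<alpha> *\<^sub>v y - e2 *\<^sub>v (df C p i *\<^sub>v y)"
        unfolding e2_vec[OF dy] by (rule mult_minus_distrib_mat_vec[OF \<alpha> y gdy])
      moreover have "\<alpha> *\<^sub>v (y - G2 *\<^sub>v (df C p i *\<^sub>v y)) \<in> coboundaries Y p ?i"
        using h_arr[OF i cy] \<alpha>_vec[OF cocyclesD(1)[OF cy]] by simp
      ultimately have "\<alpha> *\<^sub>v y - e2 *\<^sub>v (df C p i *\<^sub>v y) \<in> coboundaries Y p ?i" by simp
      then obtain u where u: "u \<in> carrier_vec (dimv (ob Y (p - 1)) ?i)"
        "\<alpha> *\<^sub>v y - e2 *\<^sub>v (df C p i *\<^sub>v y) = df Y (p - 1) ?i *\<^sub>v u" by (rule coboundariesE)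
      have "df Y (p - 1) ?i *\<^sub>v (e1 *\<^sub>v y) = \<alpha> *\<^sub>v y - e2 *\<^sub>v (df C p i *\<^sub>v y)"
        unfolding e1_vec[OF y] u(2) by (rule G1(2)[OF u(1)])
      then show "h ?i *\<^sub>v (arr (ob C p) i *\<^sub>v y) - arr (ob Y p) i *\<^sub>v (h i *\<^sub>v y)
          = df Y (p - 1) ?i *\<^sub>v (e1 *\<^sub>v y) + e2 *\<^sub>v (df C p i *\<^sub>v y)"
        unfolding \<alpha>_vec[OF y, symmetric]
        using add_diff_vec[OF edy \<alpha>y] comm_add_vec[OF edy minus_carrier_vec[OF \<alpha>y edy]] by simp
    next
      fix y assume y: "y \<in> coboundaries C p i"
      have dy: "df C p i *\<^sub>v y = zero_cochain C (p + 1) i" by (rule cocyclesD(2)[OF coboundaries_cocycles[OF C i y]])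
      show "e1 *\<^sub>v y = 0\<^sub>v (dimv (ob Y (p - 1)) ?i)"
        unfolding e1_vec[OF coboundaries_carrier[OF C i y]] dy \<alpha>B[OF y] mult_mat_zero_vec[OF e2]
        using mult_mat_zero_vec[OF G1(1)] by simp
    next
      fix y :: "'k vec" assume y: "y \<in> cochains C (p + 1) i"
      show "df Y p ?i *\<^sub>v (e2 *\<^sub>v y) = 0\<^sub>v (dimv (ob Y (p + 1)) ?i)"
        unfolding e2_vec[OF y] by (rule cocyclesD(2)[OF \<alpha>_cocycle[OF mult_mat_vec_carrier[OF G2(1) y]]])
    qed
    then show ?thesis by (metis fst_conv snd_conv)
  qed
  define e1 where "e1 i = fst (SOME e. Q i (fst e) (snd e))" for i
  define e2 where "e2 i = snd (SOME e. Q i (fst e) (snd e))" for i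
  have Q: "Q i (e1 i) (e2 i)" if "i < n" for i
    unfolding e1_def e2_def using Q_ex[OF that] by (rule someI_ex)
  have e1: "\<And>i. i < n \<Longrightarrow> e1 i \<in> graded_maps C p i Y (p - 1) (Suc i mod n)"
    and e2: "\<And>i. i < n \<Longrightarrow> e2 i \<in> graded_maps C (p + 1) i Y p (Suc i mod n)"
    and he: "\<And>i y. i < n \<Longrightarrow> y \<in> cochains C p i \<Longrightarrow>
        h (Suc i mod n) *\<^sub>v (arr (ob C p) i *\<^sub>v y) - arr (ob Y p) i *\<^sub>v (h i *\<^sub>v y)
          = df Y (p - 1) (Suc i mod n) *\<^sub>v (e1 i *\<^sub>v y) + e2 i *\<^sub>v (df C p i *\<^sub>v y)"
    and e1B: "\<And>i y. i < n \<Longrightarrow> y \<in> coboundaries C p i \<Longrightarrow> e1 i *\<^sub>v y = zero_cochain Y (p - 1) (Suc i mod n)"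
    and e2d: "\<And>i y. i < n \<Longrightarrow> y \<in> cochains C (p + 1) i \<Longrightarrow>
        df Y p (Suc i mod n) *\<^sub>v (e2 i *\<^sub>v y) = zero_cochain Y (p + 1) (Suc i mod n)"
    using Q unfolding Q_def by blast+
  define hh where "hh q i = (if q = p then h i else 0\<^sub>m (dimv (ob Y q) i) (dimv (ob C q) i))" for q i
  define ee where "ee q i = (if q = p then e1 i else if q = p + 1 then e2 i
    else 0\<^sub>m (dimv (ob Y (q - 1)) (Suc i mod n)) (dimv (ob C q) i))" for q i
  have hh0: "hh q i *\<^sub>v y = zero_cochain Y q i" if "q \<noteq> p" "y \<in> cochains C q i" for q i y
    using zero_mat_mult_vec[OF that(2)] that(1) by (simp add: hh_def)
  have ee0: "ee q i *\<^sub>v y = zero_cochain Y (q - 1) (Suc i mod n)" if "q \<noteq> p" "q \<noteq> p + 1" "y \<in> cochains C q i" for q i y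
    using zero_mat_mult_vec[OF that(3)] that(1,2) by (simp add: ee_def)
  obtain T \<pi> K where T: "is_cpx n T" "quasi_iso n T C \<pi>" "\<And>p. K p \<in> rep_hom n (ob T p) (ob Y p)"
    and eq: "\<And>q i x. i < n \<Longrightarrow> x \<in> cochains T q i \<Longrightarrow>
      K (q + 1) i *\<^sub>v (df T q i *\<^sub>v x) - df Y q i *\<^sub>v (K q i *\<^sub>v x)
      = hh (q + 1) i *\<^sub>v (df C q i *\<^sub>v (\<pi> q i *\<^sub>v x)) - df Y q i *\<^sub>v (hh q i *\<^sub>v (\<pi> q i *\<^sub>v x))"
    and lift: "\<And>q i z. i < n \<Longrightarrow> z \<in> cochains C q i \<Longrightarrow> df C q i *\<^sub>v z = zero_cochain C (q + 1) i \<Longrightarrow>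
      \<exists>x \<in> cocycles T q i. \<pi> q i *\<^sub>v x = z \<and> K q i *\<^sub>v x = hh q i *\<^sub>v z"
  proof (rule realize[OF C Y, of hh ee])
    fix q i assume i: "i < n"
    have i': "Suc i mod n < n" using n by simp
    show "hh q i \<in> graded_maps C q i Y q i" using hc by (simp add: hh_def)
    show "ee q i \<in> graded_maps C q i Y (q - 1) (Suc i mod n)" using e1[OF i] e2[OF i] by (simp add: ee_def)
    fix y :: "'k vec" assume y: "y \<in> cochains C q i"
    note dy = is_cpx_df_vec[OF C i y] and ay = is_cpx_arr_vec[OF C i y]
    have dY0: "df Y (q - 1) (Suc i mod n) *\<^sub>v zero_cochain Y (q - 1) (Suc i mod n) = zero_cochain Y q (Suc i mod n)"
      by (rule mult_mat_zero_vec[OF df_carrier'[OF Y i']])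
    have l0: "hh q (Suc i mod n) *\<^sub>v (arr (ob C q) i *\<^sub>v y) - arr (ob Y q) i *\<^sub>v (hh q i *\<^sub>v y) = zero_cochain Y q (Suc i mod n)" if "q \<noteq> p"
      unfolding hh0[OF that y] hh0[OF that ay] mult_mat_zero_vec[OF is_cpx_arr[OF Y i]] by simp
    show "hh q (Suc i mod n) *\<^sub>v (arr (ob C q) i *\<^sub>v y) - arr (ob Y q) i *\<^sub>v (hh q i *\<^sub>v y)
       = df Y (q - 1) (Suc i mod n) *\<^sub>v (ee q i *\<^sub>v y) + ee (q + 1) i *\<^sub>v (df C q i *\<^sub>v y)"
    proof -
      consider "q = p" | "q = p + 1" | "q = p - 1" | "q \<noteq> p" "q \<noteq> p + 1" "q \<noteq> p - 1" by blast
      then show ?thesis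
      proof cases
        case 1
        then show ?thesis using he[OF i] y by (simp add: hh_def ee_def)
      next
        case 2
        have "ee (q + 1) i *\<^sub>v (df C q i *\<^sub>v y) = zero_cochain Y q (Suc i mod n)"
          using ee0[OF _ _ dy] 2 by (simp add: add.commute)
        moreover have "df Y (q - 1) (Suc i mod n) *\<^sub>v (ee q i *\<^sub>v y) = zero_cochain Y q (Suc i mod n)"
          using e2d[OF i] y 2 by (simp add: ee_def)
        ultimately show ?thesis using l0 2 by simp
      next
        case 3
        have "df C q i *\<^sub>v y \<in> coboundaries C p i" using coboundaries_df[OF y] 3 by simp
        then have "ee (q + 1) i *\<^sub>v (df C q i *\<^sub>v y) = zero_cochain Y q (Suc i mod n)"
          using e1B[OF i] 3 by (simp add: ee_def)
        moreover have "ee q i *\<^sub>v y = zero_cochain Y (q - 1) (Suc i mod n)" by (rule ee0[OF _ _ y]) (use 3 in simp_all)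
        ultimately show ?thesis using l0 3 dY0 by simp
      next
        case 4
        have "ee (q + 1) i *\<^sub>v (df C q i *\<^sub>v y) = zero_cochain Y q (Suc i mod n)"
          using ee0[OF _ _ dy] 4 by simp
        moreover have "ee q i *\<^sub>v y = zero_cochain Y (q - 1) (Suc i mod n)" by (rule ee0[OF _ _ y]) (use 4 in simp_all)
        ultimately show ?thesis using l0 4 dY0 by simp
      qed
    qed
  qed blast
  note \<pi>c = quasi_iso_chain_map[OF T(2)]
  note Kc = rep_hom_carrier[OF T(3)]
  have K: "chain_map n T Y K"
  proof (rule chain_mapI[OF T(1) Y Kc])
    fix q i and y :: "'k vec" assume i: "i < n" and y: "y \<in> cochains T q i"
    show "K q (Suc i mod n) *\<^sub>v (arr (ob T q) i *\<^sub>v y) = arr (ob Y q) i *\<^sub>v (K q i *\<^sub>v y)"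
      by (rule rep_hom_arr[OF T(3) is_cpx_rep[OF T(1)] is_cpx_rep[OF Y] i y])
    note py = chain_map_vec[OF \<pi>c i y]
    note dpy = is_cpx_df_vec[OF C i py]
    have "hh (q + 1) i *\<^sub>v (df C q i *\<^sub>v (\<pi> q i *\<^sub>v y)) = zero_cochain Y (q + 1) i"
    proof (cases "q + 1 = p")
      case True
      then have "hh (q + 1) i = h i" by (simp add: hh_def)
      moreover have "df C q i *\<^sub>v (\<pi> q i *\<^sub>v y) \<in> coboundaries C p i" using coboundaries_df[OF py] True by simp
      ultimately show ?thesis using h_df[OF i] True by simp
    qed (rule hh0[OF _ dpy])
    moreover have "df Y q i *\<^sub>v (hh q i *\<^sub>v (\<pi> q i *\<^sub>v y)) = zero_cochain Y (q + 1) i"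
    proof (cases "q = p")
      case True
      then show ?thesis using cocyclesD(2)[OF h_cocycle[OF i]] py by (simp add: hh_def)
    next
      case False
      show ?thesis unfolding hh0[OF False py] by (rule mult_mat_zero_vec[OF is_cpx_df[OF Y i]])
    qed
    ultimately have 0: "K (q + 1) i *\<^sub>v (df T q i *\<^sub>v y) - df Y q i *\<^sub>v (K q i *\<^sub>v y) = zero_cochain Y (q + 1) i"
      using eq[OF i y] by simp
    note c1 = mult_mat_vec_carrier[OF Kc[OF i] is_cpx_df_vec[OF T(1) i y]]
    note c2 = is_cpx_df_vec[OF Y i mult_mat_vec_carrier[OF Kc[OF i] y]]
    show "K (q + 1) i *\<^sub>v (df T q i *\<^sub>v y) = df Y q i *\<^sub>v (K q i *\<^sub>v y)"
      using add_diff_vec[OF c2 c1] 0 c2 by simp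
  qed
  have "(T, \<pi>, K) \<in> roofs n C Y" using T(1,2) K by (simp add: roofs_def)
  moreover obtain z where "z \<in> cocycles T p v" "K p v *\<^sub>v z = hh p v *\<^sub>v z1"
    using lift[OF v cocyclesD(1)[OF z1(1)] cocyclesD(2)[OF z1(1)]] by blast
  ultimately show thesis using that[of T \<pi> K z] hz1 by (simp add: v_def hh_def)
qed

section \<open>Rigid objects and uniserial representations\<close>

text \<open>A class in the single degree \<open>m\<close>, extended by zero, is a morphism of the
  orbit category, so triviality of the Hom set is felt in every degree.\<close>

lemma orbit_Hom_zero:
  assumes X: "is_cpx n X" and Y: "is_cpx n Y" and n: "n > 0"
    and Hom: "Hom (cluster_tube n) X Y = {Zer (cluster_tube n) X Y}" and r: "r \<in> roofs n X (F_cpx n m Y)"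
  shows "roof_class n X (F_cpx n m Y) r = Zer (derived_cat n) X (F_cpx n m Y)"
proof -
  let ?\<phi> = "\<lambda>m'. if m' = m then roof_class n X (F_cpx n m Y) r else Zer (derived_cat n) X (F_cpx n m' Y)"
  have z: "Zer (derived_cat n) X (F_cpx n m' Y) \<in> Hom (derived_cat n) X (F_cpx n m' Y)" for m'
    using zero_roof[OF X is_cpx_F[OF n Y]] by (simp add: derived_cat_def)
  have "roof_class n X (F_cpx n m Y) r \<in> Hom (derived_cat n) X (F_cpx n m Y)"
    using r by (simp add: derived_cat_def)
  moreover have "finite {m'. ?\<phi> m' \<noteq> Zer (derived_cat n) X (F_cpx n m' Y)}"
    by (rule finite_subset[of _ "{m}"]) auto
  ultimately have "?\<phi> \<in> Hom (cluster_tube n) X Y"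
    using z by (simp add: cluster_tube_def orbit_cat_def)
  then have "?\<phi> = Zer (cluster_tube n) X Y" using Hom by simp
  then have "?\<phi> m = Zer (cluster_tube n) X Y m" by (rule fun_cong)
  then show ?thesis by (simp add: cluster_tube_def orbit_cat_def)
qed

text \<open>If all roofs are equivalent, the class of each one is the whole set
  \<open>roofs\<close>. Every degree then has exactly one morphism, the class of the zero
  roof.\<close>

lemma orbit_Hom_zeroI:
  assumes X: "is_cpx n X" and Y: "is_cpx n Y" and n: "n > 0"
    and equiv: "\<And>m r r'. r \<in> roofs n X (F_cpx n m Y) \<Longrightarrow> r' \<in> roofs n X (F_cpx n m Y) \<Longrightarrow>
      roof_equiv n X (F_cpx n m Y) r r'"
  shows "Hom (cluster_tube n) X Y = {Zer (cluster_tube n) X Y}"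
proof -
  have z: "(X, id_map X, zero_map X (F_cpx n m Y)) \<in> roofs n X (F_cpx n m Y)" for m
    by (rule zero_roof[OF X is_cpx_F[OF n Y]])
  have cls: "roof_class n X (F_cpx n m Y) r = roofs n X (F_cpx n m Y)" if "r \<in> roofs n X (F_cpx n m Y)" for m r
    using equiv[OF that] by (auto simp: roof_class_def)
  then have Hom: "Hom (derived_cat n) X (F_cpx n m Y) = {Zer (derived_cat n) X (F_cpx n m Y)}" for m
    using z[of m] by (auto simp: derived_cat_def)
  show ?thesis
  proof (intro subset_antisym subsetI)
    fix \<phi> assume "\<phi> \<in> Hom (cluster_tube n) X Y"
    then have "\<phi> m = Zer (derived_cat n) X (F_cpx n m Y)" for m
      using Hom[of m] by (auto simp: cluster_tube_def orbit_cat_def)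
    then show "\<phi> \<in> {Zer (cluster_tube n) X Y}" by (simp add: cluster_tube_def orbit_cat_def fun_eq_iff)
  next
    fix \<phi> assume "\<phi> \<in> {Zer (cluster_tube n) X Y}"
    then show "\<phi> \<in> Hom (cluster_tube n) X Y" using Hom by (simp add: cluster_tube_def orbit_cat_def)
  qed
qed

lemma path_kills_roofsD:
  assumes "path_kills_roofs n l Y \<phi>" "(Z, s, f) \<in> \<phi>" "i < n" "z \<in> cocycles Z p i"
  shows "path_mat n (ob Y p) i l *\<^sub>v (f p i *\<^sub>v z) \<in> coboundaries Y p ((i + l) mod n)"
  using bspec[OF assms(1)[unfolded path_kills_roofs_def] assms(2)] assms(3,4) by simp

lemma vertex_shift_mod: "vertex_shift n m (i mod n) = vertex_shift n m i"
  by (simp add: vertex_shift_def zmod_int mod_diff_left_eq)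

text \<open>If \<open>C\<close> is not acyclic, some path of length \<open>k\<close>, but none of
  length \<open>k + 1\<close>, acts nontrivially on its cohomology. The class of \<open>x\<close>,
  in degree \<open>p0\<close> at the vertex \<open>a\<close>, generates the uniserial
  \<open>U\<close> of length \<open>k + 1\<close>. In \<open>M\<close> the socle of \<open>U\<close>
  is at \<open>b = a + k - p0\<close> modulo \<open>n\<close>, and \<open>j\<close> is the next
  vertex.\<close>

lemma rigid_not_sincere:
  fixes C :: "'k::field cpx"
  assumes n: "n > 0" and rig: "rigid (cluster_tube n) (shift_cpx 1) C"
  obtains j where "j < n" "\<And>p. cocycles C p (vertex_shift n (- p) j) \<subseteq> coboundaries C p (vertex_shift n (- p) j)"
proof -
  have C: "is_cpx n C" using rig by (simp add: rigid_def cluster_tube_Obj)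
  have Hom: "Hom (cluster_tube n) C (shift_cpx 1 C) = {Zer (cluster_tube n) C (shift_cpx 1 C)}"
    using rig by (simp add: rigid_def Ext1_vanishes_def)
  have S: "is_cpx n (shift_cpx 1 C)" by (rule is_cpx_shift[OF C])
  define Q where "Q k \<longleftrightarrow> (\<exists>p i x. i < n \<and> x \<in> cocycles C p i \<and> path_mat n (ob C p) i k *\<^sub>v x \<notin> coboundaries C p ((i + k) mod n))" for k
  show thesis
  proof (cases "Q 0")
    case False
    have "cocycles C p i \<subseteq> coboundaries C p i" if i: "i < n" for p i
    proof
      fix x assume x: "x \<in> cocycles C p i"
      then have "path_mat n (ob C p) i 0 *\<^sub>v x \<in> coboundaries C p ((i + 0) mod n)"
        using False i unfolding Q_def by blast
      then show "x \<in> coboundaries C p i" using path_mat_0_vec[OF cocyclesD(1)[OF x], of n] i by simp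
    qed
    from that[of 0, OF n this[OF vertex_shift_less[OF n]]] show thesis .
  next
    case True
    obtain l where l: "\<And>p i x. i < n \<Longrightarrow> x \<in> cochains C p i \<Longrightarrow>
      path_mat n (ob C p) i l *\<^sub>v x = zero_cochain C p ((i + l) mod n)"
      using uniformly_nilpotent[OF C] by blast
    have "\<not> Q l"
      unfolding Q_def
    proof clarify
      fix p i x assume i: "i < n" and x: "x \<in> cocycles C p i"
        and not: "path_mat n (ob C p) i l *\<^sub>v x \<notin> coboundaries C p ((i + l) mod n)"
      have "(i + l) mod n < n" using n by simp
      then show False using not coboundaries_zero[OF C] unfolding l[OF i cocyclesD(1)[OF x]] by blast
    qed
    then obtain k where k: "Q k" "\<not> Q (Suc k)" using ex_least_nat_less[of "\<lambda>k. \<not> Q k" l] True by blast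
    obtain p0 a x where a: "a < n" and x: "x \<in> cocycles C p0 a"
      and xk: "path_mat n (ob C p0) a k *\<^sub>v x \<notin> coboundaries C p0 ((a + k) mod n)" using k(1) unfolding Q_def by blast
    have kill: "path_mat n (ob C p) i (Suc k) *\<^sub>v y \<in> coboundaries C p ((i + Suc k) mod n)" if "i < n" "y \<in> cocycles C p i" for p i y
      using k(2) that unfolding Q_def by blast
    define j where "j = vertex_shift n p0 ((a + Suc k) mod n)"
    have "cocycles C p (vertex_shift n (- p) j) \<subseteq> coboundaries C p (vertex_shift n (- p) j)" for p
    proof (rule ccontr)
      assume not: "\<not> ?thesis"
      \<comment> \<open>As \<open>p + m + 1 = p0\<close>, degree \<open>p\<close> of
        \<open>F^m (C[1])\<close> carries the cohomology of \<open>C\<close> in degree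
        \<open>p0\<close>. A nonzero class of \<open>C\<close> in degree \<open>p\<close> at the
        vertex in question can then be sent to the socle of \<open>U\<close>.\<close>
      define m where "m = p0 - p - 1"
      define Y where "Y = F_cpx n m (shift_cpx 1 C)"
      have Y: "is_cpx n Y" unfolding Y_def by (rule is_cpx_F[OF n S])
      define i0 where "i0 = vertex_shift n m a"
      have i0: "i0 < n" unfolding i0_def by (rule vertex_shift_less[OF n])
      have i0a: "vertex_shift n (- m) i0 = a" unfolding i0_def vertex_shift_add[OF n] using a by (simp add: vertex_shift_0)
      have p0: "p + m + 1 = p0" by (simp add: m_def)
      have obY: "ob Y p = tau_rep n (- m) (ob C p0)" unfolding Y_def ob_F ob_shift p0 ..
      have path: "path_mat n (ob Y p) i0 t = path_mat n (ob C p0) a t" for t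
        unfolding obY path_mat_tau_rep[OF n i0] i0a ..
      have cob: "coboundaries Y p ((i0 + t) mod n) = coboundaries C p0 ((a + t) mod n)" for t
      proof -
        have "(i0 + t) mod n < n" using n by simp
        from coboundaries_F[OF n S this, of m p] show ?thesis
          unfolding Y_def vertex_shift_plus[OF n] i0a
          using coboundaries_shift[OF C, of "(a + t) mod n" 1 "p + m"] n by (simp add: p0)
      qed
      have coc: "cocycles Y p i0 = cocycles C p0 a"
        unfolding Y_def cocycles_F[OF n S i0] i0a cocycles_shift[OF C a] p0 ..
      \<comment> \<open>The vertex where \<open>C\<close> is tested in degree \<open>p\<close> is
        the one where \<open>U\<close> ends inside \<open>Y\<close>: both are
        \<open>a + k + 1 - p0 + p\<close> modulo \<open>n\<close>.\<close>
      have v: "vertex_shift n (- p) j = (i0 + k) mod n"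
      proof -
        have "vertex_shift n (- p) j = vertex_shift n (p0 - p) (Suc (a + k) mod n)"
          unfolding j_def vertex_shift_add[OF n] by simp
        also have "\<dots> = vertex_shift n (p0 - p + - 1) (a + k)"
          unfolding Suc_mod_eq_vertex_shift[OF n] vertex_shift_add[OF n] ..
        also have "\<dots> = vertex_shift n m ((a + k) mod n)" unfolding vertex_shift_mod by (simp add: m_def)
        also have "\<dots> = (i0 + k) mod n" unfolding vertex_shift_plus[OF n] i0_def ..
        finally show ?thesis .
      qed
      obtain T \<pi> h z where r: "(T, \<pi>, h) \<in> roofs n C Y" and z: "z \<in> cocycles T p ((i0 + k) mod n)"
        and hz: "h p ((i0 + k) mod n) *\<^sub>v z \<notin> coboundaries Y p ((i0 + k) mod n)"
      proof (rule nonzero_roof[OF n C Y i0, of x p k])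
        show "x \<in> cocycles Y p i0" using x coc by simp
        show "path_mat n (ob Y p) i0 k *\<^sub>v x \<notin> coboundaries Y p ((i0 + k) mod n)"
          unfolding path cob by (rule xk)
        show "path_mat n (ob Y p) i0 (Suc k) *\<^sub>v x \<in> coboundaries Y p ((i0 + Suc k) mod n)"
          unfolding path cob by (rule kill[OF a x])
        show "path_mat n (ob C p) i (Suc k) *\<^sub>v y \<in> coboundaries C p ((i + Suc k) mod n)" if "i < n" "y \<in> cocycles C p i" for i y
          by (rule kill[OF that])
        show "\<not> cocycles C p ((i0 + k) mod n) \<subseteq> coboundaries C p ((i0 + k) mod n)" using not unfolding v .
      qed (rule that)
      \<comment> \<open>Rigidity puts the roof into the zero class, which acts as zero on
        cohomology; this is \<open>path_kills_Zer\<close> for paths of length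
        \<open>0\<close>.\<close>
      have "(T, \<pi>, h) \<in> Zer (derived_cat n) C Y"
        using orbit_Hom_zero[OF C S n Hom r[unfolded Y_def]] roof_class_self[OF C Y r] by (simp add: Y_def)
      moreover have iv: "(i0 + k) mod n < n" using n by simp
      ultimately have "path_mat n (ob Y p) ((i0 + k) mod n) 0 *\<^sub>v (h p ((i0 + k) mod n) *\<^sub>v z) \<in> coboundaries Y p (((i0 + k) mod n + 0) mod n)"
        using path_kills_roofsD[OF path_kills_Zer[OF C Y, of 0] _ _ z] by blast
      moreover have "h p ((i0 + k) mod n) *\<^sub>v z \<in> cochains Y p ((i0 + k) mod n)"
        by (rule chain_map_vec[OF roofsD(4)[OF r] iv cocyclesD(1)[OF z]])
      ultimately show False using hz by simp
    qed
    then show thesis using that[of j] vertex_shift_less[OF n] by (simp add: j_def)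
  qed
qed

text \<open>The uniserial representation of length $(K+1)n - 1$ with top at $j+1$ and socle at $j-1$. The $s$-th basis vector at
  vertex $i$ is at distance \<open>s * n + uniserial_pos i\<close> from the top.\<close>

definition uniserial_dim :: "nat \<Rightarrow> nat \<Rightarrow> nat \<Rightarrow> nat" where
  "uniserial_dim j K i = (if i = j then K else Suc K)"

definition uniserial :: "nat \<Rightarrow> nat \<Rightarrow> nat \<Rightarrow> 'k::field rep" where
  "uniserial n j K = \<lparr> dimv = uniserial_dim j K,
     arr = (\<lambda>i. mat (uniserial_dim j K (Suc i mod n)) (uniserial_dim j K i)
       (\<lambda>(r, c). if r = c + (if i = j then 1 else 0) then 1 else 0)) \<rparr>"

section \<open>Depths, kernels and cokernels in the uniserial representation\<close>

lemma diag_mat_vec: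
  fixes x :: "'k::field vec"
  assumes "x \<in> carrier_vec b" "r < a"
  shows "(mat a b (\<lambda>(r, c). if r = c + t then 1 else 0) *\<^sub>v x) $ r = (if t \<le> r \<and> r - t < b then x $ (r - t) else 0)"
proof -
  have "(mat a b (\<lambda>(r, c). if r = c + t then 1 else 0) *\<^sub>v x) $ r = (\<Sum>c = 0..<b. (if r = c + t then 1 else 0) * x $ c)"
    using assms by (simp add: scalar_prod_def)
  also have "\<dots> = (\<Sum>c = 0..<b. if c = r - t then (if t \<le> r then x $ (r - t) else 0) else 0)"
    by (rule sum.cong) auto
  also have "\<dots> = (if t \<le> r \<and> r - t < b then x $ (r - t) else 0)" by simp
  finally show ?thesis .
qed

context
  fixes n j K :: nat and U :: "'k::field rep"
  assumes n: "n > 0" and j: "j < n" and U: "U = uniserial n j K"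
begin

lemma dimv_uniserial: "dimv U i = (if i = j then K else Suc K)"
  by (simp add: U uniserial_def uniserial_dim_def)

lemma arr_uniserial_vec:
  assumes x: "x \<in> carrier_vec (dimv U i)" and r: "r < dimv U (Suc i mod n)"
  shows "(arr U i *\<^sub>v x) $ r = (if i = j then (if r = 0 \<or> r > K then 0 else x $ (r - 1)) else x $ r)"
proof -
  let ?t = "if i = j then 1 else 0 :: nat"
  have "(arr U i *\<^sub>v x) $ r = (if ?t \<le> r \<and> r - ?t < dimv U i then x $ (r - ?t) else 0)"
    using diag_mat_vec[of x "uniserial_dim j K i" r "uniserial_dim j K (Suc i mod n)" ?t] x r by (simp add: U uniserial_def)
  moreover have "r < Suc K" using r by (simp add: dimv_uniserial split: if_splits)
  ultimately show ?thesis by (auto simp: dimv_uniserial)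
qed

lemma uniserial_rep: "is_rep n U"
  by (simp add: is_rep_def U uniserial_def)

lemma uniserial_arr_vec: "i < n \<Longrightarrow> x \<in> carrier_vec (dimv U i) \<Longrightarrow> arr U i *\<^sub>v x \<in> carrier_vec (dimv U (Suc i mod n))"
  using is_repD[OF uniserial_rep] by (rule mult_mat_vec_carrier)

definition uniserial_pos :: "nat \<Rightarrow> nat" where "uniserial_pos i = vertex_shift n (int j + 1) i"

lemma uniserial_pos_less: "uniserial_pos i < n"
  unfolding uniserial_pos_def by (rule vertex_shift_less[OF n])

lemma uniserial_pos_j: "uniserial_pos j = n - 1"
proof -
  have "int (n - 1) = int n - 1" using n by simp
  moreover have "- 1 mod int n = int n - 1" using n by (simp add: zmod_minus1)
  ultimately show ?thesis by (simp add: uniserial_pos_def vertex_shift_def)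
qed

lemma uniserial_pos_Suc:
  assumes i: "i < n"
  shows "uniserial_pos (Suc i mod n) = (if i = j then 0 else Suc (uniserial_pos i))"
proof -
  have inj: "vertex_shift n (- (int j + 1)) (uniserial_pos i) = i" if "i < n" for i
    unfolding uniserial_pos_def vertex_shift_add[OF n] using that by (simp add: vertex_shift_0)
  have *: "uniserial_pos (Suc i mod n) = Suc (uniserial_pos i) mod n" unfolding uniserial_pos_def by (rule vertex_shift_Suc[OF n])
  show ?thesis
  proof (cases "i = j")
    case True
    then show ?thesis using * uniserial_pos_j n by simp
  next
    case False
    then have "uniserial_pos i \<noteq> n - 1" using inj[OF i] inj[OF j] uniserial_pos_j by metis
    then have "Suc (uniserial_pos i) < n" using uniserial_pos_less[of i] by simp
    then show ?thesis using * False by simp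
  qed
qed

text \<open>Each arrow raises the depth \<open>s * n + uniserial_pos i\<close> of a basis vector by
  one, so \<open>l\<close> arrows leave nothing at depth below \<open>l\<close>. As all depths are
  below \<open>Suc K * n\<close>, this gives nilpotency in the next lemma.\<close>

lemma uniserial_path_low:
  assumes i: "i < n" and x: "x \<in> carrier_vec (dimv U i)"
  shows "s < dimv U ((i + l) mod n) \<Longrightarrow> s * n + uniserial_pos ((i + l) mod n) < l \<Longrightarrow> (path_mat n U i l *\<^sub>v x) $ s = 0"
proof (induction l arbitrary: s)
  case 0
  then show ?case by simp
next
  case (Suc l)
  let ?i = "(i + l) mod n"
  have i': "?i < n" using n by simp
  have Si: "(i + Suc l) mod n = Suc ?i mod n" by (simp add: mod_Suc_eq)
  have y: "path_mat n U i l *\<^sub>v x \<in> carrier_vec (dimv U ?i)" by (rule path_vec_carrier[OF uniserial_rep i x])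
  have s: "s < dimv U (Suc ?i mod n)" using Suc.prems(1) Si by simp
  have lt: "s * n + uniserial_pos (Suc ?i mod n) < Suc l" using Suc.prems(2) Si by simp
  show ?case
  proof (cases "?i = j")
    case ij: True
    show ?thesis
    proof (cases "s = 0 \<or> s > K")
      case True
      then show ?thesis
        unfolding path_mat_Suc_vec[OF uniserial_rep i x] arr_uniserial_vec[OF y s] using ij by simp
    next
      case False
      \<comment> \<open>The arrow leaving \<open>j\<close> completes a turn: it takes the basis
        vector \<open>s - 1\<close> at the last position \<open>n - 1\<close> to the basis vector
        \<open>s\<close> at position \<open>0\<close>.\<close>
      then have "(s - 1) * n + (n - 1) < l"
        using lt uniserial_pos_Suc[OF i'] ij n by (cases s) auto
      then have "(path_mat n U i l *\<^sub>v x) $ (s - 1) = 0"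
        using Suc.IH[of "s - 1"] ij False uniserial_pos_j by (auto simp: dimv_uniserial)
      then show ?thesis
        unfolding path_mat_Suc_vec[OF uniserial_rep i x] arr_uniserial_vec[OF y s] using ij by simp
    qed
  next
    case False
    then have "s * n + uniserial_pos ?i < l" using lt uniserial_pos_Suc[OF i'] by simp
    moreover have "s < dimv U ?i" using s False by (simp add: dimv_uniserial split: if_splits)
    ultimately have "(path_mat n U i l *\<^sub>v x) $ s = 0" by (intro Suc.IH)
    then show ?thesis unfolding path_mat_Suc_vec[OF uniserial_rep i x] arr_uniserial_vec[OF y s] using False by simp
  qed
qed

lemma uniserial_tube: "U \<in> tube n"
proof -
  let ?l = "Suc K * n"
  have "path_mat n U i ?l = 0\<^sub>m (dimv U ((i + ?l) mod n)) (dimv U i)" if i: "i < n" for i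
  proof (rule mat_eq_by_vec[OF path_mat_carrier[OF uniserial_rep i] zero_carrier_mat])
    fix x :: "'k vec" assume x: "x \<in> carrier_vec (dimv U i)"
    show "path_mat n U i ?l *\<^sub>v x = 0\<^sub>m (dimv U ((i + ?l) mod n)) (dimv U i) *\<^sub>v x"
      unfolding zero_mat_mult_vec[OF x]
    proof (rule eq_vecI)
      fix s assume "s < dim_vec (0\<^sub>v (dimv U ((i + ?l) mod n)) :: 'k vec)"
      then have s: "s < dimv U ((i + ?l) mod n)" by simp
      then have "s \<le> K" by (simp add: dimv_uniserial split: if_splits)
      then have "s * n \<le> K * n" by simp
      then have "s * n + uniserial_pos ((i + ?l) mod n) < K * n + n" using uniserial_pos_less[of "(i + ?l) mod n"] by (rule add_le_less_mono)
      then have "s * n + uniserial_pos ((i + ?l) mod n) < ?l" by (simp add: add.commute)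
      then show "(path_mat n U i ?l *\<^sub>v x) $ s = 0\<^sub>v (dimv U ((i + ?l) mod n)) $ s"
        using uniserial_path_low[OF i x s] s by simp
    qed (use carrier_vecD[OF path_vec_carrier[OF uniserial_rep i x, of ?l]] in simp)
  qed
  then show ?thesis using uniserial_rep by (auto simp: tube_def nilpotent_rep_def)
qed

text \<open>The coefficient of the top basis vector travels unchanged and after \<open>l\<close>
  arrows is found at depth exactly \<open>l\<close>.\<close>

lemma uniserial_path_unit:
  assumes x: "x \<in> carrier_vec (dimv U (Suc j mod n))" and x0: "x $ 0 = 1"
  shows "s < dimv U ((Suc j mod n + l) mod n) \<Longrightarrow> s * n + uniserial_pos ((Suc j mod n + l) mod n) = l \<Longrightarrow>
    (path_mat n U (Suc j mod n) l *\<^sub>v x) $ s = 1"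
proof (induction l arbitrary: s)
  case 0
  then show ?case using x x0 n by (simp add: path_mat_0_vec)
next
  case (Suc l)
  have j': "Suc j mod n < n" using n by simp
  let ?i = "(Suc j mod n + l) mod n"
  have i': "?i < n" using n by simp
  have Si: "(Suc j mod n + Suc l) mod n = Suc ?i mod n" by (simp add: mod_Suc_eq)
  have y: "path_mat n U (Suc j mod n) l *\<^sub>v x \<in> carrier_vec (dimv U ?i)" by (rule path_vec_carrier[OF uniserial_rep j' x])
  have s: "s < dimv U (Suc ?i mod n)" using Suc.prems(1) Si by simp
  have eq: "s * n + uniserial_pos (Suc ?i mod n) = Suc l" using Suc.prems(2) Si by simp
  show ?case
  proof (cases "?i = j")
    case True
    then have sn: "s * n = Suc l" using eq uniserial_pos_Suc[OF i'] by simp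
    then have s0: "s > 0" by (cases s) auto
    then have "(s - 1) * n + (n - 1) = l" using sn n by (cases s) auto
    moreover have sK: "s \<le> K" using s by (simp add: dimv_uniserial split: if_splits)
    ultimately have "(path_mat n U (Suc j mod n) l *\<^sub>v x) $ (s - 1) = 1"
      using Suc.IH[of "s - 1"] True s0 uniserial_pos_j by (simp add: dimv_uniserial)
    then show ?thesis unfolding path_mat_Suc_vec[OF uniserial_rep j' x] arr_uniserial_vec[OF y s] using True s0 sK by simp
  next
    case False
    then have "s * n + uniserial_pos ?i = l" using eq uniserial_pos_Suc[OF i'] by simp
    moreover have "s < dimv U ?i" using s False by (simp add: dimv_uniserial split: if_splits)
    ultimately have "(path_mat n U (Suc j mod n) l *\<^sub>v x) $ s = 1" by (intro Suc.IH)
    then show ?thesis unfolding path_mat_Suc_vec[OF uniserial_rep j' x] arr_uniserial_vec[OF y s] using False by simp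
  qed
qed

lemma uniserial_path_nonzero:
  assumes K: "K > l"
  shows "\<exists>x \<in> carrier_vec (dimv U (Suc j mod n)).
    path_mat n U (Suc j mod n) l *\<^sub>v x \<noteq> (0\<^sub>v (dimv U ((Suc j mod n + l) mod n)) :: 'k vec)"
proof
  \<comment> \<open>The top basis vector. After \<open>l\<close> arrows it is at depth
    \<open>l = (l div n) * n + l mod n\<close>, thus at index \<open>l div n\<close>, and
    \<open>K > l\<close> makes this index available at every vertex.\<close>
  let ?x = "unit_vec (dimv U (Suc j mod n)) 0 :: 'k vec"
  have d: "dimv U i > l" for i using K by (simp add: dimv_uniserial)
  show x: "?x \<in> carrier_vec (dimv U (Suc j mod n))" by simp
  have "?x $ 0 = 1" using d[of "Suc j mod n"] by simp
  moreover have "l div n < dimv U ((Suc j mod n + l) mod n)" using le_less_trans[OF div_le_dividend d] .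
  moreover have "uniserial_pos ((Suc j mod n + l) mod n) = l mod n"
    using vertex_shift_plus[OF n, of "int j + 1" "Suc j mod n" l] uniserial_pos_Suc[OF j] by (simp add: uniserial_pos_def)
  ultimately have "(path_mat n U (Suc j mod n) l *\<^sub>v ?x) $ (l div n) = 1"
    by (intro uniserial_path_unit[OF x]) simp_all
  moreover have "l div n < dimv U ((Suc j mod n + l) mod n)" by fact
  ultimately show "path_mat n U (Suc j mod n) l *\<^sub>v ?x \<noteq> 0\<^sub>v (dimv U ((Suc j mod n + l) mod n))" by auto
qed

text \<open>Only the arrow into \<open>j\<close> can have a kernel, the socle at
  \<open>j - 1\<close>. In the next lemma the excluded arrow, the one leaving \<open>j\<close>, is
  the only one that can have a cokernel, the top at \<open>j + 1\<close>.\<close>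

lemma uniserial_inj:
  assumes i: "i < n" "Suc i mod n \<noteq> j" and x: "x \<in> carrier_vec (dimv U i)"
    and 0: "arr U i *\<^sub>v x = 0\<^sub>v (dimv U (Suc i mod n))"
  shows "x = 0\<^sub>v (dimv U i)"
proof (rule eq_vecI)
  fix s assume "s < dim_vec (0\<^sub>v (dimv U i))"
  then have s: "s < dimv U i" by simp
  let ?r = "if i = j then Suc s else s"
  have r: "?r < dimv U (Suc i mod n)" using s i(2) by (simp add: dimv_uniserial split: if_splits)
  have "(arr U i *\<^sub>v x) $ ?r = x $ s" using arr_uniserial_vec[OF x r] s by (simp add: dimv_uniserial split: if_splits)
  then show "x $ s = 0\<^sub>v (dimv U i) $ s" using 0 r s by simp
qed (use x in simp)

lemma uniserial_surj:
  assumes i: "i < n" "i \<noteq> j" and y: "y \<in> carrier_vec (dimv U (Suc i mod n))"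
  shows "\<exists>x \<in> carrier_vec (dimv U i). arr U i *\<^sub>v x = y"
proof
  let ?x = "vec (dimv U i) (\<lambda>s. if s < dimv U (Suc i mod n) then y $ s else 0)"
  show x: "?x \<in> carrier_vec (dimv U i)" by simp
  show "arr U i *\<^sub>v ?x = y"
  proof (rule eq_vecI)
    fix s assume "s < dim_vec y"
    then have s: "s < dimv U (Suc i mod n)" using y by simp
    then have "s < dimv U i" using i(2) by (simp add: dimv_uniserial split: if_splits)
    then show "(arr U i *\<^sub>v ?x) $ s = y $ s" using arr_uniserial_vec[OF x s] s i(2) by simp
  qed (use carrier_vecD[OF uniserial_arr_vec[OF i(1) x]] y in simp)
qed

end

section \<open>Uniserial stalk complexes as test objects\<close>

definition stalk_cpx :: "'k::field rep \<Rightarrow> 'k cpx" where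
  "stalk_cpx V = \<lparr> ob = (\<lambda>p. if p = 0 then V else \<lparr> dimv = (\<lambda>i. 0), arr = (\<lambda>i. 0\<^sub>m 0 0) \<rparr>),
     df = (\<lambda>p i. 0\<^sub>m (if p = - 1 then dimv V i else 0) (if p = 0 then dimv V i else 0)) \<rparr>"

lemma ob_stalk_0: "ob (stalk_cpx V) 0 = V"
  by (simp add: stalk_cpx_def)

lemma dimv_stalk: "dimv (ob (stalk_cpx V) p) i = (if p = 0 then dimv V i else 0)"
  by (simp add: stalk_cpx_def)

lemma is_cpx_stalk:
  fixes V :: "'k::field rep"
  assumes V: "V \<in> tube n"
  shows "is_cpx n (stalk_cpx V)"
proof -
  have df: "df (stalk_cpx V) p i *\<^sub>v x = zero_cochain (stalk_cpx V) (p + 1) i"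
    if "x \<in> cochains (stalk_cpx V) p i" for p i x
  proof -
    have "p + 1 = 0 \<longleftrightarrow> p = - 1" by auto
    then have "df (stalk_cpx V) p i = 0\<^sub>m (dimv (ob (stalk_cpx V) (p + 1)) i) (dimv (ob (stalk_cpx V) p) i)"
      by (simp add: stalk_cpx_def)
    then show ?thesis using zero_mat_mult_vec[OF that] by simp
  qed
  have tb: "ob (stalk_cpx V) p \<in> tube n" for p
  proof -
    have "path_mat n \<lparr> dimv = (\<lambda>i. 0), arr = (\<lambda>i. 0\<^sub>m 0 0) \<rparr> i 0 = (0\<^sub>m 0 0 :: 'k mat)" for i by auto
    then have "\<lparr> dimv = (\<lambda>i. 0), arr = (\<lambda>i. 0\<^sub>m 0 0 :: 'k mat) \<rparr> \<in> tube n"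
      by (auto simp: tube_def is_rep_def nilpotent_rep_def intro!: exI[of _ 0])
    then show ?thesis using V by (simp add: stalk_cpx_def)
  qed
  have rep: "is_rep n (ob (stalk_cpx V) p)" for p using tb[of p] by (simp add: tube_def)
  have c: "df (stalk_cpx V) p i \<in> graded_maps (stalk_cpx V) p i (stalk_cpx V) (p + 1) i" for p i
  proof -
    have "p + 1 = 0 \<longleftrightarrow> p = - 1" by auto
    then show ?thesis by (simp add: stalk_cpx_def)
  qed
  show ?thesis
  proof (rule is_cpxI[where b = 0])
    fix p i and x :: "'k vec" assume i: "i < n" and x: "x \<in> cochains (stalk_cpx V) p i"
    show "df (stalk_cpx V) p (Suc i mod n) *\<^sub>v (arr (ob (stalk_cpx V) p) i *\<^sub>v x)
      = arr (ob (stalk_cpx V) (p + 1)) i *\<^sub>v (df (stalk_cpx V) p i *\<^sub>v x)"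
      unfolding df[OF x] df[OF mult_mat_vec_carrier[OF is_repD[OF rep i] x]]
      by (rule mult_mat_zero_vec[OF is_repD[OF rep i], symmetric])
    show "df (stalk_cpx V) (p + 1) i *\<^sub>v (df (stalk_cpx V) p i *\<^sub>v x) = zero_cochain (stalk_cpx V) (p + 2) i"
      using df[OF zero_carrier_vec, of "p + 1" i] unfolding df[OF x] by (simp add: add.assoc)
  qed (use tb c in \<open>auto simp: dimv_stalk\<close>)
qed

text \<open>\<open>F^m (X[1])\<close> is \<open>\<tau>^(-m) X\<close> placed in degree
  \<open>-m - 1\<close>, and \<open>\<tau>^(-m)\<close> moves the socle from \<open>j - 1\<close> to
  \<open>j - m - 1\<close>, which is \<open>vertex_shift n (m + 1) j\<close>.\<close>

lemma stalk_target_uniserial: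
  assumes n: "n > 0" and j: "j < n"
  shows "stalk_target n (F_cpx n m (shift_cpx 1 (stalk_cpx (uniserial n j K :: 'k::field rep)))) (- m - 1) (vertex_shift n (m + 1) j)"
    (is "stalk_target n ?N ?q ?j")
proof
  let ?V = "uniserial n j K :: 'k rep"
  note V = uniserial_tube[OF n j refl]
  have shift: "vertex_shift n (- m) ?j = vertex_shift n 1 j" unfolding vertex_shift_add[OF n] by simp
  have inj: "i = i'" if eq: "vertex_shift n (- m) i = vertex_shift n (- m) i'" and i: "i < n" "i' < n" for i i'
  proof -
    have "vertex_shift n m (vertex_shift n (- m) i) = vertex_shift n m (vertex_shift n (- m) i')" unfolding eq ..
    then show ?thesis unfolding vertex_shift_add[OF n] using i by (simp add: vertex_shift_0)
  qed
  have Sj: "Suc (vertex_shift n 1 j) mod n = j"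
    unfolding Suc_mod_eq_vertex_shift[OF n] vertex_shift_add[OF n] using j by (simp add: vertex_shift_0)
  show "n > 0" by (rule n)
  show "is_cpx n ?N" by (intro is_cpx_F[OF n] is_cpx_shift is_cpx_stalk V)
  show "?j < n" by (rule vertex_shift_less[OF n])
  have dim: "dimv (ob ?N p) i = (if p = ?q then dimv ?V (vertex_shift n (- m) i) else 0)" for p i
  proof -
    have "p + m + 1 = 0 \<longleftrightarrow> p = ?q" by auto
    then show ?thesis by (simp add: dimv_F ob_shift dimv_stalk)
  qed
  have arr: "arr (ob ?N ?q) i = arr ?V (vertex_shift n (- m) i)" for i
    by (simp add: arr_F ob_shift ob_stalk_0)
  have v: "vertex_shift n (- m) i < n" for i by (rule vertex_shift_less[OF n])
  show "dimv (ob ?N p) i = 0" if "p \<noteq> ?q" for p i using that by (simp add: dim)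
  show "x = 0\<^sub>v (dimv (ob ?N ?q) i)" if i: "i < n" "i \<noteq> ?j" and x: "x \<in> carrier_vec (dimv (ob ?N ?q) i)"
    and 0: "arr (ob ?N ?q) i *\<^sub>v x = 0\<^sub>v (dimv (ob ?N ?q) (Suc i mod n))" for i x
  proof -
    have "vertex_shift n (- m) i \<noteq> vertex_shift n 1 j"
      using inj[OF _ i(1) vertex_shift_less[OF n, of "m + 1" j]] i(2) unfolding shift by blast
    then have "Suc (vertex_shift n (- m) i) mod n \<noteq> j"
      using Suc_mod_cancel[OF n, of "vertex_shift n (- m) i" "vertex_shift n 1 j"] Sj v[of i] vertex_shift_less[OF n, of 1 j] by simp
    then show ?thesis
      using uniserial_inj[OF n j refl v, of i x] x 0 by (simp add: dim arr vertex_shift_Suc[OF n])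
  qed
  show "\<exists>x \<in> carrier_vec (dimv (ob ?N ?q) i). arr (ob ?N ?q) i *\<^sub>v x = y"
    if i: "i < n" "i \<noteq> Suc ?j mod n" and y: "y \<in> carrier_vec (dimv (ob ?N ?q) (Suc i mod n))" for i y
  proof -
    have "vertex_shift n (- m) (Suc ?j mod n) = j" unfolding vertex_shift_Suc[OF n] shift by (rule Sj)
    then have "vertex_shift n (- m) i \<noteq> j" using inj[OF _ i(1), of "Suc ?j mod n"] i(2) n by auto
    then show ?thesis
      using uniserial_surj[OF n j refl v, of i y] y by (simp add: dim arr vertex_shift_Suc[OF n])
  qed
qed

theorem corollary2p7:
  fixes n :: nat
  assumes "n \<ge> 1"
  shows "\<not> (\<exists>C :: 'k::field cpx. cluster_tilting (cluster_tube n) (shift_cpx 1) C)"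
proof clarify
  fix C :: "'k cpx"
  assume ct: "cluster_tilting (cluster_tube n) (shift_cpx 1) C"
  have n: "n > 0" using assms by simp
  have rig: "rigid (cluster_tube n) (shift_cpx 1) C" using ct by (simp add: cluster_tilting_def)
  then have C: "is_cpx n C" by (simp add: rigid_def cluster_tube_Obj)
  obtain j where j: "j < n" and H: "\<And>p. cocycles C p (vertex_shift n (- p) j) \<subseteq> coboundaries C p (vertex_shift n (- p) j)"
    using rigid_not_sincere[OF n rig] by blast
  obtain l where l: "\<And>p i x. i < n \<Longrightarrow> x \<in> cochains C p i \<Longrightarrow>
    path_mat n (ob C p) i l *\<^sub>v x = zero_cochain C p ((i + l) mod n)"
    using uniformly_nilpotent[OF C] by blast
  have kC: "path_kills n l C"
    unfolding path_kills_def
  proof (intro allI impI ballI)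
    fix p i x assume i: "i < n" and x: "x \<in> cocycles C p i"
    have "(i + l) mod n < n" using n by simp
    then show "path_mat n (ob C p) i l *\<^sub>v x \<in> coboundaries C p ((i + l) mod n)"
      unfolding l[OF i cocyclesD(1)[OF x]] by (rule coboundaries_zero[OF C])
  qed
  \<comment> \<open>\<open>Suc l\<close> meets the bound \<open>K > l\<close> of
    \<open>uniserial_path_nonzero\<close>: a path of length \<open>l\<close> from the top does not
    act as zero.\<close>
  define V :: "'k rep" where "V = uniserial n j (Suc l)"
  define X where "X = stalk_cpx V"
  have X: "is_cpx n X" unfolding X_def V_def by (rule is_cpx_stalk[OF uniserial_tube[OF n j refl]])
  have "Hom (cluster_tube n) C (shift_cpx 1 X) = {Zer (cluster_tube n) C (shift_cpx 1 X)}"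
  proof (rule orbit_Hom_zeroI[OF C is_cpx_shift[OF X] n])
    fix m r r'
    assume r: "r \<in> roofs n C (F_cpx n m (shift_cpx 1 X))" and r': "r' \<in> roofs n C (F_cpx n m (shift_cpx 1 X))"
    have st: "stalk_target n (F_cpx n m (shift_cpx 1 X)) (- m - 1) (vertex_shift n (m + 1) j)"
      unfolding X_def V_def by (rule stalk_target_uniserial[OF n j])
    \<comment> \<open>The cohomology of \<open>C\<close> has to vanish in degree
      \<open>-m - 1\<close> at the vertex \<open>j - m - 1\<close>, and in degree \<open>-m\<close>
      at the next vertex \<open>j - m\<close>. Both are instances of \<open>H\<close>, which moves
      on by one vertex per degree.\<close>
    have "Suc (vertex_shift n (m + 1) j) mod n = vertex_shift n m j"
      unfolding Suc_mod_eq_vertex_shift[OF n] vertex_shift_add[OF n] by simp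
    then show "roof_equiv n C (F_cpx n m (shift_cpx 1 X)) r r'"
      using stalk_target.roofs_equivalent[OF st C _ _ r r'] H[of "- m - 1"] H[of "- m"] by (simp add: add.commute)
  qed
  then have "Ext1_vanishes (cluster_tube n) (shift_cpx 1) C X" by (simp add: Ext1_vanishes_def)
  then have "X \<in> add_closure (cluster_tube n) C"
    using ct X by (simp add: cluster_tilting_def cluster_tube_Obj)
  then have kX: "path_kills n l X" by (rule path_kills_add_closure[OF n C kC])
  have j': "Suc j mod n < n" using n by simp
  obtain x where x: "x \<in> carrier_vec (dimv V (Suc j mod n))"
    and nz: "path_mat n V (Suc j mod n) l *\<^sub>v x \<noteq> 0\<^sub>v (dimv V ((Suc j mod n + l) mod n))"
    using uniserial_path_nonzero[OF n j V_def, of l] by blast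
  \<comment> \<open>In the stalk complex every vector of degree \<open>0\<close> is a cocycle and
    only zero is a coboundary, so paths act on its cohomology as they act on
    \<open>V\<close>.\<close>
  have "x \<in> cocycles X 0 (Suc j mod n)"
    using x zero_mat_mult_vec[OF x, of 0] by (simp add: cocycles_def X_def stalk_cpx_def)
  then have "path_mat n (ob X 0) (Suc j mod n) l *\<^sub>v x \<in> coboundaries X 0 ((Suc j mod n + l) mod n)"
    using kX j' unfolding path_kills_def by blast
  then obtain y where "y \<in> carrier_vec 0"
    "path_mat n V (Suc j mod n) l *\<^sub>v x = 0\<^sub>m (dimv V ((Suc j mod n + l) mod n)) 0 *\<^sub>v y"
    by (rule coboundariesE) (simp add: X_def stalk_cpx_def)
  then show False using nz zero_mat_mult_vec by metis
qed

end
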